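(* Let $d\ge 2$, $0<p<1$, and let $G=(V,E)$ be the discrete directed spanning forest on $\mathbb Z^d$ with parameter $p$ (defined in the context). For $d=2$ and $d=3$ the random graph $G$ is connected almost surely and consists of a single tree, while for $d\ge 4$ it is, almost surely, a disconnected forest containing infinitely many distinct connected components, each connected component being an infinite tree.
   Context: Write $\mathbf v(j)$ for the $j$-th coordinate of $\mathbf v\in\mathbb Z^d$ and $\|\cdot\|_1$ for the $L_1$ norm. Let $\{U_{\mathbf v}:\mathbf v\in\mathbb Z^d\}$ be i.i.d. uniform $(0,1)$ random variables and let $V:=\{\mathbf v\in\mathbb Z^d: U_{\mathbf v}<p\}$ be the set of open vertices. For $\mathbf u\in\mathbb Z^d$ let $h(\mathbf u)$ be the (almost surely unique) $\mathbf v\in V$ such that: (1) $\mathbf u(d)<\mathbf v(d)$; (2) there is no $\mathbf w\in V$ with $\mathbf w(d)>\mathbf u(d)$ and $\|\mathbf u-\mathbf w\|_1<\|\mathbf u-\mathbf v\|_1$; (3) for all $\mathbf w\in V$ with $\mathbf w(d)>\mathbf u(d)$ and $\|\mathbf u-\mathbf w\|_1=\|\mathbf u-\mathbf v\|_1$ we have $U_{\mathbf v}\le U_{\mathbf w}$. The edge set is $E:=\{\langle\mathbf u,h(\mathbf u)\rangle:\mathbf u\in V\}$ and $G=(V,E)$ is regarded as an undirected graph. *)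

theory Defs
  imports "HOL-Probability.Probability"
begin

text \<open>
  Undirected graphs, possibly infinite, are pairs of a vertex set and a set of edges, an edge
  being the set of its end points. (The notions \<open>forest\<close> and \<open>tree\<close> of the
  AFP entry Graph_Theory only exclude directed cycles and hence do not apply to undirected graphs.)
\<close>

type_synonym 'a ugraph = "'a set \<times> 'a set set"

definition simple_ugraph :: "'a ugraph \<Rightarrow> bool" where
  "simple_ugraph G \<longleftrightarrow> (\<forall>e\<in>snd G. e \<subseteq> fst G \<and> card e = 2)"

definition uwalk :: "'a ugraph \<Rightarrow> 'a list \<Rightarrow> bool" where
  "uwalk G xs \<longleftrightarrow> xs \<noteq> [] \<and> set xs \<subseteq> fst G \<and> successively (\<lambda>u v. {u, v} \<in> snd G) xs"

definition ureachable :: "'a ugraph \<Rightarrow> 'a \<Rightarrow> 'a \<Rightarrow> bool" where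
  "ureachable G u v \<longleftrightarrow> (\<exists>xs. uwalk G xs \<and> hd xs = u \<and> last xs = v)"

definition uconnected :: "'a ugraph \<Rightarrow> bool" where
  "uconnected G \<longleftrightarrow> fst G \<noteq> {} \<and> (\<forall>u\<in>fst G. \<forall>v\<in>fst G. ureachable G u v)"

definition ucycle :: "'a ugraph \<Rightarrow> 'a list \<Rightarrow> bool" where
  "ucycle G xs \<longleftrightarrow> uwalk G xs \<and> distinct xs \<and> length xs \<ge> 3 \<and> {last xs, hd xs} \<in> snd G"

definition uforest :: "'a ugraph \<Rightarrow> bool" where
  "uforest G \<longleftrightarrow> simple_ugraph G \<and> (\<nexists>xs. ucycle G xs)"

definition utree :: "'a ugraph \<Rightarrow> bool" where
  "utree G \<longleftrightarrow> uforest G \<and> uconnected G"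

definition ucomponent_of :: "'a ugraph \<Rightarrow> 'a \<Rightarrow> 'a ugraph" where
  "ucomponent_of G v =
    ({w. ureachable G v w}, {e \<in> snd G. e \<subseteq> {w. ureachable G v w}})"

definition ucomponents :: "'a ugraph \<Rightarrow> 'a ugraph set" where
  "ucomponents G = ucomponent_of G ` fst G"


text \<open>
  Points of \<open>\<int>\<^sup>d\<close> are functions on the index set \<open>{1..d}\<close> (with the value
  \<^const>\<open>undefined\<close> outside), so that the distinguished last coordinate of \<open>v\<close>
  is \<open>v d\<close>.
\<close>

definition lattice_points :: "nat \<Rightarrow> (nat \<Rightarrow> int) set" where
  "lattice_points d = {1..d} \<rightarrow>\<^sub>E UNIV"

definition l1_dist :: "nat \<Rightarrow> (nat \<Rightarrow> int) \<Rightarrow> (nat \<Rightarrow> int) \<Rightarrow> int" where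
  "l1_dist d u v = (\<Sum>j=1..d. \<bar>u j - v j\<bar>)"

text \<open>
  In the following, \<open>U\<close> is a single realization of the family of uniform variables.
\<close>

definition open_vertices :: "nat \<Rightarrow> real \<Rightarrow> ((nat \<Rightarrow> int) \<Rightarrow> real) \<Rightarrow> (nat \<Rightarrow> int) set" where
  "open_vertices d p U = {v \<in> lattice_points d. U v < p}"

definition is_successor ::
  "nat \<Rightarrow> real \<Rightarrow> ((nat \<Rightarrow> int) \<Rightarrow> real) \<Rightarrow> (nat \<Rightarrow> int) \<Rightarrow> (nat \<Rightarrow> int) \<Rightarrow> bool" where
  "is_successor d p U u v \<longleftrightarrow>
     v \<in> open_vertices d p U \<and>
     u d < v d \<and>
     \<not> (\<exists>w\<in>open_vertices d p U. w d > u d \<and> l1_dist d u w < l1_dist d u v) \<and>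
     (\<forall>w\<in>open_vertices d p U. w d > u d \<and> l1_dist d u w = l1_dist d u v \<longrightarrow> U v \<le> U w)"

text \<open>
  For independent uniform \<open>U\<close> and \<open>0 < p\<close>, existence and uniqueness of the
  successor hold almost surely; on the exceptional null set the value is arbitrary.
\<close>

definition successor ::
  "nat \<Rightarrow> real \<Rightarrow> ((nat \<Rightarrow> int) \<Rightarrow> real) \<Rightarrow> (nat \<Rightarrow> int) \<Rightarrow> (nat \<Rightarrow> int)" where
  "successor d p U u = (THE v. is_successor d p U u v)"

definition dsf_graph :: "nat \<Rightarrow> real \<Rightarrow> ((nat \<Rightarrow> int) \<Rightarrow> real) \<Rightarrow> (nat \<Rightarrow> int) ugraph" where
  "dsf_graph d p U =
    (open_vertices d p U, {{u, successor d p U u} | u. u \<in> open_vertices d p U})"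

end

(*
  A vertex x on the path of a is a regeneration point if finding the path up to x only involved
  levels up to that of x. The paths of two points a, b on one level regenerate simultaneously at
  some level T above; the environment above T is then fresh, so the difference of the two paths
  performs a Markov chain on Z^(d-1). On a stretch of n levels a simultaneous regeneration fails
  with probability decaying faster than any power of n, uniformly in a and b: steps are at most of
  order log n, and all vertices of the two paths just below a given level see open vertices
  straight above them with probability at least n^(-1/2).

  As long as T is small against the distance of a and b, the two paths explore disjoint balls, and
  applying one reflection or swap of coordinates about a in the first and about b in the second
  shows that the increments of the chain are centred, uncorrelated and of equal variance. Writing
  rho for the squared distance, ln (ln (rho + 3)) is therefore superharmonic far from the origin if
  d <= 3, and (rho + 1)^(-1/4) is if d >= 4. With the maximum principle, the former implies that
  paths on one level meet almost surely; the latter bounds the probability that they meet by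
  C (rho + 1)^(-1/4), which tends to 0 with the distance.
*)
theory Submission
  imports Defs "HOL-Real_Asymp.Real_Asymp"
begin

section \<open>The lattice and its l1 metric\<close>

text \<open>The successor of \<open>a\<close> is found by searching an upper half ball, whose top
  lies above the successor unless this is straight above \<open>a\<close>. The search reveals levels
  the path has not reached yet, so the path is not Markov in the level; regeneration levels repair
  this. Paths may start at closed points. The chain itself is never constructed. Only its one-step
  kernel \<open>Q\<close> is used, through one-sided inequalities between a meeting probability at a
  difference and its mean after one step. As T is unbounded, \<open>Q\<close> is cut to T at most t;
  the cut respects the symmetries, so the first and mixed second moments vanish exactly, at the
  price of \<open>tail\<close>, which beats every power. In the plane (d = 3) ln rho is harmonic to
  leading order and cannot absorb any error; ln (ln rho) is still unbounded but has drift of order -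
  1 / (rho (ln rho)^2), which dominates errors of order rho^(-3/2 + 3/32). For d >= 4, (rho +
  1)^(-alpha) has negative drift if 0 < alpha < (d - 3) / 2, and alpha = 1/4 fits from d = 4
  on.\<close>

lemma l1_nonneg [simp]: "0 \<le> l1_dist d a b"
  by (simp add: l1_dist_def sum_nonneg)

lemma l1_self [simp]: "l1_dist d a a = 0"
  by (simp add: l1_dist_def)

lemma l1_commute: "l1_dist d a b = l1_dist d b a"
  by (simp add: l1_dist_def abs_minus_commute)

lemma l1_triangle: "l1_dist d a c \<le> l1_dist d a b + l1_dist d b c"
  unfolding l1_dist_def sum.distrib[symmetric] by (rule sum_mono) linarith

lemma l1_coord: "j \<in> {1..d} \<Longrightarrow> \<bar>a j - b j\<bar> \<le> l1_dist d a b"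
  unfolding l1_dist_def by (rule member_le_sum) auto

lemma l1_eq_0:
  assumes "a \<in> lattice_points d" "b \<in> lattice_points d" "l1_dist d a b = 0"
  shows "a = b"
proof -
  have "a j = b j" if "j \<in> {1..d}" for j
    using l1_coord[OF that, of a b] assms(3) by simp
  with assms(1,2) show ?thesis unfolding lattice_points_def by (rule_tac PiE_ext) auto
qed

lemma l1_ball_subset_box:
  "{w \<in> lattice_points d. l1_dist d a w \<le> r} \<subseteq> (\<Pi>\<^sub>E j\<in>{1..d}. {a j - r..a j + r})"
proof
  fix w assume "w \<in> {w \<in> lattice_points d. l1_dist d a w \<le> r}"
  hence w: "w \<in> lattice_points d" "l1_dist d a w \<le> r" by auto
  have "w j \<in> {a j - r..a j + r}" if "j \<in> {1..d}" for j
    using l1_coord[OF that, of a w] w(2) by auto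
  with w(1) show "w \<in> (\<Pi>\<^sub>E j\<in>{1..d}. {a j - r..a j + r})"
    by (auto simp: lattice_points_def PiE_iff)
qed

lemma finite_l1_ball: "finite {w \<in> lattice_points d. l1_dist d a w \<le> r}"
  by (rule finite_subset[OF l1_ball_subset_box]) (intro finite_PiE; auto)

lemma countable_lattice_points [simp]: "countable (lattice_points d)"
  unfolding lattice_points_def by (intro countable_PiE) auto

locale dsf =
  fixes d :: nat and p :: real
  assumes d_ge_2: "2 \<le> d" and p_pos: "0 < p" and p_less_1: "p < 1"
begin

abbreviation "L \<equiv> lattice_points d"
abbreviation "dl \<equiv> l1_dist d"
abbreviation "hop \<equiv> is_successor d p"

lemma d_in [simp]: "d \<in> {1..d}" "Suc 0 \<le> d"
  using d_ge_2 by auto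

lemma level_le_dl: "\<bar>a d - b d\<bar> \<le> dl a b"
  using l1_coord[of d d a b] by simp

lemma upd_in_L: "a \<in> L \<Longrightarrow> a(d := k) \<in> L"
  by (auto simp: lattice_points_def PiE_iff extensional_def)

lemma dl_split: "dl a b = (\<Sum>j\<in>{1..d} - {d}. \<bar>a j - b j\<bar>) + \<bar>a d - b d\<bar>"
  unfolding l1_dist_def by (subst sum.remove[of _ d]) auto

lemma dl_apex [simp]: "dl a (a(d := k)) = \<bar>a d - k\<bar>"
  unfolding dl_split by simp

text \<open>The level difference already uses up the whole distance, so no other coordinate can
  differ. This makes an open vertex one level straight above a point its forced successor.\<close>

lemma apex_unique:
  assumes "a \<in> L" "b \<in> L" "dl a b \<le> \<bar>a d - b d\<bar>"
  shows "b = a(d := b d)"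
proof (rule PiE_ext[of _ "{1..d}" "\<lambda>_. UNIV"])
  show "b \<in> {1..d} \<rightarrow>\<^sub>E UNIV" "a(d := b d) \<in> {1..d} \<rightarrow>\<^sub>E UNIV"
    using assms upd_in_L[of a] by (auto simp: lattice_points_def)
  have "(\<Sum>j\<in>{1..d} - {d}. \<bar>a j - b j\<bar>) \<le> 0"
    using assms(3) unfolding dl_split by linarith
  hence "(\<Sum>j\<in>{1..d} - {d}. \<bar>a j - b j\<bar>) = 0"
    by (intro antisym sum_nonneg) auto
  hence "\<forall>j\<in>{1..d} - {d}. a j = b j"
    by (subst (asm) sum_nonneg_eq_0_iff) auto
  thus "b j = (a(d := b d)) j" if "j \<in> {1..d}" for j
    using that by auto
qed

section \<open>The successor relation\<close>

lemma hopD: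
  assumes "hop U a b"
  shows "b \<in> L" "U b < p" "a d < b d"
    "\<And>w. w \<in> L \<Longrightarrow> U w < p \<Longrightarrow> a d < w d \<Longrightarrow> dl a b \<le> dl a w"
    "\<And>w. w \<in> L \<Longrightarrow> U w < p \<Longrightarrow> a d < w d \<Longrightarrow> dl a w = dl a b \<Longrightarrow> U b \<le> U w"
  using assms unfolding is_successor_def open_vertices_def
  by (auto simp: not_less)

lemma hopI:
  assumes "b \<in> L" "U b < p" "a d < b d"
    "\<And>w. w \<in> L \<Longrightarrow> U w < p \<Longrightarrow> a d < w d \<Longrightarrow> dl a b \<le> dl a w"
    "\<And>w. w \<in> L \<Longrightarrow> U w < p \<Longrightarrow> a d < w d \<Longrightarrow> dl a w = dl a b \<Longrightarrow> U b \<le> U w"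
  shows "hop U a b"
  using assms unfolding is_successor_def open_vertices_def
  by (fastforce simp: not_less)

text \<open>With a single open candidate there is no tie to break. Hence a step can be forced by
  prescribing finitely many vertices as open or closed.\<close>

lemma hop_unique_nearest:
  assumes "b \<in> L" "U b < p" "a d < b d"
    "\<And>w. w \<in> L \<Longrightarrow> a d < w d \<Longrightarrow> dl a w \<le> dl a b \<Longrightarrow> w \<noteq> b \<Longrightarrow> p \<le> U w"
  shows "hop U a b"
proof (rule hopI)
  show "dl a b \<le> dl a w" if "w \<in> L" "U w < p" "a d < w d" for w
    using assms(4)[of w] that by (cases "w = b") auto
  show "U b \<le> U w" if "w \<in> L" "U w < p" "a d < w d" "dl a w = dl a b" for w
    using assms(4)[of w] that by (cases "w = b") auto
qed (use assms in auto)

text \<open>Locality of the search: a vertex farther from \<open>a\<close> than \<open>b\<close>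
  loses against \<open>b\<close> whatever its value.\<close>

lemma hop_cong:
  assumes "hop U a b"
    and "\<And>w. w \<in> L \<Longrightarrow> a d < w d \<Longrightarrow> dl a w \<le> dl a b \<Longrightarrow> U w = U' w"
  shows "hop U' a b"
proof (rule hopI)
  note n = hopD[OF assms(1)]
  show "b \<in> L" "a d < b d" by (fact n)+
  show "U' b < p" using n assms(2)[of b] by simp
  show "dl a b \<le> dl a w" if "w \<in> L" "U' w < p" "a d < w d" for w
    using n(4)[of w] assms(2)[of w] that by (cases "dl a w \<le> dl a b") auto
  show "U' b \<le> U' w" if "w \<in> L" "U' w < p" "a d < w d" "dl a w = dl a b" for w
    using n(1-3) n(5)[of w] assms(2)[of w] assms(2)[of b] that by auto
qed

lemma hop_unique:
  assumes "inj_on U (open_vertices d p U)" "hop U a b" "hop U a c"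
  shows "b = c"
proof -
  note b = hopD[OF assms(2)] and c = hopD[OF assms(3)]
  have "dl a b = dl a c" using b(4)[of c] c(4)[of b] b(1-3) c(1-3) by auto
  hence "U b = U c" using b(5)[of c] c(5)[of b] b(1-3) c(1-3) by auto
  thus ?thesis using assms(1) b(1,2) c(1,2) by (auto simp: inj_on_def open_vertices_def)
qed

lemma hop_ex:
  assumes "w \<in> L" "U w < p" "a d < w d"
  shows "\<exists>b. hop U a b"
proof -
  define B where "B = {v \<in> L. dl a v \<le> dl a w \<and> U v < p \<and> a d < v d}"
  have fB: "finite B" unfolding B_def
    by (rule finite_subset[OF _ finite_l1_ball[of d a "dl a w"]]) auto
  have "B \<noteq> {}" using assms by (auto simp: B_def)
  then obtain b0 where b0: "b0 \<in> B" "\<And>v. v \<in> B \<Longrightarrow> dl a b0 \<le> dl a v"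
    using ex_is_arg_min_if_finite[OF fB, of "dl a"] unfolding is_arg_min_linorder by metis
  define C where "C = {v \<in> B. dl a v = dl a b0}"
  have fC: "finite C" "C \<noteq> {}" using fB b0 by (auto simp: C_def)
  then obtain b where b: "b \<in> C" "\<And>v. v \<in> C \<Longrightarrow> U b \<le> U v"
    using ex_is_arg_min_if_finite[OF fC, of U] unfolding is_arg_min_linorder by metis
  have "hop U a b"
  proof (rule hopI)
    show "b \<in> L" "U b < p" "a d < b d" using b(1) by (auto simp: C_def B_def)
    show *: "dl a b \<le> dl a v" if "v \<in> L" "U v < p" "a d < v d" for v
      using b(1) b0(2)[of v] that by (cases "v \<in> B") (auto simp: C_def B_def)
    show "U b \<le> U v" if "v \<in> L" "U v < p" "a d < v d" "dl a v = dl a b" for v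
      using b(1) b(2)[of v] that by (auto simp: C_def B_def)
  qed
  thus ?thesis by blast
qed

section \<open>Paths of successors\<close>

definition trail :: "((nat \<Rightarrow> int) \<Rightarrow> real) \<Rightarrow> (nat \<Rightarrow> int) \<Rightarrow> (nat \<Rightarrow> int) \<Rightarrow> bool" where
  "trail U = (hop U)\<^sup>*\<^sup>*"

lemma trail_refl [simp]: "trail U a a"
  by (simp add: trail_def)

lemma trail_trans: "trail U a b \<Longrightarrow> trail U b c \<Longrightarrow> trail U a c"
  by (simp add: trail_def)

lemma trail_level: "trail U a b \<Longrightarrow> a = b \<or> a d < b d"
  unfolding trail_def by (induction rule: rtranclp_induct) (auto dest: hopD(3))

lemma trail_level_le: "trail U a b \<Longrightarrow> a d \<le> b d"
  using trail_level[of U a b] by auto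

lemma trail_below_induct [consumes 2, case_names base step]:
  assumes "trail U a b" "b d \<le> l" "P a"
    and "\<And>c e. trail U a c \<Longrightarrow> hop U c e \<Longrightarrow> c d \<le> l \<Longrightarrow> e d \<le> l \<Longrightarrow> P c \<Longrightarrow> P e"
  shows "P b"
proof -
  have "b d \<le> l \<longrightarrow> P b"
    using assms(1) unfolding trail_def
  proof (induction rule: rtranclp_induct)
    case (step c e)
    with hopD(3)[OF step(2)] assms(4)[of c e] show ?case by (auto simp: trail_def)
  qed (simp add: assms(3))
  with assms(2) show ?thesis by blast
qed

lemma trail_in_L: "trail U a b \<Longrightarrow> a \<in> L \<Longrightarrow> b \<in> L"
  unfolding trail_def by (induction rule: rtranclp_induct) (auto dest: hopD(1))

text \<open>Successors are unique, so the path of \<open>a\<close> is a single chain, ordered by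
  level.\<close>

lemma trail_linear:
  assumes "inj_on U (open_vertices d p U)" "trail U a x" "trail U a y" "x d \<le> y d"
  shows "trail U x y"
  using assms(2,3,4) unfolding trail_def
proof (induction rule: converse_rtranclp_induct)
  case (step a c)
  note hop = step(1) and IH = step(3) and lev = step(5)
  from step(4) show ?case
  proof (cases rule: converse_rtranclpE)
    case base
    with lev hopD(3)[OF hop] trail_level_le[of U c x] step(2) show ?thesis
      by (auto simp: trail_def)
  next
    case (step c')
    with hop_unique[OF assms(1) hop] IH lev show ?thesis by auto
  qed
qed auto

lemma trail_same_level:
  assumes "inj_on U (open_vertices d p U)" "trail U a x" "trail U a y" "x d = y d"
  shows "x = y"
  using trail_linear[OF assms(1-3)] trail_level[of U x y] assms(4) by auto

lemma trail_cong:
  assumes "trail U a b" "\<And>w. w \<in> L \<Longrightarrow> a d < w d \<Longrightarrow> U w = U' w"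
  shows "trail U' a b"
  using assms(1) unfolding trail_def
proof (induction rule: rtranclp_induct)
  case (step b c)
  have "hop U' b c"
    using step(2)
  proof (rule hop_cong)
    fix w assume "w \<in> L" "b d < w d"
    with trail_level_le[of U a b] step(1) show "U w = U' w"
      by (intro assms(2)) (auto simp: trail_def)
  qed
  with step show ?case by auto
qed auto

section \<open>Regeneration points\<close>

text \<open>
  \<open>reg U a x\<close>: the path from \<open>a\<close> to \<open>x\<close> has been found by looking only at vertices
  on levels up to that of \<open>x\<close>, so that the environment above \<open>x\<close> is still fresh.
\<close>

definition st :: "((nat \<Rightarrow> int) \<Rightarrow> real) \<Rightarrow> int \<Rightarrow> (nat \<Rightarrow> int) \<Rightarrow> (nat \<Rightarrow> int) \<Rightarrow> bool" where
  "st U l a b \<longleftrightarrow> hop U a b \<and> a d + dl a b \<le> l"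

definition reg :: "((nat \<Rightarrow> int) \<Rightarrow> real) \<Rightarrow> (nat \<Rightarrow> int) \<Rightarrow> (nat \<Rightarrow> int) \<Rightarrow> bool" where
  "reg U a x = (st U (x d))\<^sup>*\<^sup>* a x"

lemma st_trail: "(st U l)\<^sup>*\<^sup>* a x \<Longrightarrow> trail U a x"
  unfolding trail_def by (erule rtranclp_mono[THEN predicate2D, rotated]) (auto simp: st_def)

lemma reg_trail: "reg U a x \<Longrightarrow> trail U a x"
  unfolding reg_def by (rule st_trail)

text \<open>A step of \<open>st U l\<close> from \<open>c\<close> to \<open>e\<close> searches a
  ball whose top \<open>c d + dl c e\<close> is at most \<open>l\<close>, so its length is at most
  \<open>l - a d\<close>. Every step climbs at least one level, which bounds the number of steps by
  \<open>c d - a d\<close>. All that is searched thus lies within \<open>(l - a d)\<^sup>2\<close>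
  of \<open>a\<close>, the origin of the squared radii below.\<close>

lemma st_invariant:
  assumes "(st U l)\<^sup>*\<^sup>* a c" "a \<in> L"
    and "\<And>w. w \<in> L \<Longrightarrow> a d < w d \<Longrightarrow> w d \<le> l \<Longrightarrow> dl a w \<le> (l - a d)\<^sup>2 \<Longrightarrow> U w = U' w"
  shows "(st U' l)\<^sup>*\<^sup>* a c \<and> c \<in> L \<and> (c = a \<or> c d \<le> l) \<and> dl a c \<le> (c d - a d) * (l - a d)"
  using assms(1)
proof (induction rule: rtranclp_induct)
  case (step c e)
  have ce: "hop U c e" "c d + dl c e \<le> l" using step(2) by (auto simp: st_def)
  note n = hopD[OF ce(1)]
  have ac: "a d \<le> c d" using trail_level_le[OF st_trail[OF step(1)]] .
  have el: "e d \<le> l" using ce(2) level_le_dl[of c e] by linarith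
  have lda: "l - a d \<ge> 0" using el n(3) ac by linarith
  have r: "dl a w \<le> (e d - a d) * (l - a d)" if "dl c w \<le> dl c e" for w
  proof -
    have "dl a w \<le> dl a c + dl c w" by (rule l1_triangle)
    also have "\<dots> \<le> (c d - a d) * (l - a d) + (l - a d)"
      using step(3) that ce(2) ac by linarith
    also have "\<dots> = (c d - a d + 1) * (l - a d)" by (simp add: algebra_simps)
    also have "\<dots> \<le> (e d - a d) * (l - a d)"
      using n(3) lda by (intro mult_right_mono) auto
    finally show ?thesis .
  qed
  have "hop U' c e"
    using ce(1)
  proof (rule hop_cong)
    fix w assume w: "w \<in> L" "c d < w d" "dl c w \<le> dl c e"
    show "U w = U' w"
    proof (rule assms(3))
      show "a d < w d" using w ac by linarith
      show "w d \<le> l" using w ce(2) level_le_dl[of c w] by linarith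
      have "(e d - a d) * (l - a d) \<le> (l - a d) * (l - a d)"
        using el lda by (intro mult_right_mono) auto
      with r[OF w(3)] show "dl a w \<le> (l - a d)\<^sup>2" by (simp add: power2_eq_square)
    qed fact
  qed
  with step ce el r[of e] n(1) show ?case
    by (auto simp: st_def intro: rtranclp.rtrancl_into_rtrancl)
qed (use assms in auto)

lemma reg_cong:
  assumes "reg U a x" "a \<in> L"
    and "\<And>w. w \<in> L \<Longrightarrow> a d < w d \<Longrightarrow> w d \<le> x d \<Longrightarrow> dl a w \<le> (x d - a d)\<^sup>2 \<Longrightarrow> U w = U' w"
  shows "reg U' a x"
  using st_invariant[of U "x d" a x U'] assms unfolding reg_def by blast

lemma reg_ball: "reg U a x \<Longrightarrow> a \<in> L \<Longrightarrow> x \<in> L \<and> dl a x \<le> (x d - a d)\<^sup>2"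
  using st_invariant[of U "x d" a x U] unfolding reg_def power2_eq_square by blast

text \<open>Demanding \<open>a d < x d\<close> rules out the trivial regeneration by the empty path,
  so each round of the chain consumes at least one level.\<close>

definition joint :: "((nat \<Rightarrow> int) \<Rightarrow> real) \<Rightarrow> (nat \<Rightarrow> int) \<Rightarrow> (nat \<Rightarrow> int) \<Rightarrow> int \<Rightarrow> bool" where
  "joint U a b n \<longleftrightarrow> (\<exists>x y. x d = y d \<and> a d < x d \<and> x d \<le> n \<and> reg U a x \<and> reg U b y)"

definition FR :: "((nat \<Rightarrow> int) \<Rightarrow> real) \<Rightarrow> (nat \<Rightarrow> int) \<Rightarrow> (nat \<Rightarrow> int) \<Rightarrow> (nat \<Rightarrow> int) \<Rightarrow> (nat \<Rightarrow> int) \<Rightarrow> bool"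
  where "FR U a b x y \<longleftrightarrow>
    x d = y d \<and> a d < x d \<and> reg U a x \<and> reg U b y \<and> \<not> joint U a b (x d - 1)"

lemma joint_iff_FR: "joint U a b n \<longleftrightarrow> (\<exists>x y. FR U a b x y \<and> x d \<le> n)"
proof
  assume j: "joint U a b n"
  define P where "P m \<longleftrightarrow> joint U a b (a d + int m)" for m
  have "a d < n" using j by (auto simp: joint_def)
  hence "P (nat (n - a d))" using j by (auto simp: P_def)
  hence P: "P (LEAST m. P m)" and le: "(LEAST m. P m) \<le> nat (n - a d)"
    by (auto intro: LeastI Least_le)
  define m where "m = (LEAST m. P m)"
  from P obtain x y where xy: "x d = y d" "a d < x d" "x d \<le> a d + int m" "reg U a x" "reg U b y"
    unfolding P_def joint_def m_def by auto
  have "\<not> joint U a b (x d - 1)"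
  proof
    assume "joint U a b (x d - 1)"
    hence "P (nat (x d - 1 - a d))" using xy(2) by (simp add: P_def)
    hence "m \<le> nat (x d - 1 - a d)" unfolding m_def by (rule Least_le)
    with xy(2,3) show False by linarith
  qed
  moreover have "x d \<le> n" using xy(3) le \<open>a d < n\<close> unfolding m_def by linarith
  ultimately show "\<exists>x y. FR U a b x y \<and> x d \<le> n" using xy unfolding FR_def by blast
qed (auto simp: FR_def joint_def)

lemma FR_unique:
  assumes inj: "inj_on U (open_vertices d p U)" and "FR U a b x y" "FR U a b x' y'"
  shows "x = x' \<and> y = y'"
proof -
  have "\<not> x d < x' d" "\<not> x' d < x d"
    using assms(2,3) unfolding FR_def joint_def by force+
  hence "x d = x' d" by simp
  with assms(2,3) trail_same_level[OF inj, of a x x'] trail_same_level[OF inj, of b y y']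
  show ?thesis by (auto simp: FR_def dest: reg_trail)
qed

section \<open>Coalescence of two paths\<close>

definition meets :: "((nat \<Rightarrow> int) \<Rightarrow> real) \<Rightarrow> (nat \<Rightarrow> int) \<Rightarrow> (nat \<Rightarrow> int) \<Rightarrow> bool" where
  "meets U a b \<longleftrightarrow> (\<exists>m. trail U a m \<and> trail U b m)"

definition meetsn :: "nat \<Rightarrow> ((nat \<Rightarrow> int) \<Rightarrow> real) \<Rightarrow> (nat \<Rightarrow> int) \<Rightarrow> (nat \<Rightarrow> int) \<Rightarrow> bool" where
  "meetsn n U a b \<longleftrightarrow> (\<exists>m. trail U a m \<and> trail U b m \<and> m d \<le> a d + int n)"

lemma meets_FR:
  assumes "FR U a b x y" "meets U x y" shows "meets U a b"
  using assms unfolding FR_def meets_def by (meson trail_trans reg_trail)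

text \<open>The joint regeneration lies at least one level above \<open>a\<close>, so one of the
  \<open>Suc n\<close> levels is used up. If the paths meet before it, they have merged and
  \<open>x = y\<close>.\<close>

lemma meetsn_FR:
  assumes inj: "inj_on U (open_vertices d p U)" and F: "FR U a b x y" and M: "meetsn (Suc n) U a b"
  shows "meetsn n U x y"
proof -
  from M obtain m where m: "trail U a m" "trail U b m" "m d \<le> a d + int (Suc n)"
    unfolding meetsn_def by auto
  have xy: "trail U a x" "trail U b y" "x d = y d" "a d < x d"
    using F by (auto simp: FR_def dest: reg_trail)
  show ?thesis
  proof (cases "x d \<le> m d")
    case True
    have "trail U x m" "trail U y m"
      using trail_linear[OF inj xy(1) m(1)] trail_linear[OF inj xy(2) m(2)] xy True by auto
    with m(3) xy(4) show ?thesis unfolding meetsn_def by force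
  next
    case False
    have "trail U m x" "trail U m y"
      using trail_linear[OF inj m(1) xy(1)] trail_linear[OF inj m(2) xy(2)] xy False by auto
    hence "x = y" using trail_same_level[OF inj] xy(3) by blast
    thus ?thesis unfolding meetsn_def by (intro exI[of _ x]) auto
  qed
qed

lemma meetsn_0: "meetsn 0 U a b \<Longrightarrow> a d = b d \<Longrightarrow> a = b"
  unfolding meetsn_def by (auto dest!: trail_level)

lemma meets_iff_meetsn: "meets U a b \<longleftrightarrow> (\<exists>n. meetsn n U a b)"
proof
  assume "meets U a b"
  then obtain m where m: "trail U a m" "trail U b m" by (auto simp: meets_def)
  have "meetsn (nat (m d - a d)) U a b"
    unfolding meetsn_def using m trail_level_le[OF m(1)] by (intro exI[of _ m]) auto
  thus "\<exists>n. meetsn n U a b" ..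
qed (auto simp: meets_def meetsn_def)

lemma meetsn_mono: "meetsn n U a b \<Longrightarrow> n \<le> m \<Longrightarrow> meetsn m U a b"
  unfolding meetsn_def by force

section \<open>Isometries of the lattice\<close>

definition iso :: "((nat \<Rightarrow> int) \<Rightarrow> (nat \<Rightarrow> int)) \<Rightarrow> int \<Rightarrow> bool" where
  "iso s k \<longleftrightarrow> bij_betw s L L \<and> (\<forall>u\<in>L. \<forall>w\<in>L. dl (s u) (s w) = dl u w) \<and> (\<forall>w\<in>L. s w d = w d + k)"

text \<open>\<open>s\<close> carries paths of \<open>pull s U\<close> to paths of \<open>U\<close>.
  The restriction to \<open>L\<close> keeps the result in the space of the product measure.\<close>

definition pull :: "((nat \<Rightarrow> int) \<Rightarrow> (nat \<Rightarrow> int)) \<Rightarrow> ((nat \<Rightarrow> int) \<Rightarrow> real) \<Rightarrow> ((nat \<Rightarrow> int) \<Rightarrow> real)" where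
  "pull s U = (\<lambda>v\<in>L. U (s v))"

lemma isoD:
  assumes "iso s k"
  shows "bij_betw s L L" "\<And>u w. u \<in> L \<Longrightarrow> w \<in> L \<Longrightarrow> dl (s u) (s w) = dl u w"
    "\<And>w. w \<in> L \<Longrightarrow> s w d = w d + k" "\<And>w. w \<in> L \<Longrightarrow> s w \<in> L" "s ` L = L" "inj_on s L"
  using assms by (auto simp: iso_def bij_betw_def)

lemma iso_inv:
  assumes "iso s k"
  shows "iso (the_inv_into L s) (- k)"
proof -
  note i = isoD[OF assms]
  have f: "s (the_inv_into L s w) = w" "the_inv_into L s w \<in> L" if "w \<in> L" for w
    using f_the_inv_into_f[OF i(6), of w] the_inv_into_into[OF i(6), of w L] that i(5) by auto
  show ?thesis unfolding iso_def
  proof (intro conjI ballI)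
    show "bij_betw (the_inv_into L s) L L" by (rule bij_betw_the_inv_into) (rule i)
  next
    fix u w assume "u \<in> L" "w \<in> L"
    thus "dl (the_inv_into L s u) (the_inv_into L s w) = dl u w"
      using i(2)[of "the_inv_into L s u" "the_inv_into L s w"] f by simp
  next
    fix w assume "w \<in> L"
    thus "the_inv_into L s w d = w d + - k"
      using i(3)[of "the_inv_into L s w"] f by simp
  qed
qed

lemma hop_iso:
  assumes "iso s k" "hop (pull s U) a b" "a \<in> L"
  shows "hop U (s a) (s b)"
proof -
  note i = isoD[OF assms(1)] and n = hopD[OF assms(2)]
  show ?thesis
  proof (rule hopI)
    show "s b \<in> L" "U (s b) < p" "s a d < s b d"
      using n(1-3) i assms(3) by (auto simp: pull_def)
    show "dl (s a) (s b) \<le> dl (s a) w" if w: "w \<in> L" "U w < p" "s a d < w d" for w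
    proof -
      obtain v where v: "w = s v" "v \<in> L" using w(1) i(5) by (metis imageE)
      show ?thesis using w n(4)[of v] v by (auto simp: pull_def i assms(3) n(1))
    qed
    show "U (s b) \<le> U w" if w: "w \<in> L" "U w < p" "s a d < w d" "dl (s a) w = dl (s a) (s b)" for w
    proof -
      obtain v where v: "w = s v" "v \<in> L" using w(1) i(5) by (metis imageE)
      show ?thesis using w n(5)[of v] v n(1) by (auto simp: pull_def i assms(3))
    qed
  qed
qed

lemma pull_inv:
  assumes "iso s k" "w \<in> L"
  shows "pull (the_inv_into L s) (pull s U) w = U w"
proof -
  note i = isoD[OF assms(1)] isoD[OF iso_inv[OF assms(1)]]
  show ?thesis using assms(2) i f_the_inv_into_f[OF i(6), of w]
    by (auto simp: pull_def)
qed

lemma st_iso: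
  assumes "iso s k" "(st (pull s U) l)\<^sup>*\<^sup>* a b" "a \<in> L"
  shows "(st U (l + k))\<^sup>*\<^sup>* (s a) (s b)"
  using assms(2)
proof (induction rule: rtranclp_induct)
  case (step b c)
  note i = isoD[OF assms(1)]
  have bL: "b \<in> L" using trail_in_L[OF st_trail[OF step(1)] assms(3)] .
  have bc: "hop (pull s U) b c" "b d + dl b c \<le> l" using step(2) by (auto simp: st_def)
  have cL: "c \<in> L" using hopD(1)[OF bc(1)] .
  have "st U (l + k) (s b) (s c)"
    unfolding st_def using hop_iso[OF assms(1) bc(1) bL] i(2)[OF bL cL] i(3)[OF bL] bc(2) by auto
  with step show ?case by auto
qed auto

lemma reg_iso1:
  assumes "iso s k" "reg (pull s U) a b" "a \<in> L"
  shows "reg U (s a) (s b)"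
  using st_iso[OF assms(1) _ assms(3), of U "b d" b] assms isoD(3)[OF assms(1), of b]
    reg_ball[OF assms(2,3)] by (auto simp: reg_def)

lemma reg_iso:
  assumes "iso s k" "a \<in> L" "x \<in> L"
  shows "reg (pull s U) a x \<longleftrightarrow> reg U (s a) (s x)"
proof
  note i = isoD[OF assms(1)]
  assume "reg U (s a) (s x)"
  \<comment> \<open>The converse is the forward direction for the inverse isometry, which undoes
    \<open>pull s\<close> on \<open>L\<close>.\<close>
  hence "reg (pull (the_inv_into L s) (pull s U)) (s a) (s x)"
    by (rule reg_cong) (use assms i in \<open>auto simp: pull_inv[OF assms(1)]\<close>)
  from reg_iso1[OF iso_inv[OF assms(1)] this] show "reg (pull s U) a x"
    using assms i by (simp add: the_inv_into_f_f)
qed (use assms in \<open>auto intro: reg_iso1\<close>)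

lemma trail_iso1:
  assumes "iso s k" "trail (pull s U) a b" "a \<in> L"
  shows "trail U (s a) (s b)"
  using assms(2) unfolding trail_def
proof (induction rule: rtranclp_induct)
  case (step b c)
  have "b \<in> L" using step(1) assms(3) trail_in_L by (auto simp: trail_def)
  from hop_iso[OF assms(1) step(2) this] step(3) show ?case by auto
qed auto

lemma trail_iso:
  assumes "iso s k" "a \<in> L" "x \<in> L"
  shows "trail (pull s U) a x \<longleftrightarrow> trail U (s a) (s x)"
proof
  note i = isoD[OF assms(1)]
  assume "trail U (s a) (s x)"
  hence "trail (pull (the_inv_into L s) (pull s U)) (s a) (s x)"
    by (rule trail_cong) (use assms i in \<open>auto simp: pull_inv[OF assms(1)]\<close>)
  from trail_iso1[OF iso_inv[OF assms(1)] this] show "trail (pull s U) a x"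
    using assms i by (simp add: the_inv_into_f_f)
qed (use assms in \<open>auto intro: trail_iso1\<close>)

lemma meetsn_iso:
  assumes "iso s k" "a \<in> L" "b \<in> L"
  shows "meetsn n (pull s U) a b \<longleftrightarrow> meetsn n U (s a) (s b)"
proof
  note i = isoD[OF assms(1)]
  show "meetsn n U (s a) (s b)" if "meetsn n (pull s U) a b"
  proof -
    from that obtain m where m: "trail (pull s U) a m" "trail (pull s U) b m" "m d \<le> a d + int n"
      by (auto simp: meetsn_def)
    have "m \<in> L" using trail_in_L[OF m(1) assms(2)] .
    thus ?thesis unfolding meetsn_def
      using m trail_iso1[OF assms(1)] assms i(3) by (intro exI[of _ "s m"]) auto
  qed
  show "meetsn n (pull s U) a b" if "meetsn n U (s a) (s b)"
  proof -
    from that obtain m where m: "trail U (s a) m" "trail U (s b) m" "m d \<le> s a d + int n"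
      by (auto simp: meetsn_def)
    have "m \<in> L" using trail_in_L[OF m(1)] assms i by auto
    then obtain m' where m': "m = s m'" "m' \<in> L" using i(5) by (metis imageE)
    show ?thesis unfolding meetsn_def
      using m trail_iso[OF assms(1)] assms i(3) m' by (intro exI[of _ m']) auto
  qed
qed

lemma meets_iso:
  assumes "iso s k" "a \<in> L" "b \<in> L"
  shows "meets (pull s U) a b \<longleftrightarrow> meets U (s a) (s b)"
  using meetsn_iso[OF assms] by (simp add: meets_iff_meetsn)

end

section \<open>The product measure on environments\<close>

definition UU :: "real measure" where "UU = uniform_measure lborel {0<..<1}"

lemma prob_space_UU: "prob_space UU"
  unfolding UU_def by (rule prob_space_uniform_measure) auto

lemma sets_UU [simp, measurable_cong]: "sets UU = sets borel" and space_UU [simp]: "space UU = UNIV"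
  by (simp_all add: UU_def)

lemma measure_UU_atLeastLessThan:
  assumes "0 \<le> a" "a \<le> b" "b \<le> 1"
  shows "measure UU {a..<b} = b - a"
proof -
  have "emeasure UU {a..<b} = emeasure lborel ({0<..<1} \<inter> {a..<b}) / emeasure lborel {0<..<1::real}"
    unfolding UU_def by (rule emeasure_uniform_measure) auto
  also have "emeasure lborel ({0<..<1} \<inter> {a..<b}) = ennreal (b - a)"
  proof (rule antisym)
    have "emeasure lborel ({0<..<1} \<inter> {a..<b}) \<le> emeasure lborel {a..<b}"
      by (rule emeasure_mono) auto
    thus "emeasure lborel ({0<..<1} \<inter> {a..<b}) \<le> ennreal (b - a)" using assms by simp
    have "emeasure lborel {a<..<b} \<le> emeasure lborel ({0<..<1} \<inter> {a..<b})"
      by (rule emeasure_mono) (use assms in auto)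
    thus "ennreal (b - a) \<le> emeasure lborel ({0<..<1} \<inter> {a..<b})" using assms by simp
  qed
  finally show ?thesis using assms by (simp add: measure_def divide_ennreal_def)
qed

lemma AE_UU_bounds: "AE x in UU. 0 < x \<and> x < 1"
  unfolding UU_def by (rule AE_uniform_measureI) auto

lemma measure_UU_lessThan:
  assumes "0 \<le> p" "p \<le> 1"
  shows "measure UU {..<p} = p" "measure UU {p..} = 1 - p"
proof -
  interpret UU: prob_space UU by (rule prob_space_UU)
  have "measure UU {..<p} = measure UU {0..<p}"
    by (rule UU.finite_measure_eq_AE) (use AE_UU_bounds in \<open>auto elim!: eventually_mono\<close>)
  also have "\<dots> = p" using measure_UU_atLeastLessThan[of 0 p] assms by simp
  finally show 1: "measure UU {..<p} = p" .
  have "{p..} = space UU - {..<p}" by auto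
  thus "measure UU {p..} = 1 - p" using UU.prob_compl[of "{..<p}"] 1 by simp
qed

context dsf
begin

definition N :: "((nat \<Rightarrow> int) \<Rightarrow> real) measure" where "N = (\<Pi>\<^sub>M v\<in>L. UU)"

sublocale N: prob_space N
  unfolding N_def by (intro prob_space_PiM prob_space_UU)

lemma component_measurable [measurable]: "v \<in> L \<Longrightarrow> (\<lambda>U. U v) \<in> borel_measurable N"
  unfolding N_def using measurable_component_singleton[of v L "\<lambda>_. UU"]
  by (simp cong: measurable_cong_sets)

text \<open>Together with measurability on \<open>N\<close>, this stands in for measurability with
  respect to the coordinates in \<open>I\<close>.\<close>

definition depends :: "(((nat \<Rightarrow> int) \<Rightarrow> real) \<Rightarrow> 'b) \<Rightarrow> (nat \<Rightarrow> int) set \<Rightarrow> bool" where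
  "depends P I \<longleftrightarrow> (\<forall>U U'. (\<forall>v\<in>I. U v = U' v) \<longrightarrow> P U = P U')"

lemma dependsD: "depends P I \<Longrightarrow> (\<And>v. v \<in> I \<Longrightarrow> U v = U' v) \<Longrightarrow> P U = P U'"
  unfolding depends_def by blast

lemma cylinder_prob:
  assumes "finite A" "A \<subseteq> L" "\<And>v. v \<in> A \<Longrightarrow> X v \<in> sets borel"
  shows "N.prob {U \<in> space N. \<forall>v\<in>A. U v \<in> X v} = (\<Prod>v\<in>A. measure UU (X v))"
proof -
  interpret P: product_prob_space "\<lambda>_. UU" L
    by (intro product_prob_spaceI prob_space_UU)
  have "{U \<in> space N. \<forall>v\<in>A. U v \<in> X v} = prod_emb L (\<lambda>_. UU) A (Pi\<^sub>E A X)"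
    using assms(2) unfolding N_def prod_emb_def space_PiM by (auto simp: PiE_iff extensional_def)
  thus ?thesis using P.measure_PiM_emb[OF assms(2,1), of X] assms(3) by (simp add: N_def)
qed

lemma open_closed_prob:
  assumes "finite A" "finite B" "A \<subseteq> L" "B \<subseteq> L" "A \<inter> B = {}"
  shows "N.prob {U \<in> space N. (\<forall>v\<in>A. U v < p) \<and> (\<forall>v\<in>B. p \<le> U v)} = p ^ card A * (1 - p) ^ card B"
proof -
  define X where "X v = (if v \<in> A then {..<p} else {p..})" for v
  have "{U \<in> space N. (\<forall>v\<in>A. U v < p) \<and> (\<forall>v\<in>B. p \<le> U v)} = {U \<in> space N. \<forall>v\<in>A \<union> B. U v \<in> X v}"
    using assms(5) by (force simp: X_def)
  also have "N.prob \<dots> = (\<Prod>v\<in>A \<union> B. measure UU (X v))"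
    by (rule cylinder_prob) (use assms in \<open>auto simp: X_def\<close>)
  also have "\<dots> = (\<Prod>v\<in>A. measure UU (X v)) * (\<Prod>v\<in>B. measure UU (X v))"
    by (rule prod.union_disjoint) (use assms in auto)
  also have "(\<Prod>v\<in>A. measure UU (X v)) = p ^ card A"
    using measure_UU_lessThan[of p] p_pos p_less_1 by (simp add: X_def)
  also have "(\<Prod>v\<in>B. measure UU (X v)) = (\<Prod>v\<in>B. 1 - p)"
    using assms(5) measure_UU_lessThan[of p] p_pos p_less_1 by (intro prod.cong) (auto simp: X_def)
  finally show ?thesis by simp
qed

lemma depends_indep:
  assumes A [measurable]: "Measurable.pred N A" and B [measurable]: "Measurable.pred N B"
    and dA: "depends A I" and dB: "depends B J" and IJ: "I \<inter> J = {}" "I \<subseteq> L" "J \<subseteq> L"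
  shows "N.prob {U \<in> space N. A U \<and> B U} = N.prob {U \<in> space N. A U} * N.prob {U \<in> space N. B U}"
proof -
  have comp: "(\<lambda>U. U v) \<in> measurable N UU" if "v \<in> L" for v
    unfolding N_def using that by measurable
  have "L \<noteq> {}" by (auto simp: lattice_points_def PiE_eq_empty_iff)
  have "distr N (\<Pi>\<^sub>M i\<in>L. UU) (\<lambda>U. \<lambda>i\<in>L. U i) = distr N N (\<lambda>U. U)"
    by (rule distr_cong) (auto simp: N_def space_PiM fun_eq_iff PiE_iff extensional_def)
  also have "\<dots> = (\<Pi>\<^sub>M i\<in>L. distr N UU (\<lambda>U. U i))"
    unfolding distr_id2[OF refl] N_def
    by (rule PiM_cong) (auto intro!: distr_PiM_component[symmetric] prob_space_UU)
  finally have "N.indep_vars (\<lambda>_. UU) (\<lambda>v U. U v) L"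
    by (subst N.indep_vars_iff_distr_eq_PiM'[OF \<open>L \<noteq> {}\<close>]) (auto intro: comp)
  from N.indep_var_restrict[OF this IJ]
  have iv: "N.indep_var (\<Pi>\<^sub>M v\<in>I. UU) (\<lambda>U. restrict U I) (\<Pi>\<^sub>M v\<in>J. UU) (\<lambda>U. restrict U J)"
    by simp
  \<comment> \<open>Filling up with 0 outside \<open>K\<close> turns a predicate determined by the
    values on \<open>K\<close> into a measurable one on the product over \<open>K\<close>
    alone.\<close>
  define ext :: "(nat \<Rightarrow> int) set \<Rightarrow> _ \<Rightarrow> (nat \<Rightarrow> int) \<Rightarrow> real"
    where "ext K U = (\<lambda>v\<in>L. if v \<in> K then U v else 0)" for K U
  have ext: "ext K \<in> measurable (\<Pi>\<^sub>M v\<in>K. UU) N" for K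
    unfolding ext_def N_def
  proof (rule measurable_restrict)
    fix v assume "v \<in> L"
    show "(\<lambda>U. if v \<in> K then U v else 0) \<in> measurable (\<Pi>\<^sub>M v\<in>K. UU) UU"
      by (cases "v \<in> K") (simp_all add: measurable_component_singleton)
  qed
  have E: "{U \<in> space N. P U} = (\<lambda>U. restrict U K) -` {V \<in> space (\<Pi>\<^sub>M v\<in>K. UU). P (ext K V)} \<inter> space N"
    if "depends P K" "K \<subseteq> L" for P K
  proof -
    have "P U = P (ext K (restrict U K))" for U
      using that by (intro dependsD[OF that(1)]) (auto simp: ext_def)
    thus ?thesis by (auto simp: space_PiM)
  qed
  have S: "{V \<in> space (\<Pi>\<^sub>M v\<in>K. UU). P (ext K V)} \<in> sets (\<Pi>\<^sub>M v\<in>K. UU)" if "Measurable.pred N P" for P K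
    using measurable_compose[OF ext that] by (simp add: pred_def)
  have "{U \<in> space N. A U \<and> B U} =
     (\<lambda>U. (restrict U I, restrict U J)) -` ({V \<in> space (\<Pi>\<^sub>M v\<in>I. UU). A (ext I V)} \<times> {V \<in> space (\<Pi>\<^sub>M v\<in>J. UU). B (ext J V)}) \<inter> space N"
    using E[OF dA IJ(2)] E[OF dB IJ(3)] by blast
  also have "N.prob \<dots> = N.prob {U \<in> space N. A U} * N.prob {U \<in> space N. B U}"
    by (subst N.indep_varD[OF iv S[OF A] S[OF B]])
       (simp only: E[OF dA IJ(2), symmetric] E[OF dB IJ(3), symmetric])
  finally show ?thesis .
qed

lemma pull_measurable: "bij_betw s L L \<Longrightarrow> pull s \<in> measurable N N"
  unfolding pull_def N_def
  by (rule measurable_restrict) (auto simp: bij_betw_def intro!: measurable_component_singleton)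

text \<open>A permutation of i.i.d. coordinates preserves their joint law. Bijectivity is all that
  is asked of \<open>s\<close>, so maps that are only piecewise isometries qualify.\<close>

lemma distr_pull: "bij_betw s L L \<Longrightarrow> distr N N (pull s) = N"
  unfolding pull_def N_def
  using distr_PiM_reindex[of L "\<lambda>_. UU" s L] prob_space_UU by (auto simp: bij_betw_def)

lemma prob_pull:
  assumes "bij_betw s L L" "Measurable.pred N P"
  shows "N.prob {U \<in> space N. P (pull s U)} = N.prob {U \<in> space N. P U}"
proof -
  have "N.prob {U \<in> space N. P U} = measure (distr N N (pull s)) {U \<in> space N. P U}"
    by (simp add: distr_pull[OF assms(1)])
  also have "\<dots> = N.prob (pull s -` {U \<in> space N. P U} \<inter> space N)"
    by (rule measure_distr[OF pull_measurable[OF assms(1)]]) (use assms(2) in \<open>simp add: pred_def\<close>)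
  also have "pull s -` {U \<in> space N. P U} \<inter> space N = {U \<in> space N. P (pull s U)}"
    using measurable_space[OF pull_measurable[OF assms(1)]] by auto
  finally show ?thesis ..
qed

section \<open>Measurability\<close>

lemma hop_iff: "hop U a b \<longleftrightarrow> b \<in> L \<and> U b < p \<and> a d < b d \<and>
   (\<forall>w\<in>L. U w < p \<longrightarrow> a d < w d \<longrightarrow> dl a b \<le> dl a w \<and> (dl a w = dl a b \<longrightarrow> U b \<le> U w))"
  by (auto intro: hopI dest: hopD)

lemma le_measurable [measurable]:
  "v \<in> L \<Longrightarrow> w \<in> L \<Longrightarrow> Measurable.pred N (\<lambda>U. U v \<le> U w)"
  using borel_measurable_le[OF component_measurable[of v] component_measurable[of w]]
  by (simp add: pred_def)

lemma hop_measurable [measurable]: "Measurable.pred N (\<lambda>U. hop U a b)"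
proof (cases "b \<in> L")
  case True
  have 1: "Measurable.pred N (\<lambda>U. U w < p)" if "w \<in> L" for w
    using component_measurable[OF that] by measurable
  have 2: "Measurable.pred N (\<lambda>U. U b \<le> U w)" if "w \<in> L" for w
    by (rule le_measurable[OF True that])
  show ?thesis unfolding hop_iff using 1 2 True
    by (intro pred_intros_logic measurable_pred_countable(1) countable_lattice_points) auto
qed (simp add: hop_iff)

lemma st_measurable [measurable]: "Measurable.pred N (\<lambda>U. st U l a b)"
  unfolding st_def by measurable

text \<open>Each power of the relation is a countable union over the last intermediate vertex, which
  lies in the countable set \<open>L\<close>.\<close>

lemma rtranclp_measurable:
  assumes [measurable]: "\<And>x y. Measurable.pred N (\<lambda>U. R U x y)" and L: "\<And>U x y. R U x y \<Longrightarrow> y \<in> L"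
    and "a \<in> L"
  shows "Measurable.pred N (\<lambda>U. (R U)\<^sup>*\<^sup>* a b)"
proof -
  have inL: "(R U ^^ n) a x \<Longrightarrow> x \<in> L" for U n x
    using L assms(3) by (cases n) auto
  have [measurable]: "Measurable.pred N (\<lambda>U. (R U ^^ n) a x)" for n x
  proof (induction n arbitrary: x)
    case (Suc n)
    have "(R U ^^ Suc n) a x \<longleftrightarrow> (\<exists>y\<in>L. (R U ^^ n) a y \<and> R U y x)" for U
      using inL by auto
    with Suc show ?case
      by (simp del: relpowp.simps)
  qed simp
  show ?thesis unfolding rtranclp_power by measurable
qed

lemma reg_measurable [measurable]: "a \<in> L \<Longrightarrow> Measurable.pred N (\<lambda>U. reg U a x)"
  unfolding reg_def by (rule rtranclp_measurable) (auto simp: st_def dest: hopD)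

lemma trail_measurable [measurable]: "a \<in> L \<Longrightarrow> Measurable.pred N (\<lambda>U. trail U a x)"
  unfolding trail_def by (rule rtranclp_measurable) (auto dest: hopD)

lemma joint_measurable [measurable]:
  assumes [measurable]: "a \<in> L" "b \<in> L"
  shows "Measurable.pred N (\<lambda>U. joint U a b n)"
proof -
  have "joint U a b n \<longleftrightarrow>
    (\<exists>x\<in>L. \<exists>y\<in>L. x d = y d \<and> a d < x d \<and> x d \<le> n \<and> reg U a x \<and> reg U b y)" for U
    unfolding joint_def using reg_ball assms by blast
  thus ?thesis
    by simp
qed

lemma FR_measurable [measurable]:
  "a \<in> L \<Longrightarrow> b \<in> L \<Longrightarrow> Measurable.pred N (\<lambda>U. FR U a b x y)"
  unfolding FR_def by measurable

lemma meetsn_measurable [measurable]: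
  assumes [measurable]: "a \<in> L" "b \<in> L"
  shows "Measurable.pred N (\<lambda>U. meetsn n U a b)"
proof -
  have "meetsn n U a b \<longleftrightarrow> (\<exists>m\<in>L. trail U a m \<and> trail U b m \<and> m d \<le> a d + int n)" for U
    unfolding meetsn_def using trail_in_L assms by blast
  thus ?thesis
    by simp
qed

lemma meets_measurable [measurable]:
  "a \<in> L \<Longrightarrow> b \<in> L \<Longrightarrow> Measurable.pred N (\<lambda>U. meets U a b)"
  unfolding meets_iff_meetsn by measurable

section \<open>Almost sure properties of the environment\<close>

text \<open>Injectivity breaks all ties, hence at most one successor; an open vertex on every level
  gives at least one.\<close>

definition nice :: "((nat \<Rightarrow> int) \<Rightarrow> real) \<Rightarrow> bool" where
  "nice U \<longleftrightarrow> inj_on U L \<and> (\<forall>k. \<exists>w\<in>L. U w < p \<and> w d = k)"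

lemma nice_inj: "nice U \<Longrightarrow> inj_on U (open_vertices d p U)"
  unfolding nice_def open_vertices_def by (auto intro: inj_on_subset)

lemma AE_neq:
  assumes "v \<in> L" "w \<in> L" "v \<noteq> w"
  shows "AE U in N. U v \<noteq> U w"
proof -
  have [measurable]: "(\<lambda>U. U v) \<in> borel_measurable N" "(\<lambda>U. U w) \<in> borel_measurable N"
    using assms by auto
  define E where "E = {U \<in> space N. U v = U w \<and> U v \<in> {0..<1}}"
  have "E = {U \<in> space N. U v \<le> U w} \<inter> {U \<in> space N. U w \<le> U v} \<inter> {U \<in> space N. 0 \<le> U v \<and> U v < 1}"
    by (auto simp: E_def)
  also have "\<dots> \<in> sets N"
    using le_measurable[OF assms(1,2)] le_measurable[OF assms(2,1)] by (simp add: pred_def)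
  finally have [measurable]: "E \<in> sets N" .
  have bound: "N.prob E \<le> 1 / real n" if "n > 0" for n
  proof -
    \<comment> \<open>Equal values in [0, 1) share one of \<open>n\<close> intervals of length 1 /
      n, an event of probability at most n * (1 / n)^2.\<close>
    define I where "I k = {real k / real n ..< real (Suc k) / real n}" for k
    have "E \<subseteq> (\<Union>k<n. {U \<in> space N. \<forall>u\<in>{v,w}. U u \<in> I k})"
    proof
      fix U assume U: "U \<in> E"
      define k where "k = nat \<lfloor>U v * n\<rfloor>"
      have 0: "0 \<le> U v * n" "U v * n < n" using U that by (auto simp: E_def)
      have "real k \<le> U v * n" "U v * n < real (Suc k)" using 0 by (auto simp: k_def; linarith)+
      moreover from this have "k < n" using 0 by linarith
      ultimately show "U \<in> (\<Union>k<n. {U \<in> space N. \<forall>u\<in>{v,w}. U u \<in> I k})"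
        using U that by (auto simp: E_def I_def field_simps intro!: bexI[of _ k])
    qed
    hence "N.prob E \<le> N.prob (\<Union>k<n. {U \<in> space N. \<forall>u\<in>{v,w}. U u \<in> I k})"
      by (intro N.finite_measure_mono sets.finite_UN) (auto simp: I_def)
    also have "\<dots> \<le> (\<Sum>k<n. N.prob {U \<in> space N. \<forall>u\<in>{v,w}. U u \<in> I k})"
      by (intro N.finite_measure_subadditive_finite) (auto simp: I_def)
    also have "\<dots> = (\<Sum>k<n. 1 / (real n)\<^sup>2)"
    proof (intro sum.cong refl)
      fix k assume "k \<in> {..<n}"
      have "N.prob {U \<in> space N. \<forall>u\<in>{v,w}. U u \<in> I k} = (\<Prod>u\<in>{v,w}. measure UU (I k))"
        by (rule cylinder_prob) (use assms in \<open>auto simp: I_def\<close>)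
      also have "measure UU (I k) = 1 / real n"
        using \<open>k \<in> {..<n}\<close> that unfolding I_def
        by (subst measure_UU_atLeastLessThan) (auto simp: field_simps)
      finally show "N.prob {U \<in> space N. \<forall>u\<in>{v,w}. U u \<in> I k} = 1 / (real n)\<^sup>2"
        using assms by (simp add: power2_eq_square)
    qed
    also have "\<dots> = 1 / real n" using that by (simp add: power2_eq_square)
    finally show ?thesis .
  qed
  have "N.prob E \<le> 0"
  proof (rule ccontr)
    assume "\<not> N.prob E \<le> 0"
    then obtain n where "n > 0" "1 / real n < N.prob E"
      using real_arch_inverse[of "N.prob E"] by (auto simp: inverse_eq_divide)
    with bound[of n] show False by linarith
  qed
  hence "E \<in> null_sets N"
    by (intro null_setsI) (auto simp: N.emeasure_eq_measure antisym)
  hence "AE U in N. U \<notin> E" by (rule AE_not_in)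
  moreover have "AE U in N. U v \<in> {0..<1}"
  proof -
    have "N.prob {U \<in> space N. \<forall>u\<in>{v}. U u \<in> {0..<1}} = 1"
      using cylinder_prob[of "{v}" "\<lambda>_. {0..<1}"] assms measure_UU_atLeastLessThan[of 0 1] by simp
    thus ?thesis by (subst (asm) N.prob_Collect_eq_1) auto
  qed
  ultimately show ?thesis using AE_space[of N] by eventually_elim (auto simp: E_def)
qed

lemma AE_open_level: "AE U in N. \<exists>w\<in>L. U w < p \<and> w d = k"
proof -
  define z where "z = (\<lambda>j\<in>{1..d}. if j = d then k else 0)"
  \<comment> \<open>Because \<open>d\<close> is at least 2, moving along coordinate 1 gives
    infinitely many vertices on level \<open>k\<close>.\<close>
  define f where "f i = z(1 := int i)" for i :: nat
  have d1: "d \<noteq> 1" "d \<noteq> Suc 0" using d_ge_2 by auto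
  have f: "f i \<in> L" "f i d = k" for i
    using d_ge_2 by (auto simp: f_def z_def lattice_points_def PiE_iff extensional_def)
  have injf: "inj f" by (auto simp: inj_on_def f_def dest: fun_cong[of _ _ 1])
  define E where "E = {U \<in> space N. \<forall>w\<in>range f. p \<le> U w}"
  have E [measurable]: "E \<in> sets N"
  proof -
    have "E = {U \<in> space N. \<forall>i. p \<le> U (f i)}" by (auto simp: E_def)
    also have "\<dots> \<in> sets N" using f by measurable
    finally show ?thesis .
  qed
  have bound: "N.prob E \<le> (1 - p) ^ n" for n
  proof -
    have "N.prob E \<le> N.prob {U \<in> space N. (\<forall>v\<in>{}. U v < p) \<and> (\<forall>v\<in>f ` {..<n}. p \<le> U v)}"
      by (rule N.finite_measure_mono) (use f in \<open>auto simp: E_def\<close>)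
    also have "\<dots> = (1 - p) ^ card (f ` {..<n})"
      using open_closed_prob[of "{}" "f ` {..<n}"] f by auto
    also have "card (f ` {..<n}) = n"
      by (subst card_image) (auto intro: inj_on_subset[OF injf])
    finally show ?thesis .
  qed
  have "(\<lambda>n. (1 - p) ^ n) \<longlonglongrightarrow> 0"
    by (rule LIMSEQ_power_zero) (use p_pos p_less_1 in auto)
  hence "N.prob E \<le> 0" by (rule LIMSEQ_le_const) (use bound in auto)
  hence "E \<in> null_sets N"
    by (intro null_setsI) (auto simp: N.emeasure_eq_measure antisym)
  hence "AE U in N. U \<notin> E" by (rule AE_not_in)
  thus ?thesis
  proof (rule AE_mp, intro AE_I2 impI)
    fix U assume "U \<in> space N" "U \<notin> E"
    thus "\<exists>w\<in>L. U w < p \<and> w d = k" using f by (auto simp: E_def not_le)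
  qed
qed

lemma AE_nice: "AE U in N. nice U"
proof -
  have "AE U in N. \<forall>v\<in>L. \<forall>w\<in>L. v \<noteq> w \<longrightarrow> U v \<noteq> U w"
    by (intro AE_ball_countable' countable_lattice_points) (use AE_neq in auto)
  moreover have "AE U in N. \<forall>k. \<exists>w\<in>L. U w < p \<and> w d = k"
    by (subst AE_all_countable) (use AE_open_level in auto)
  ultimately show ?thesis by eventually_elim (auto simp: nice_def inj_on_def)
qed

end

section \<open>Tail of the first joint regeneration level\<close>

context dsf
begin

text \<open>The value 1 counts as closed since \<open>p < 1\<close>. Paths in
  \<open>trunc l U\<close> are therefore decided by the levels up to \<open>l\<close>.\<close>

definition trunc :: "int \<Rightarrow> ((nat \<Rightarrow> int) \<Rightarrow> real) \<Rightarrow> ((nat \<Rightarrow> int) \<Rightarrow> real)" where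
  "trunc l U = (\<lambda>v\<in>L. if v d \<le> l then U v else 1)"

lemma trunc_open: "v \<in> L \<Longrightarrow> trunc l U v < p \<longleftrightarrow> v d \<le> l \<and> U v < p"
  using p_less_1 by (auto simp: trunc_def)

lemma trunc_inj: "nice U \<Longrightarrow> inj_on (trunc l U) (open_vertices d p (trunc l U))"
  unfolding open_vertices_def
proof (rule inj_onI)
  fix x y assume n: "nice U" and "x \<in> {v \<in> L. trunc l U v < p}" "y \<in> {v \<in> L. trunc l U v < p}"
    and eq: "trunc l U x = trunc l U y"
  from this(2,3) have xy: "x \<in> L" "y \<in> L" "x d \<le> l" "y d \<le> l" by (auto simp: trunc_open)
  with eq have "U x = U y" by (simp add: trunc_def)
  with n xy show "x = y" by (auto simp: nice_def inj_on_def)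
qed

lemma trunc_measurable: "trunc l \<in> measurable N N"
  unfolding N_def
proof (subst trunc_def[abs_def], rule measurable_restrict)
  fix v assume "v \<in> L"
  show "(\<lambda>U. if v d \<le> l then U v else 1) \<in> measurable (\<Pi>\<^sub>M v\<in>L. UU) UU"
    using \<open>v \<in> L\<close> by (cases "v d \<le> l") (auto intro!: measurable_component_singleton)
qed

text \<open>Truncation makes this set a function of the levels up to \<open>l\<close>, independent
  of level \<open>l + 1\<close>; the radius \<open>R\<close> confines it to a fixed finite set.
  Vertices more than \<open>S\<close> levels below \<open>l + 1\<close> are left out because a step
  of length at most \<open>S\<close> from there stays below \<open>l + 1\<close>.\<close>

definition slots :: "int \<Rightarrow> nat \<Rightarrow> int \<Rightarrow> ((nat \<Rightarrow> int) \<Rightarrow> real) \<Rightarrow> (nat \<Rightarrow> int) \<Rightarrow> (nat \<Rightarrow> int) set" where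
  "slots l S R U a = {c \<in> L. dl a c \<le> R \<and> trail (trunc l U) a c \<and> l - int S < c d \<and> c d \<le> l}"

lemma card_slots:
  assumes "nice U" shows "card (slots l S R U a) \<le> S"
proof -
  have "inj_on (\<lambda>c. c d) (slots l S R U a)"
    by (rule inj_onI) (auto simp: slots_def intro: trail_same_level[OF trunc_inj[OF assms]])
  moreover have "(\<lambda>c. c d) ` slots l S R U a \<subseteq> {l - int S<..l}" by (auto simp: slots_def)
  ultimately have "card (slots l S R U a) \<le> card {l - int S<..l}"
    by (intro card_inj_on_le) auto
  thus ?thesis by simp
qed

text \<open>
  If all vertices of the path just below level \<open>l + 1\<close> see an open vertex straight above them on
  level \<open>l + 1\<close>, the path is forced to pass through one of these and to regenerate there.
\<close>

lemma slots_open_reg: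
  assumes a: "a \<in> L" and l: "a d \<le> l" "l < a d + int n"
    and steps: "\<And>c. c \<in> L \<Longrightarrow> dl a c \<le> int n * int S \<Longrightarrow> \<exists>w\<in>L. U w < p \<and> c d < w d \<and> dl c w \<le> int S"
    and slots: "\<And>c. c \<in> slots l S (int n * int S) U a \<Longrightarrow> U (c(d := l + 1)) < p"
  shows "\<exists>x. x d = l + 1 \<and> reg U a x"
proof -
  have short: "dl c e \<le> int S" if c: "c \<in> L" "dl a c \<le> int n * int S" and e: "hop U c e" for c e
  proof -
    obtain w where "w \<in> L" "U w < p" "c d < w d" "dl c w \<le> int S" using steps[OF c] by auto
    with hopD(4)[OF e, of w] show ?thesis by auto
  qed
  have in_ball: "c \<in> L \<and> dl a c \<le> (c d - a d) * int S \<and> dl a c \<le> int n * int S"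
    if "trail U a c" "c d \<le> l" for c
    using that
  proof (induction rule: trail_below_induct)
    case (step c e)
    note h = hopD[OF step(2)]
    have c: "c \<in> L" "dl a c \<le> (c d - a d) * int S" "dl a c \<le> int n * int S"
      using step(5) by auto
    have "dl a e \<le> dl a c + dl c e" by (rule l1_triangle)
    also have "\<dots> \<le> (c d - a d) * int S + int S"
      using short[OF c(1,3) step(2)] c(2) by linarith
    also have "\<dots> = (c d - a d + 1) * int S" by (simp add: algebra_simps)
    also have "\<dots> \<le> (e d - a d) * int S" using h(3) by (intro mult_right_mono) auto
    finally have 1: "dl a e \<le> (e d - a d) * int S" .
    also have "\<dots> \<le> int n * int S" using step(4) l by (intro mult_right_mono) auto
    finally show ?case using 1 h(1) by auto
  qed (use a in auto)
  have trunc_trail: "trail (trunc l U) a c" if "trail U a c" "c d \<le> l" for c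
    using that
  proof (induction rule: trail_below_induct)
    case (step c e)
    note h = hopD[OF step(2)]
    have "hop (trunc l U) c e"
    proof (rule hopI)
      show "trunc l U e < p" using h step(4) by (simp add: trunc_open)
      show "dl c e \<le> dl c w" if "w \<in> L" "trunc l U w < p" "c d < w d" for w
        using h(4)[of w] that by (simp add: trunc_open)
      show "trunc l U e \<le> trunc l U w"
        if "w \<in> L" "trunc l U w < p" "c d < w d" "dl c w = dl c e" for w
        using h(5)[of w] that h(1) step(4) by (auto simp: trunc_open) (auto simp: trunc_def)
    qed (use h in auto)
    with step(5) show ?case by (auto simp: trail_def)
  qed simp
  have slot: "c \<in> slots l S (int n * int S) U a" if "trail U a c" "c d \<le> l" "l - int S < c d" for c
    using trunc_trail[OF that(1,2)] in_ball[OF that(1,2)] that by (auto simp: slots_def)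
  \<comment> \<open>Close to level \<open>l + 1\<close>, the open vertex straight above limits the
    search; farther down, a step of length at most \<open>S\<close> cannot overshoot.\<close>
  have radius: "c d + dl c e \<le> l + 1" if c: "trail U a c" "c d \<le> l" and e: "hop U c e" for c e
  proof (cases "l - int S < c d")
    case True
    have "dl c e \<le> dl c (c(d := l + 1))"
      using hopD(4)[OF e, of "c(d := l + 1)"] slots[OF slot[OF c True]] in_ball[OF c] c(2) upd_in_L[of c]
      by auto
    thus ?thesis using c(2) by simp
  next
    case False
    thus ?thesis using short[OF _ _ e] in_ball[OF c] by force
  qed
  have st: "(st U (l + 1))\<^sup>*\<^sup>* a c" if "trail U a c" "c d \<le> l" for c
    using that
  proof (induction rule: trail_below_induct)
    case (step c e)
    have "st U (l + 1) c e" using radius[OF step(1,3,2)] step(2) by (simp add: st_def)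
    with step(5) show ?case by auto
  qed simp
  define V where "V = {c. trail U a c \<and> c d \<le> l}"
  have "(\<lambda>c. c d) ` V \<subseteq> {a d..l}" by (auto simp: V_def dest: trail_level_le)
  hence fin: "finite ((\<lambda>c. c d) ` V)" by (rule finite_subset) auto
  have ne: "(\<lambda>c. c d) ` V \<noteq> {}" using l by (auto simp: V_def intro!: exI[of _ a])
  \<comment> \<open>The highest path vertex up to level \<open>l\<close>: its successor lies above
    \<open>l\<close> but, by \<open>radius\<close>, not above \<open>l + 1\<close>, and so exactly
    on level \<open>l + 1\<close>.\<close>
  obtain c where c: "c \<in> V" "c d = Max ((\<lambda>c. c d) ` V)" using Max_in[OF fin ne] by auto
  hence max: "e \<in> V \<Longrightarrow> e d \<le> c d" for e using Max_ge[OF fin] by auto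
  have ct: "trail U a c" "c d \<le> l" using c(1) by (auto simp: V_def)
  have cL: "c \<in> L" "dl a c \<le> int n * int S" using in_ball[OF ct] by auto
  obtain v where v: "hop U c v" using steps[OF cL] hop_ex[of _ U c] by blast
  have tv: "trail U a v" using ct(1) v by (auto simp: trail_def)
  have vl: "v d > l"
  proof (rule ccontr)
    assume "\<not> v d > l"
    hence "v \<in> V" using tv by (auto simp: V_def)
    with max[of v] hopD(3)[OF v] show False by simp
  qed
  have "dl c v \<le> l + 1 - c d" using radius[OF ct v] by linarith
  moreover have "\<bar>c d - v d\<bar> \<le> dl c v" by (rule level_le_dl)
  ultimately have "v d = l + 1" using vl by linarith
  moreover have "st U (l + 1) c v" using v radius[OF ct v] by (simp add: st_def)
  ultimately show ?thesis using st[OF ct] unfolding reg_def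
    by (intro exI[of _ v]) (auto intro: rtranclp.rtrancl_into_rtrancl)
qed

definition all_slots_open :: "nat \<Rightarrow> int \<Rightarrow> (nat \<Rightarrow> int) \<Rightarrow> (nat \<Rightarrow> int) \<Rightarrow> int \<Rightarrow> ((nat \<Rightarrow> int) \<Rightarrow> real) \<Rightarrow> bool" where
  "all_slots_open S R a b l U \<longleftrightarrow> (\<forall>c\<in>slots l S R U a \<union> slots l S R U b. U (c(d := l + 1)) < p)"

definition near :: "int \<Rightarrow> (nat \<Rightarrow> int) \<Rightarrow> (nat \<Rightarrow> int) \<Rightarrow> (nat \<Rightarrow> int) set" where
  "near R a b = {c \<in> L. dl a c \<le> R \<or> dl b c \<le> R}"

lemma finite_near [simp]: "finite (near R a b)"
proof -
  have "near R a b = {c \<in> L. dl a c \<le> R} \<union> {c \<in> L. dl b c \<le> R}" by (auto simp: near_def)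
  thus ?thesis by (simp add: finite_l1_ball)
qed

lemma card_ball_le:
  assumes "a \<in> L" "0 \<le> R"
  shows "card {c \<in> L. dl a c \<le> R} \<le> (2 * nat R + 1) ^ d"
proof -
  have "card {c \<in> L. dl a c \<le> R} \<le> card (\<Pi>\<^sub>E j\<in>{1..d}. {a j - R..a j + R})"
    by (intro card_mono finite_PiE l1_ball_subset_box) auto
  also have "\<dots> = (2 * nat R + 1) ^ d"
    using assms(2) by (subst card_PiE) (auto simp: nat_add_distrib nat_mult_distrib add_ac)
  finally show ?thesis .
qed

lemma card_near_le:
  assumes "a \<in> L" "b \<in> L" "0 \<le> R"
  shows "card (near R a b) \<le> 2 * (2 * nat R + 1) ^ d"
proof -
  have "near R a b = {c \<in> L. dl a c \<le> R} \<union> {c \<in> L. dl b c \<le> R}" by (auto simp: near_def)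
  hence "card (near R a b) \<le> card {c \<in> L. dl a c \<le> R} + card {c \<in> L. dl b c \<le> R}"
    by (simp add: card_Un_le)
  with card_ball_le[OF assms(1,3)] card_ball_le[OF assms(2,3)] show ?thesis by linarith
qed

lemma slots_mem_measurable:
  assumes "a \<in> L" shows "Measurable.pred N (\<lambda>U. c \<in> slots l S R U a)"
proof -
  have [measurable]: "Measurable.pred N (\<lambda>U. trail (trunc l U) a c)"
    using measurable_compose[OF trunc_measurable trail_measurable[OF assms, of c]] by simp
  show ?thesis unfolding slots_def mem_Collect_eq by measurable
qed

lemma slots_eq_measurable:
  assumes "a \<in> L" "b \<in> L"
  shows "Measurable.pred N (\<lambda>U. slots l S R U a \<union> slots l S R U b = W)"
proof (cases "W \<subseteq> L")
  case True
  have "slots l S R U a \<union> slots l S R U b = W \<longleftrightarrow>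
    (\<forall>c\<in>L. (c \<in> slots l S R U a \<or> c \<in> slots l S R U b) \<longleftrightarrow> c \<in> W)" for U
    using True unfolding slots_def by blast
  thus ?thesis
    using slots_mem_measurable[OF assms(1)] slots_mem_measurable[OF assms(2)]
    by simp
next
  case False
  hence "slots l S R U a \<union> slots l S R U b \<noteq> W" for U unfolding slots_def by blast
  thus ?thesis by simp
qed

lemma slots_subset: "slots l S R U a \<union> slots l S R U b \<subseteq> near R a b"
  by (auto simp: slots_def near_def)

lemma slots_cong: "(\<And>v. v \<in> L \<Longrightarrow> v d \<le> l \<Longrightarrow> U v = U' v) \<Longrightarrow> slots l S R U a = slots l S R U' a"
proof -
  assume "\<And>v. v \<in> L \<Longrightarrow> v d \<le> l \<Longrightarrow> U v = U' v"
  hence "trunc l U = trunc l U'" by (auto simp: trunc_def fun_eq_iff)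
  thus ?thesis by (simp add: slots_def)
qed

lemma all_slots_open_measurable:
  assumes "a \<in> L" "b \<in> L"
  shows "Measurable.pred N (all_slots_open S R a b l)"
proof -
  have eq: "all_slots_open S R a b l U \<longleftrightarrow>
     (\<forall>c\<in>L. c \<in> slots l S R U a \<or> c \<in> slots l S R U b \<longrightarrow> U (c(d := l + 1)) < p)" for U
    unfolding all_slots_open_def slots_def by blast
  have "Measurable.pred N (\<lambda>U. U (c(d := l + 1)) < p)" if "c \<in> L" for c
    using component_measurable[OF upd_in_L[OF that]] by measurable
  thus ?thesis unfolding eq
    by (intro measurable_pred_countable(1) countable_lattice_points pred_intros_logic
        slots_mem_measurable assms) auto
qed

lemma all_slots_open_cong:
  assumes "\<And>v. v \<in> L \<Longrightarrow> v d \<le> l + 1 \<Longrightarrow> U v = U' v"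
  shows "all_slots_open S R a b l U = all_slots_open S R a b l U'"
proof -
  have s: "slots l S R U c = slots l S R U' c" for c using assms by (intro slots_cong) auto
  have "U (c(d := l + 1)) = U' (c(d := l + 1))" if "c \<in> L" for c
    using assms[of "c(d := l + 1)"] upd_in_L[OF that] by simp
  hence "(U (c(d := l + 1)) < p) = (U' (c(d := l + 1)) < p)" if "c \<in> slots l S R U' a \<union> slots l S R U' b" for c
    using that by (auto simp: slots_def)
  thus ?thesis unfolding all_slots_open_def s by (rule ball_cong[OF refl])
qed

text \<open>Given the levels up to m, the vertices of level m + 1 above the slots are fresh. There
  are at most \<open>2 * S\<close> of them, one per path and level, so all are open with probability
  at least \<open>p ^ (2 * S)\<close>. Conditioning is done by summing over the finitely many
  possible values of the slot set.\<close>

lemma no_slots_open_prob: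
  assumes a: "a \<in> L" and b: "b \<in> L"
  shows "N.prob {U \<in> space N. \<forall>j<n. \<not> all_slots_open S R a b (l + int j) U} \<le> (1 - p ^ (2 * S)) ^ n"
proof (induction n)
  case (Suc n)
  note [measurable] = all_slots_open_measurable[OF a b] slots_eq_measurable[OF a b]
  define A where "A U \<longleftrightarrow> (\<forall>j<n. \<not> all_slots_open S R a b (l + int j) U)" for U
  define m where "m = l + int n"
  define W where "W U = slots m S R U a \<union> slots m S R U b" for U
  define I where "I = {v \<in> L. v d \<le> m}"
  define J where "J = {v \<in> L. v d = m + 1}"
  define \<W> where "\<W> = {X. X \<subseteq> near R a b \<and> card X \<le> 2 * S}"
  define Op where "Op X U \<longleftrightarrow> (\<forall>c\<in>X. U (c(d := m + 1)) < p)" for X U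
  have fW: "finite \<W>" unfolding \<W>_def by (rule finite_subset[of _ "Pow (near R a b)"]) auto
  have [measurable]: "Measurable.pred N A" unfolding A_def by measurable
  have [measurable]: "Measurable.pred N (\<lambda>U. W U = X)" for X unfolding W_def by measurable
  have XL: "X \<subseteq> L" "finite X" "card X \<le> 2 * S" if "X \<in> \<W>" for X
    using that finite_subset[OF _ finite_near] by (auto simp: \<W>_def near_def)
  have Op [measurable]: "Measurable.pred N (Op X)" if "X \<in> \<W>" for X
  proof -
    have "Measurable.pred N (\<lambda>U. U (c(d := m + 1)) < p)" if "c \<in> X" for c
    proof -
      have "c(d := m + 1) \<in> L" using XL(1)[OF \<open>X \<in> \<W>\<close>] that upd_in_L by auto
      thus ?thesis using component_measurable by measurable
    qed
    thus ?thesis unfolding Op_def using XL[OF that]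
      by (intro measurable_pred_countable(1) countable_finite) auto
  qed
  have Oprob: "N.prob {U \<in> space N. \<not> Op X U} \<le> 1 - p ^ (2 * S)" if "X \<in> \<W>" for X
  proof -
    define X' where "X' = (\<lambda>c. c(d := m + 1)) ` X"
    have "card X' \<le> 2 * S" unfolding X'_def
      using card_image_le[of X] XL[OF that] order_trans by blast
    have "N.prob {U \<in> space N. \<not> Op X U} = 1 - N.prob {U \<in> space N. Op X U}"
      using Op[OF that] by (intro N.prob_neg) (simp add: pred_def)
    also have "{U \<in> space N. Op X U} = {U \<in> space N. (\<forall>v\<in>X'. U v < p) \<and> (\<forall>v\<in>{}. p \<le> U v)}"
      by (auto simp: Op_def X'_def)
    also have "N.prob \<dots> = p ^ card X'"
      using open_closed_prob[of X' "{}"] XL[OF that] upd_in_L by (auto simp: X'_def)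
    finally show ?thesis
      using power_decreasing[OF \<open>card X' \<le> 2 * S\<close>, of p] p_pos p_less_1 by simp
  qed
  have "N.prob {U \<in> space N. \<forall>j<Suc n. \<not> all_slots_open S R a b (l + int j) U}
     = N.prob {U \<in> space N. A U \<and> \<not> Op (W U) U}"
    by (intro arg_cong[of _ _ N.prob])
       (auto simp: A_def all_slots_open_def Op_def W_def m_def less_Suc_eq)
  also have "\<dots> \<le> N.prob (\<Union>X\<in>\<W>. {U \<in> space N. (A U \<and> W U = X) \<and> \<not> Op X U})"
  proof (rule N.finite_measure_mono_AE)
    show "AE U in N. U \<in> {U \<in> space N. A U \<and> \<not> Op (W U) U} \<longrightarrow>
       U \<in> (\<Union>X\<in>\<W>. {U \<in> space N. (A U \<and> W U = X) \<and> \<not> Op X U})"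
      using AE_nice
    proof eventually_elim
      fix U assume n: "nice U"
      have "card (W U) \<le> 2 * S"
        using card_Un_le[of "slots m S R U a" "slots m S R U b"] card_slots[OF n, of m S R a]
          card_slots[OF n, of m S R b] unfolding W_def by linarith
      hence "W U \<in> \<W>" using slots_subset by (auto simp: \<W>_def W_def)
      thus "U \<in> {U \<in> space N. A U \<and> \<not> Op (W U) U} \<longrightarrow>
         U \<in> (\<Union>X\<in>\<W>. {U \<in> space N. (A U \<and> W U = X) \<and> \<not> Op X U})" by auto
    qed
    show "(\<Union>X\<in>\<W>. {U \<in> space N. (A U \<and> W U = X) \<and> \<not> Op X U}) \<in> N.events"
      using fW by (intro sets.finite_UN) (auto simp: pred_def[symmetric])
  qed
  also have "\<dots> \<le> (\<Sum>X\<in>\<W>. N.prob {U \<in> space N. (A U \<and> W U = X) \<and> \<not> Op X U})"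
    using fW by (intro N.finite_measure_subadditive_finite) (auto simp: pred_def[symmetric])
  also have "\<dots> = (\<Sum>X\<in>\<W>. N.prob {U \<in> space N. A U \<and> W U = X} * N.prob {U \<in> space N. \<not> Op X U})"
  proof (intro sum.cong refl, rule depends_indep)
    fix X assume X: "X \<in> \<W>"
    have "A U = A U'" if "\<forall>v\<in>I. U v = U' v" for U U'
      unfolding A_def using that by (intro all_cong arg_cong[of _ _ Not] all_slots_open_cong)
        (auto simp: I_def m_def)
    moreover have "W U = W U'" if "\<forall>v\<in>I. U v = U' v" for U U'
      unfolding W_def using that by (intro arg_cong2[of _ _ _ _ "(\<union>)"] slots_cong) (auto simp: I_def)
    ultimately show "depends (\<lambda>U. A U \<and> W U = X) I" unfolding depends_def by metis
    show "depends (\<lambda>U. \<not> Op X U) J"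
      unfolding depends_def Op_def J_def using XL[OF X] upd_in_L by (auto simp: subset_eq)
    show "Measurable.pred N (\<lambda>U. \<not> Op X U)" using Op[OF X] by measurable
  qed (auto simp: I_def J_def)
  also have "\<dots> \<le> (\<Sum>X\<in>\<W>. N.prob {U \<in> space N. A U \<and> W U = X} * (1 - p ^ (2 * S)))"
    by (intro sum_mono mult_left_mono Oprob) auto
  also have "\<dots> = (\<Sum>X\<in>\<W>. N.prob {U \<in> space N. A U \<and> W U = X}) * (1 - p ^ (2 * S))"
    by (simp add: sum_distrib_right)
  also have "(\<Sum>X\<in>\<W>. N.prob {U \<in> space N. A U \<and> W U = X}) =
      N.prob (\<Union>X\<in>\<W>. {U \<in> space N. A U \<and> W U = X})"
    using fW by (intro N.finite_measure_finite_Union[symmetric])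
      (auto simp: disjoint_family_on_def)
  also have "\<dots> * (1 - p ^ (2 * S)) \<le> N.prob {U \<in> space N. A U} * (1 - p ^ (2 * S))"
    using p_pos p_less_1
    by (intro mult_right_mono N.finite_measure_mono) (auto simp: power_le_one)
  also have "\<dots> \<le> (1 - p ^ (2 * S)) ^ n * (1 - p ^ (2 * S))"
    using Suc p_pos p_less_1 by (intro mult_right_mono) (auto simp: A_def power_le_one)
  finally show ?case by (simp add: mult.commute)
qed (simp add: N.prob_space)

text \<open>A square of side \<open>S div 2\<close> in the plane of coordinates 1 and
  \<open>d\<close> lies above \<open>c\<close> within distance \<open>S\<close>. Its area makes the
  exponent quadratic: with \<open>S\<close> of order ln n the bound beats every power of n, whereas
  a single column would give only a power.\<close>

lemma no_short_step_prob:
  assumes c: "c \<in> L"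
  shows "N.prob {U \<in> space N. \<not> (\<exists>w\<in>L. U w < p \<and> c d < w d \<and> dl c w \<le> int S)} \<le> (1 - p) ^ ((S div 2)\<^sup>2)"
proof -
  define f where "f = (\<lambda>(i::int, j::int). (c(1 := c 1 + i))(d := c d + j))"
  define B where "B = f ` ({1..int (S div 2)} \<times> {1..int (S div 2)})"
  have d1: "d \<noteq> 1" "1 \<in> {1..d} - {d}" using d_ge_2 by auto
  have f1: "f ij 1 = c 1 + fst ij" "f ij d = c d + snd ij" for ij
    using d1 by (auto simp: f_def split: prod.splits)
  have "inj f"
  proof (rule injI)
    fix ij kl assume "f ij = f kl"
    with f1[of ij] f1[of kl] show "ij = kl" by (auto intro: prod_eqI)
  qed
  hence card: "card B = (S div 2)\<^sup>2"
    unfolding B_def by (subst card_image) (auto intro: inj_on_subset simp: power2_eq_square card_cartesian_product)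
  have fL: "f ij \<in> L" for ij
    using c d_ge_2 by (auto simp: f_def lattice_points_def PiE_iff extensional_def split: prod.splits)
  have dist: "dl c (f (i, j)) = \<bar>i\<bar> + \<bar>j\<bar>" for i j
  proof -
    have "(\<Sum>k\<in>{1..d} - {d}. \<bar>c k - f (i, j) k\<bar>) = (\<Sum>k\<in>{1..d} - {d}. if k = 1 then \<bar>i\<bar> else 0)"
      using d1 by (intro sum.cong) (auto simp: f_def)
    also have "\<dots> = \<bar>i\<bar>" using d1(2) by simp
    finally show ?thesis unfolding dl_split by (simp add: f_def)
  qed
  have "N.prob {U \<in> space N. \<not> (\<exists>w\<in>L. U w < p \<and> c d < w d \<and> dl c w \<le> int S)}
      \<le> N.prob {U \<in> space N. (\<forall>v\<in>{}. U v < p) \<and> (\<forall>v\<in>B. p \<le> U v)}"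
  proof (rule N.finite_measure_mono)
    show "{U \<in> space N. (\<forall>v\<in>{}. U v < p) \<and> (\<forall>v\<in>B. p \<le> U v)} \<in> N.events"
    proof -
      have "Measurable.pred N (\<lambda>U. p \<le> U v)" if "v \<in> B" for v
        using component_measurable[of v] that fL by (auto simp: B_def)
      hence "Measurable.pred N (\<lambda>U. \<forall>v\<in>B. p \<le> U v)"
        by (intro measurable_pred_countable(1) countable_finite) (auto simp: B_def)
      thus ?thesis by (simp add: pred_def)
    qed
    have "\<exists>w\<in>L. U w < p \<and> c d < w d \<and> dl c w \<le> int S" if "v \<in> B" "U v < p" for U v
    proof -
      have "v \<in> f ` ({1..int (S div 2)} \<times> {1..int (S div 2)})" using that(1) by (simp add: B_def)
      then obtain ij where vij: "v = f ij" "ij \<in> {1..int (S div 2)} \<times> {1..int (S div 2)}"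
        by (rule imageE)
      obtain i j where ij: "v = f (i, j)" "i \<in> {1..int (S div 2)}" "j \<in> {1..int (S div 2)}"
        using vij by (cases ij) auto
      have "dl c v \<le> int S" using dist[of i j] ij by auto
      moreover have "c d < v d" using ij by (simp add: f_def)
      ultimately show ?thesis using that(2) fL[of "(i,j)"] ij(1) by auto
    qed
    thus "{U \<in> space N. \<not> (\<exists>w\<in>L. U w < p \<and> c d < w d \<and> dl c w \<le> int S)}
      \<subseteq> {U \<in> space N. (\<forall>v\<in>{}. U v < p) \<and> (\<forall>v\<in>B. p \<le> U v)}" by force
  qed
  also have "\<dots> = (1 - p) ^ card B"
    using open_closed_prob[of "{}" B] fL by (auto simp: B_def)
  finally show ?thesis unfolding card .
qed

lemma no_joint_prob:
  assumes a: "a \<in> L" and b: "b \<in> L" and ab: "a d = b d"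
  shows "N.prob {U \<in> space N. \<not> joint U a b (a d + int n)} \<le>
    2 * (2 * real n * real S + 1) ^ d * (1 - p) ^ ((S div 2)\<^sup>2) + (1 - p ^ (2 * S)) ^ n"
proof -
  define R where "R = int n * int S"
  define K where "K c U \<longleftrightarrow> (\<exists>w\<in>L. U w < p \<and> c d < w d \<and> dl c w \<le> int S)" for c U
  note [measurable] = all_slots_open_measurable[OF a b]
  have K [measurable]: "Measurable.pred N (K c)" for c
  proof -
    have "Measurable.pred N (\<lambda>U. U w < p)" if "w \<in> L" for w
      using component_measurable[OF that] by measurable
    thus ?thesis unfolding K_def
      by (intro measurable_pred_countable(2) countable_lattice_points) auto
  qed
  define E1 where "E1 = (\<Union>c\<in>near R a b. {U \<in> space N. \<not> K c U})"
  define E2 where "E2 = {U \<in> space N. \<forall>j<n. \<not> all_slots_open S R a b (a d + int j) U}"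
  have E12: "E1 \<in> N.events" "E2 \<in> N.events"
    unfolding E1_def E2_def by (intro sets.finite_UN finite_near) measurable
  have "{U \<in> space N. \<not> joint U a b (a d + int n)} \<subseteq> E1 \<union> E2"
  proof
    fix U assume U: "U \<in> {U \<in> space N. \<not> joint U a b (a d + int n)}"
    show "U \<in> E1 \<union> E2"
    proof (rule ccontr)
      assume n: "U \<notin> E1 \<union> E2"
      then obtain j where j: "j < n" "all_slots_open S R a b (a d + int j) U"
        using U by (auto simp: E2_def)
      have steps: "K c U" if "c \<in> near R a b" for c using n U that by (auto simp: E1_def)
      have "\<exists>x. x d = (a d + int j) + 1 \<and> reg U a x"
        by (rule slots_open_reg[of _ _ n S])
           (use j steps a in \<open>auto simp: near_def R_def K_def all_slots_open_def\<close>)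
      moreover have "\<exists>x. x d = (a d + int j) + 1 \<and> reg U b x"
        by (rule slots_open_reg[of _ _ n S])
           (use j steps b ab in \<open>auto simp: near_def R_def K_def all_slots_open_def\<close>)
      ultimately obtain x y where "x d = a d + int j + 1" "reg U a x" "y d = a d + int j + 1" "reg U b y"
        by blast
      hence "joint U a b (a d + int n)"
        unfolding joint_def using j(1) by (intro exI[of _ x] exI[of _ y]) auto
      with U show False by simp
    qed
  qed
  hence "N.prob {U \<in> space N. \<not> joint U a b (a d + int n)} \<le> N.prob (E1 \<union> E2)"
    by (rule N.finite_measure_mono) (use E12 in auto)
  also have "\<dots> \<le> N.prob E1 + N.prob E2"
    by (rule measure_Un_le) (use E12 in auto)
  also have "N.prob E2 \<le> (1 - p ^ (2 * S)) ^ n"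
    unfolding E2_def by (rule no_slots_open_prob[OF a b])
  also have "N.prob E1 \<le> (\<Sum>c\<in>near R a b. N.prob {U \<in> space N. \<not> K c U})"
    unfolding E1_def by (rule N.finite_measure_subadditive_finite) auto
  also have "\<dots> \<le> (\<Sum>c\<in>near R a b. (1 - p) ^ ((S div 2)\<^sup>2))"
    unfolding K_def by (intro sum_mono no_short_step_prob) (auto simp: near_def)
  also have "\<dots> = real (card (near R a b)) * (1 - p) ^ ((S div 2)\<^sup>2)" by simp
  also have "\<dots> \<le> (2 * (2 * real n * real S + 1) ^ d) * (1 - p) ^ ((S div 2)\<^sup>2)"
  proof (rule mult_right_mono)
    have "real (card (near R a b)) \<le> real (2 * (2 * nat R + 1) ^ d)"
      using card_near_le[OF a b, of R] by (intro of_nat_mono) (auto simp: R_def)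
    thus "real (card (near R a b)) \<le> 2 * (2 * real n * real S + 1) ^ d"
      by (simp add: R_def nat_mult_distrib mult.assoc add.commute)
  qed (use p_less_1 in auto)
  finally show ?thesis by simp
qed

lemma joint_tail:
  "\<exists>C>0. \<forall>a\<in>L. \<forall>b\<in>L. \<forall>n\<ge>1. a d = b d \<longrightarrow>
     N.prob {U \<in> space N. \<not> joint U a b (a d + int n)} \<le> C / real n ^ k"
proof -
  \<comment> \<open>This choice gives \<open>p ^ (2 * S)\<close> at least n^(-1/2) for all
    \<open>S\<close> up to \<kappa> ln n, so \<open>n\<close> levels all fail with probability at
    most exp (- sqrt n).\<close>
  define \<kappa> where "\<kappa> = 1 / (4 * - ln p)"
  define \<mu> where "\<mu> = - ln (1 - p)"
  have lp: "- ln p > 0" using p_pos p_less_1 by simp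
  hence \<kappa>: "\<kappa> > 0" unfolding \<kappa>_def by (intro divide_pos_pos) auto
  have \<mu>: "\<mu> > 0" using p_pos p_less_1 by (simp add: \<mu>_def)
  define A where "A = real (2 * d + k)"
  \<comment> \<open>Bounds n^k times the failure probability. The exponent \<open>A\<close> pays for
    n^k and for the number of vertices near the two points, which is of order n^(2 d) at
    most.\<close>
  define g where "g x = 2 * (2 * \<kappa> + 1) ^ d * (x powr A * exp (- \<mu> * (\<kappa> * ln x - 2)\<^sup>2 / 4)) + x powr real k * exp (- sqrt x)" for x :: real
  have "((\<lambda>x::real. x powr A * exp (- \<mu> * (\<kappa> * ln x - 2)\<^sup>2 / 4)) \<longlongrightarrow> 0) at_top"
    using \<kappa> \<mu> by real_asymp
  moreover have "((\<lambda>x::real. x powr real k * exp (- sqrt x)) \<longlongrightarrow> 0) at_top"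
    by real_asymp
  ultimately have "(g \<longlongrightarrow> 2 * (2 * \<kappa> + 1) ^ d * 0 + 0) at_top"
    unfolding g_def by (intro tendsto_intros)
  hence "eventually (\<lambda>x. g x < 1) at_top" by (intro order_tendstoD(2)) auto
  moreover have "eventually (\<lambda>x. \<kappa> * ln x > 3) at_top"
    using \<kappa> by real_asymp
  ultimately have "eventually (\<lambda>x. g x < 1 \<and> \<kappa> * ln x > 3 \<and> x \<ge> 1) at_top"
    using eventually_ge_at_top[of 1] by eventually_elim auto
  then obtain x0 where x0: "\<And>x. x \<ge> x0 \<Longrightarrow> g x < 1 \<and> \<kappa> * ln x > 3 \<and> x \<ge> 1"
    by (auto simp: eventually_at_top_linorder)
  define n0 where "n0 = nat \<lceil>max x0 1\<rceil>"
  have main: "N.prob {U \<in> space N. \<not> joint U a b (a d + int n)} \<le> 1 / real n ^ k"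
    if ab: "a \<in> L" "b \<in> L" "a d = b d" and n: "n \<ge> n0" for a b n
  proof -
    have nx: "real n \<ge> x0" "real n \<ge> 1" using n unfolding n0_def by linarith+
    note X = x0[OF nx(1)]
    define S where "S = nat \<lfloor>\<kappa> * ln (real n)\<rfloor>"
    have S: "real S \<le> \<kappa> * ln (real n)" "\<kappa> * ln (real n) - 1 \<le> real S"
      unfolding S_def using X by linarith+
    have npow: "real n ^ j = real n powr real j" for j
      using nx(2) by (simp add: powr_realpow)
    have t2: "(1 - p ^ (2 * S)) ^ n \<le> exp (- sqrt (real n))"
    proof -
      have "real n powr (-1/2) \<le> p ^ (2 * S)"
      proof -
        have "- ln p * (2 * real S) \<le> - ln p * (2 * (\<kappa> * ln (real n)))"
          using S lp by (intro mult_left_mono) auto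
        moreover have "- ln p * (2 * (\<kappa> * ln (real n))) = ln (real n) / 2" using lp by (simp add: \<kappa>_def field_simps)
        moreover have "- ln p * (2 * real S) = - (real (2 * S) * ln p)" by simp
        ultimately have "- ln (real n) / 2 \<le> real (2 * S) * ln p" by linarith
        hence "exp (- ln (real n) / 2) \<le> exp (real (2 * S) * ln p)" by simp
        also have "exp (real (2 * S) * ln p) = p ^ (2 * S)" using p_pos by (simp add: exp_of_nat_mult del: of_nat_mult)
        finally show ?thesis using nx(2) by (simp add: powr_def)
      qed
      hence "1 - p ^ (2 * S) \<le> 1 - real n powr (-1/2)" by simp
      also have "\<dots> \<le> exp (- (real n powr (-1/2)))"
        using exp_ge_add_one_self[of "- (real n powr (-1/2))"] by simp
      finally have "(1 - p ^ (2 * S)) ^ n \<le> exp (- (real n powr (-1/2))) ^ n"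
        using p_pos p_less_1 by (intro power_mono) (auto simp: power_le_one)
      also have "\<dots> = exp (- (real n * real n powr (-1/2)))"
        by (simp add: exp_of_nat_mult[symmetric])
      also have "real n * real n powr (-1/2) = real n powr (1/2)"
        using nx(2) powr_add[of "real n" 1 "-1/2"] by simp
      also have "\<dots> = sqrt (real n)" using nx(2) by (simp add: powr_half_sqrt)
      finally show ?thesis .
    qed
    have t1: "(1 - p) ^ ((S div 2)\<^sup>2) \<le> exp (- \<mu> * (\<kappa> * ln (real n) - 2)\<^sup>2 / 4)"
    proof -
      have "(\<kappa> * ln (real n) - 2) / 2 \<le> real (S div 2)"
      proof -
        have "real S \<le> 2 * real (S div 2) + 1" by linarith
        thus ?thesis using S by simp
      qed
      hence "((\<kappa> * ln (real n) - 2) / 2)\<^sup>2 \<le> (real (S div 2))\<^sup>2"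
        using X by (intro power_mono) auto
      hence "\<mu> * ((\<kappa> * ln (real n) - 2)\<^sup>2 / 4) \<le> \<mu> * (real (S div 2))\<^sup>2"
        using \<mu> by (intro mult_left_mono) (auto simp: power_divide)
      hence "exp (- (\<mu> * (real (S div 2))\<^sup>2)) \<le> exp (- \<mu> * (\<kappa> * ln (real n) - 2)\<^sup>2 / 4)" by simp
      also have "exp (- (\<mu> * (real (S div 2))\<^sup>2)) = exp (real ((S div 2)\<^sup>2) * ln (1 - p))"
        by (simp add: \<mu>_def mult.commute)
      also have "\<dots> = (1 - p) ^ ((S div 2)\<^sup>2)"
        using p_less_1 by (simp add: exp_of_nat_mult del: of_nat_power)
      finally show ?thesis .
    qed
    have t3: "(2 * real n * real S + 1) ^ d \<le> ((2 * \<kappa> + 1) * real n ^ 2) ^ d"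
    proof (rule power_mono)
      have "real S \<le> \<kappa> * real n"
        using S(1) ln_le_minus_one[of "real n"] nx(2) \<kappa>
        by (smt (verit, best) mult_left_mono)
      hence "2 * real n * real S \<le> 2 * real n * (\<kappa> * real n)" by (intro mult_left_mono) auto
      moreover have "1 \<le> real n ^ 2" using nx(2) by simp
      ultimately show "2 * real n * real S + 1 \<le> (2 * \<kappa> + 1) * real n ^ 2"
        by (simp add: power2_eq_square algebra_simps)
    qed auto
    have "N.prob {U \<in> space N. \<not> joint U a b (a d + int n)} \<le>
      2 * (2 * real n * real S + 1) ^ d * (1 - p) ^ ((S div 2)\<^sup>2) + (1 - p ^ (2 * S)) ^ n"
      by (rule no_joint_prob) (use ab in auto)
    also have "\<dots> \<le> 2 * ((2 * \<kappa> + 1) * real n ^ 2) ^ d * exp (- \<mu> * (\<kappa> * ln (real n) - 2)\<^sup>2 / 4) + exp (- sqrt (real n))"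
      using t1 t2 t3 p_less_1 \<kappa> by (intro add_mono mult_mono) auto
    also have "\<dots> = g (real n) / real n ^ k"
    proof -
      have "real n powr A = (real n ^ 2) ^ d * real n ^ k"
        unfolding A_def using nx(2) by (simp add: powr_realpow flip: power_mult power_add del: of_nat_add of_nat_mult)
      moreover have "real n ^ k > 0" using nx(2) by simp
      ultimately show ?thesis
        unfolding g_def npow[of k, symmetric] power_mult_distrib by (simp add: field_simps)
    qed
    also have "\<dots> \<le> 1 / real n ^ k" using X nx(2) by (intro divide_right_mono) auto
    finally show ?thesis .
  qed
  \<comment> \<open>Below \<open>n0\<close> the claim is made trivial by a constant that lifts the
    bound to at least 1.\<close>
  define C where "C = real (max 1 n0) ^ k"
  have "N.prob {U \<in> space N. \<not> joint U a b (a d + int n)} \<le> C / real n ^ k"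
    if ab: "a \<in> L" "b \<in> L" "a d = b d" and n: "n \<ge> 1" for a b n
  proof (cases "n \<ge> n0")
    case True
    have "1 / real n ^ k \<le> C / real n ^ k"
      unfolding C_def using n by (intro divide_right_mono) (auto intro!: one_le_power)
    with main[OF ab True] show ?thesis by linarith
  next
    case False
    have "real n ^ k \<le> C" unfolding C_def using False by (intro power_mono) auto
    hence "1 \<le> C / real n ^ k" using n by (simp add: field_simps)
    with N.prob_le_1 show ?thesis using order_trans by blast
  qed
  moreover have "C > 0" unfolding C_def by (rule zero_less_power) simp
  ultimately show ?thesis by blast
qed

end

context dsf
begin

section \<open>Translations and local symmetries\<close>

lemma isoI:
  assumes "\<And>v. v \<in> L \<Longrightarrow> s v \<in> L" "\<And>v. v \<in> L \<Longrightarrow> t v \<in> L"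
    "\<And>v. v \<in> L \<Longrightarrow> t (s v) = v" "\<And>v. v \<in> L \<Longrightarrow> s (t v) = v"
    "\<And>u w. u \<in> L \<Longrightarrow> w \<in> L \<Longrightarrow> dl (s u) (s w) = dl u w" "\<And>w. w \<in> L \<Longrightarrow> s w d = w d + k"
  shows "iso s k"
  unfolding iso_def
proof (intro conjI ballI)
  show "bij_betw s L L" by (rule bij_betw_byWitness[of _ t]) (use assms in auto)
qed (use assms in auto)

lemma lattice_ext: "u \<in> L \<Longrightarrow> v \<in> L \<Longrightarrow> (\<And>j. j \<in> {1..d} \<Longrightarrow> u j = v j) \<Longrightarrow> u = v"
  unfolding lattice_points_def by (rule PiE_ext)

lemma restrict_in_L [simp]: "restrict f {1..d} \<in> L" "restrict f {Suc 0..d} \<in> L"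
  by (simp_all add: lattice_points_def)

definition orig :: "nat \<Rightarrow> int" where "orig = (\<lambda>j\<in>{1..d}. 0)"

definition trans :: "(nat \<Rightarrow> int) \<Rightarrow> (nat \<Rightarrow> int) \<Rightarrow> (nat \<Rightarrow> int)" where
  "trans c v = (\<lambda>j\<in>{1..d}. v j + c j)"

definition diff :: "(nat \<Rightarrow> int) \<Rightarrow> (nat \<Rightarrow> int) \<Rightarrow> (nat \<Rightarrow> int)" where
  "diff a b = (\<lambda>j\<in>{1..d}. a j - b j)"

lemma orig_L [simp]: "orig \<in> L" and diff_L [simp]: "diff a b \<in> L" and trans_L [simp]: "trans c v \<in> L"
  by (simp_all add: orig_def diff_def trans_def)

lemma orig_d [simp]: "orig d = 0" and diff_d [simp]: "diff a b d = a d - b d"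
  using d_in by (simp_all add: orig_def diff_def)

lemma trans_orig: "c \<in> L \<Longrightarrow> trans c orig = c"
  by (rule lattice_ext) (auto simp: trans_def orig_def)

lemma trans_diff: "a \<in> L \<Longrightarrow> trans b (diff a b) = a"
  by (rule lattice_ext) (auto simp: trans_def diff_def)

lemma diff_self: "diff a a = orig"
  by (rule lattice_ext) (auto simp: orig_def diff_def)

lemma iso_trans: "iso (trans c) (c d)"
proof (rule isoI[where t = "\<lambda>v. diff v c"])
  show "dl (trans c u) (trans c w) = dl u w" for u w
    unfolding l1_dist_def trans_def by (rule sum.cong) auto
  show "trans c w d = w d + c d" for w using d_in by (simp add: trans_def)
  show "diff (trans c v) c = v" if "v \<in> L" for v
    using that by (intro lattice_ext) (auto simp: trans_def diff_def)
qed (auto simp: trans_diff)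

text \<open>Covers both symmetries in use: a reflection (\<open>\<tau>\<close> the identity) and a
  swap of two coordinates (all signs 1). The conditions at \<open>d\<close> preserve levels, and
  \<open>\<epsilon> j * \<epsilon> (\<tau> j) = 1\<close> makes \<open>sg\<close> its own
  inverse.\<close>

definition signed_involution :: "(nat \<Rightarrow> int) \<Rightarrow> (nat \<Rightarrow> nat) \<Rightarrow> bool" where
  "signed_involution \<epsilon> \<tau> \<longleftrightarrow> \<epsilon> d = 1 \<and> \<tau> d = d \<and>
     (\<forall>j\<in>{1..d}. \<tau> j \<in> {1..d} \<and> \<tau> (\<tau> j) = j \<and> \<epsilon> j * \<epsilon> (\<tau> j) = 1 \<and> \<bar>\<epsilon> j\<bar> = 1)"

definition sg :: "(nat \<Rightarrow> int) \<Rightarrow> (nat \<Rightarrow> nat) \<Rightarrow> (nat \<Rightarrow> int) \<Rightarrow> (nat \<Rightarrow> int) \<Rightarrow> (nat \<Rightarrow> int)" where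
  "sg \<epsilon> \<tau> c v = (\<lambda>j\<in>{1..d}. c j + \<epsilon> j * (v (\<tau> j) - c (\<tau> j)))"

context
  fixes \<epsilon> :: "nat \<Rightarrow> int" and \<tau> :: "nat \<Rightarrow> nat"
  assumes si: "signed_involution \<epsilon> \<tau>"
begin

lemma sg_L [simp]: "sg \<epsilon> \<tau> c v \<in> L"
  by (simp add: sg_def)

lemma sg_invol: "v \<in> L \<Longrightarrow> sg \<epsilon> \<tau> c (sg \<epsilon> \<tau> c v) = v"
proof (rule lattice_ext)
  fix j assume j: "j \<in> {1..d}"
  have s: "\<tau> j \<in> {1..d}" "\<tau> (\<tau> j) = j" "\<epsilon> j * \<epsilon> (\<tau> j) = 1"
    using si j by (auto simp: signed_involution_def)
  have "sg \<epsilon> \<tau> c (sg \<epsilon> \<tau> c v) j = c j + (\<epsilon> j * \<epsilon> (\<tau> j)) * (v j - c j)"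
    using j s(1,2) by (simp add: sg_def algebra_simps)
  thus "sg \<epsilon> \<tau> c (sg \<epsilon> \<tau> c v) j = v j" using s(3) by simp
qed auto

lemma sg_dl: "dl (sg \<epsilon> \<tau> c u) (sg \<epsilon> \<tau> c w) = dl u w"
proof -
  have "dl (sg \<epsilon> \<tau> c u) (sg \<epsilon> \<tau> c w) = (\<Sum>j\<in>{1..d}. \<bar>u (\<tau> j) - w (\<tau> j)\<bar>)"
    unfolding l1_dist_def
  proof (rule sum.cong)
    fix j assume j: "j \<in> {1..d}"
    have "sg \<epsilon> \<tau> c u j - sg \<epsilon> \<tau> c w j = \<epsilon> j * (u (\<tau> j) - w (\<tau> j))"
      using j by (simp add: sg_def algebra_simps)
    moreover have "\<bar>\<epsilon> j\<bar> = 1" using si j by (auto simp: signed_involution_def)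
    ultimately show "\<bar>sg \<epsilon> \<tau> c u j - sg \<epsilon> \<tau> c w j\<bar> = \<bar>u (\<tau> j) - w (\<tau> j)\<bar>"
      by (simp add: abs_mult)
  qed auto
  also have "\<dots> = dl u w"
    unfolding l1_dist_def using si
    by (intro sum.reindex_bij_witness[of _ \<tau> \<tau>]) (auto simp: signed_involution_def)
  finally show ?thesis .
qed

lemma sg_d [simp]: "sg \<epsilon> \<tau> c v d = v d"
  using si d_in by (simp add: sg_def signed_involution_def)

lemma sg_centre: "c \<in> L \<Longrightarrow> sg \<epsilon> \<tau> c c = c"
  by (rule lattice_ext) (auto simp: sg_def)

lemma sg_dl_centre: "c \<in> L \<Longrightarrow> dl c (sg \<epsilon> \<tau> c v) = dl c v"
  using sg_dl[of c c v] sg_centre by simp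

lemma iso_sg: "iso (sg \<epsilon> \<tau> c) 0"
  by (rule isoI[where t = "sg \<epsilon> \<tau> c"]) (simp_all add: sg_invol sg_dl)

text \<open>For disjoint balls this is a bijection of \<open>L\<close>, which is enough to preserve
  the product measure, though not an isometry. Each ball is mapped onto itself, and on it the map
  agrees with the isometry \<open>sg\<close> about its centre.\<close>

definition local_sg :: "int \<Rightarrow> (nat \<Rightarrow> int) \<Rightarrow> (nat \<Rightarrow> int) \<Rightarrow> (nat \<Rightarrow> int) \<Rightarrow> (nat \<Rightarrow> int)" where
  "local_sg r a b v = (if dl a v \<le> r then sg \<epsilon> \<tau> a v else if dl b v \<le> r then sg \<epsilon> \<tau> b v else v)"

context
  fixes r :: int and a b :: "nat \<Rightarrow> int"
  assumes a: "a \<in> L" and b: "b \<in> L" and far: "2 * r < dl a b"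
begin

lemma far_balls: "dl b v \<le> r \<Longrightarrow> \<not> dl a v \<le> r"
  using far l1_triangle[of d a b v] l1_commute[of d v b] by linarith

lemma bij_local_sg: "bij_betw (local_sg r a b) L L"
proof (rule bij_betw_byWitness[of _ "local_sg r a b"])
  have "local_sg r a b (local_sg r a b v) = v" if "v \<in> L" for v
    using that far_balls[of v] far_balls[of "sg \<epsilon> \<tau> b v"] a b
    by (auto simp: local_sg_def sg_invol sg_dl_centre)
  thus "\<forall>v\<in>L. local_sg r a b (local_sg r a b v) = v" "\<forall>v\<in>L. local_sg r a b (local_sg r a b v) = v"
    by auto
qed (auto simp: local_sg_def)

text \<open>By \<open>reg_cong\<close>, such a regeneration is decided inside the ball of radius
  \<open>r\<close> about \<open>c\<close>, where the local map cannot be told from the global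
  isometry.\<close>

lemma reg_pull_local:
  assumes c: "c = a \<or> c = b" and x: "x \<in> L" "(x d - c d)\<^sup>2 \<le> r"
  shows "reg (pull (local_sg r a b) U) c x \<longleftrightarrow> reg U c (sg \<epsilon> \<tau> c x)"
proof -
  have cL: "c \<in> L" using c a b by auto
  have eq: "pull (local_sg r a b) U w = pull (sg \<epsilon> \<tau> c) U w"
    if "w \<in> L" "dl c w \<le> (x d - c d)\<^sup>2" for w
  proof -
    have "dl c w \<le> r" using that x(2) by linarith
    hence "local_sg r a b w = sg \<epsilon> \<tau> c w" using c far_balls[of w] by (auto simp: local_sg_def)
    thus ?thesis using that(1) by (simp add: pull_def)
  qed
  have "reg (pull (local_sg r a b) U) c x \<longleftrightarrow> reg (pull (sg \<epsilon> \<tau> c) U) c x"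
    using eq by (auto intro: reg_cong[OF _ cL])
  also have "\<dots> \<longleftrightarrow> reg U (sg \<epsilon> \<tau> c c) (sg \<epsilon> \<tau> c x)"
    by (rule reg_iso[OF iso_sg cL x(1)])
  finally show ?thesis using sg_centre[OF cL] by simp
qed

lemma joint_pull_local:
  assumes ab: "a d = b d" and n: "(n - a d)\<^sup>2 \<le> r"
  shows "joint (pull (local_sg r a b) U) a b n \<longleftrightarrow> joint U a b n"
proof -
  have sq: "(x d - a d)\<^sup>2 \<le> r" if "a d < x d" "x d \<le> n" for x :: "nat \<Rightarrow> int"
    using power_mono[of "x d - a d" "n - a d" 2] that n by linarith
  note R = reg_pull_local[of a] reg_pull_local[of b]
  show ?thesis
  proof
    assume "joint (pull (local_sg r a b) U) a b n"
    then obtain x y where xy: "x d = y d" "a d < x d" "x d \<le> n"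
      "reg (pull (local_sg r a b) U) a x" "reg (pull (local_sg r a b) U) b y"
      by (auto simp: joint_def)
    hence "reg U a (sg \<epsilon> \<tau> a x)" "reg U b (sg \<epsilon> \<tau> b y)"
      using R(1)[of x U] R(2)[of y U] sq[of x] reg_ball[OF xy(4) a] reg_ball[OF xy(5) b] ab by auto
    thus "joint U a b n" using xy unfolding joint_def
      by (intro exI[of _ "sg \<epsilon> \<tau> a x"] exI[of _ "sg \<epsilon> \<tau> b y"]) auto
  next
    assume "joint U a b n"
    then obtain x y where xy: "x d = y d" "a d < x d" "x d \<le> n" "reg U a x" "reg U b y"
      by (auto simp: joint_def)
    have L: "x \<in> L" "y \<in> L" using reg_ball[OF xy(4) a] reg_ball[OF xy(5) b] by auto
    have "reg (pull (local_sg r a b) U) a (sg \<epsilon> \<tau> a x)" "reg (pull (local_sg r a b) U) b (sg \<epsilon> \<tau> b y)"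
      using R(1)[of "sg \<epsilon> \<tau> a x" U] R(2)[of "sg \<epsilon> \<tau> b y" U] sq[of x] xy ab L by (auto simp: sg_invol)
    thus "joint (pull (local_sg r a b) U) a b n" using xy unfolding joint_def
      by (intro exI[of _ "sg \<epsilon> \<tau> a x"] exI[of _ "sg \<epsilon> \<tau> b y"]) auto
  qed
qed

lemma FR_pull_local:
  assumes ab: "a d = b d" and x: "x \<in> L" "y \<in> L" "(x d - a d)\<^sup>2 \<le> r"
  shows "FR (pull (local_sg r a b) U) a b x y \<longleftrightarrow> FR U a b (sg \<epsilon> \<tau> a x) (sg \<epsilon> \<tau> b y)"
proof (cases "x d = y d \<and> a d < x d")
  case True
  have "(x d - 1 - a d)\<^sup>2 \<le> r"
    using power_mono[of "x d - 1 - a d" "x d - a d" 2] x(3) True by linarith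
  thus ?thesis unfolding FR_def
    using reg_pull_local[of a x U] reg_pull_local[of b y U] joint_pull_local[OF ab, of "x d - 1" U] x ab True
    by auto
qed (auto simp: FR_def)

end

end

section \<open>The kernel of the joint regeneration points\<close>

definition Q :: "(nat \<Rightarrow> int) \<Rightarrow> (nat \<Rightarrow> int) \<Rightarrow> (nat \<Rightarrow> int) \<times> (nat \<Rightarrow> int) \<Rightarrow> real" where
  "Q a b xy = N.prob {U \<in> space N. FR U a b (fst xy) (snd xy)}"

text \<open>By \<open>FR_in_J\<close>, the distance bounds hold for every first joint regeneration
  within \<open>t\<close> levels. They make the set finite and, being centred at \<open>a\<close>
  and \<open>b\<close>, are respected by the symmetries.\<close>

definition J :: "nat \<Rightarrow> (nat \<Rightarrow> int) \<Rightarrow> (nat \<Rightarrow> int) \<Rightarrow> ((nat \<Rightarrow> int) \<times> (nat \<Rightarrow> int)) set" where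
  "J t a b = {(x, y). x \<in> L \<and> y \<in> L \<and> x d = y d \<and> a d < x d \<and> x d \<le> a d + int t \<and>
     dl a x \<le> (int t)\<^sup>2 \<and> dl b y \<le> (int t)\<^sup>2}"

text \<open>Expectation after one round of the chain of differences started at \<open>z\<close>,
  restricted to rounds of at most \<open>t\<close> levels. By \<open>sum_Q\<close> the total mass is
  \<open>1 - tail t orig z\<close>.\<close>

abbreviation mean :: "nat \<Rightarrow> (nat \<Rightarrow> int) \<Rightarrow> ((nat \<Rightarrow> int) \<Rightarrow> real) \<Rightarrow> real" where
  "mean t z f \<equiv> (\<Sum>xy\<in>J t orig z. Q orig z xy * f (diff (snd xy) (fst xy)))"

lemma Q_nonneg [simp]: "0 \<le> Q a b xy"
  by (simp add: Q_def)

lemma finite_J [simp]: "finite (J t a b)"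
  by (rule finite_subset[of _ "{x \<in> L. dl a x \<le> (int t)\<^sup>2} \<times> {y \<in> L. dl b y \<le> (int t)\<^sup>2}"])
     (auto simp: J_def finite_l1_ball)

lemma J_mono: "s \<le> t \<Longrightarrow> J s a b \<subseteq> J t a b"
proof -
  assume "s \<le> t"
  hence sq: "(int s)\<^sup>2 \<le> (int t)\<^sup>2" and le: "int s \<le> int t" by (auto intro: power_mono)
  show ?thesis unfolding J_def
    by (clarify, intro conjI) (use le in \<open>auto intro: order_trans[OF _ sq]\<close>)
qed

lemma FR_in_J:
  assumes "FR U a b x y" "a \<in> L" "b \<in> L" "a d = b d" "x d \<le> a d + int t"
  shows "(x, y) \<in> J t a b"
proof -
  have xy: "x d = y d" "a d < x d" "reg U a x" "reg U b y" using assms(1) by (auto simp: FR_def)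
  have "(x d - a d)\<^sup>2 \<le> (int t)\<^sup>2" using xy assms(5) by (intro power_mono) auto
  hence "dl a x \<le> (int t)\<^sup>2" "dl b y \<le> (int t)\<^sup>2"
    using xy(1) reg_ball[OF xy(3) assms(2)] reg_ball[OF xy(4) assms(3)] assms(4) by simp_all
  with xy reg_ball[OF xy(3) assms(2)] reg_ball[OF xy(4) assms(3)] assms(5) show ?thesis
    by (simp add: J_def)
qed

lemma Q_sg:
  assumes si: "signed_involution \<epsilon> \<tau>" and ab: "a \<in> L" "b \<in> L" "a d = b d"
    and far: "2 * (int t)\<^sup>2 < dl a b" and xy: "(x, y) \<in> J t a b"
  shows "Q a b (sg \<epsilon> \<tau> a x, sg \<epsilon> \<tau> b y) = Q a b (x, y)"
proof -
  have "(x d - a d)\<^sup>2 \<le> (int t)\<^sup>2" using xy by (intro power_mono) (auto simp: J_def)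
  hence "FR (pull (local_sg \<epsilon> \<tau> ((int t)\<^sup>2) a b) U) a b x y \<longleftrightarrow> FR U a b (sg \<epsilon> \<tau> a x) (sg \<epsilon> \<tau> b y)" for U
    using xy ab by (intro FR_pull_local[OF si ab(1,2) far]) (auto simp: J_def)
  thus ?thesis unfolding Q_def
    using prob_pull[OF bij_local_sg[OF si ab(1,2) far], of "\<lambda>U. FR U a b x y"] ab by simp
qed

lemma sum_Q_sg:
  assumes si: "signed_involution \<epsilon> \<tau>" and ab: "a \<in> L" "b \<in> L" "a d = b d"
    and far: "2 * (int t)\<^sup>2 < dl a b"
  shows "(\<Sum>xy\<in>J t a b. Q a b xy * f xy) =
    (\<Sum>xy\<in>J t a b. Q a b xy * f (sg \<epsilon> \<tau> a (fst xy), sg \<epsilon> \<tau> b (snd xy)))"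
proof -
  define h where "h xy = (sg \<epsilon> \<tau> a (fst xy), sg \<epsilon> \<tau> b (snd xy))" for xy
  have hJ: "h xy \<in> J t a b" "h (h xy) = xy" if "xy \<in> J t a b" for xy
    using that ab by (auto simp: h_def J_def sg_L[OF si] sg_d[OF si] sg_dl_centre[OF si] sg_invol[OF si])
  have "(\<Sum>xy\<in>J t a b. Q a b xy * f xy) = (\<Sum>xy\<in>J t a b. Q a b (h xy) * f (h xy))"
    by (rule sum.reindex_bij_witness[of _ h h]) (use hJ in auto)
  also have "\<dots> = (\<Sum>xy\<in>J t a b. Q a b xy * f (h xy))"
    by (intro sum.cong refl) (use Q_sg[OF assms] in \<open>auto simp: h_def\<close>)
  finally show ?thesis by (simp add: h_def)
qed

definition D :: "(nat \<Rightarrow> int) \<Rightarrow> (nat \<Rightarrow> int) \<Rightarrow> nat \<Rightarrow> (nat \<Rightarrow> int) \<times> (nat \<Rightarrow> int) \<Rightarrow> real" where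
  "D a b j xy = of_int ((snd xy j - b j) - (fst xy j - a j))"

lemma D_sg:
  assumes "j \<in> {1..d}"
  shows "D a b j (sg \<epsilon> \<tau> a x, sg \<epsilon> \<tau> b y) = of_int (\<epsilon> j) * D a b (\<tau> j) (x, y)"
  using assms by (simp add: D_def sg_def algebra_simps)

text \<open>Reflecting coordinate \<open>i\<close> preserves the kernel and flips the sign of
  \<open>D a b i\<close> alone, so the first two sums equal their own negatives. Swapping
  \<open>i\<close> and \<open>k\<close> exchanges the two variances.\<close>

lemma
  assumes ab: "a \<in> L" "b \<in> L" "a d = b d" and far: "2 * (int t)\<^sup>2 < dl a b" and i: "i \<in> {1..<d}"
  shows sum_Q_D: "(\<Sum>xy\<in>J t a b. Q a b xy * D a b i xy) = 0"
    and sum_Q_DD: "k \<in> {1..<d} \<Longrightarrow> i \<noteq> k \<Longrightarrow> (\<Sum>xy\<in>J t a b. Q a b xy * (D a b i xy * D a b k xy)) = 0"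
    and sum_Q_D2: "k \<in> {1..<d} \<Longrightarrow>
      (\<Sum>xy\<in>J t a b. Q a b xy * (D a b i xy)\<^sup>2) = (\<Sum>xy\<in>J t a b. Q a b xy * (D a b k xy)\<^sup>2)"
proof -
  define \<epsilon> :: "nat \<Rightarrow> int" where "\<epsilon> j = (if j = i then - 1 else 1)" for j
  have si: "signed_involution \<epsilon> (\<lambda>j. j)" using i by (auto simp: signed_involution_def \<epsilon>_def)
  have i': "i \<in> {1..d}" using i by auto
  have "(\<Sum>xy\<in>J t a b. Q a b xy * D a b i xy) = (\<Sum>xy\<in>J t a b. - (Q a b xy * D a b i xy))"
    unfolding sum_Q_sg[OF si ab far, of "D a b i"]
    by (intro sum.cong refl) (simp add: D_sg[OF i'] \<epsilon>_def)
  thus "(\<Sum>xy\<in>J t a b. Q a b xy * D a b i xy) = 0" by (simp add: sum_negf)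
  show "(\<Sum>xy\<in>J t a b. Q a b xy * (D a b i xy * D a b k xy)) = 0" if k: "k \<in> {1..<d}" "i \<noteq> k"
  proof -
    have k': "k \<in> {1..d}" using k by auto
    have "(\<Sum>xy\<in>J t a b. Q a b xy * (D a b i xy * D a b k xy)) =
        (\<Sum>xy\<in>J t a b. - (Q a b xy * (D a b i xy * D a b k xy)))"
      unfolding sum_Q_sg[OF si ab far, of "\<lambda>xy. D a b i xy * D a b k xy"]
      using k(2) by (intro sum.cong refl) (simp add: D_sg[OF i'] D_sg[OF k'] \<epsilon>_def)
    thus ?thesis by (simp add: sum_negf)
  qed
  show "(\<Sum>xy\<in>J t a b. Q a b xy * (D a b i xy)\<^sup>2) = (\<Sum>xy\<in>J t a b. Q a b xy * (D a b k xy)\<^sup>2)"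
    if k: "k \<in> {1..<d}"
  proof -
    define \<tau> where "\<tau> j = (if j = i then k else if j = k then i else j)" for j
    have si: "signed_involution (\<lambda>_. 1) \<tau>" using i k by (auto simp: signed_involution_def \<tau>_def)
    show ?thesis
      unfolding sum_Q_sg[OF si ab far, of "\<lambda>xy. (D a b i xy)\<^sup>2"]
      by (intro sum.cong refl) (simp add: D_sg[OF i'] \<tau>_def)
  qed
qed

section \<open>Renewal\<close>

lemma nice_measurable [measurable]: "Measurable.pred N nice"
proof -
  have 1: "Measurable.pred N (\<lambda>U. v \<noteq> w \<longrightarrow> \<not> (U v \<le> U w \<and> U w \<le> U v))" if "v \<in> L" "w \<in> L" for v w
    using le_measurable[OF that] le_measurable[OF that(2,1)] by measurable
  have 2: "Measurable.pred N (\<lambda>U. U w < p \<and> w d = k)" if "w \<in> L" for w k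
    using component_measurable[OF that] by measurable
  have "nice = (\<lambda>U. (\<forall>v\<in>L. \<forall>w\<in>L. v \<noteq> w \<longrightarrow> \<not> (U v \<le> U w \<and> U w \<le> U v)) \<and> (\<forall>k. \<exists>w\<in>L. U w < p \<and> w d = k))"
    unfolding fun_eq_iff nice_def inj_on_def order.eq_iff[symmetric] by blast
  thus ?thesis
    by (simp only:) (intro pred_intros_logic(3) pred_intros_countable measurable_pred_countable
        countable_lattice_points 1 2)
qed

lemma prob_nice: "Measurable.pred N P \<Longrightarrow> N.prob {U \<in> space N. nice U \<and> P U} = N.prob {U \<in> space N. P U}"
  by (rule N.finite_measure_eq_AE) (use AE_nice in \<open>auto simp: pred_def elim: eventually_mono\<close>)

definition tail :: "nat \<Rightarrow> (nat \<Rightarrow> int) \<Rightarrow> (nat \<Rightarrow> int) \<Rightarrow> real" where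
  "tail t a b = N.prob {U \<in> space N. \<not> joint U a b (a d + int t)}"

lemma tail_nonneg [simp]: "0 \<le> tail t a b"
  by (simp add: tail_def)

text \<open>In a nice environment the first joint regeneration is unique, so the events behind
  \<open>Q\<close> are disjoint.\<close>

lemma sum_Q:
  assumes ab: "a \<in> L" "b \<in> L" "a d = b d"
  shows "(\<Sum>xy\<in>J t a b. Q a b xy) = 1 - tail t a b"
proof -
  note [measurable] = ab(1,2)
  have "(\<Sum>xy\<in>J t a b. Q a b xy) = (\<Sum>xy\<in>J t a b. N.prob {U \<in> space N. nice U \<and> FR U a b (fst xy) (snd xy)})"
    unfolding Q_def by (intro sum.cong refl prob_nice[symmetric]) measurable
  also have "\<dots> = N.prob (\<Union>xy\<in>J t a b. {U \<in> space N. nice U \<and> FR U a b (fst xy) (snd xy)})"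
    by (rule N.finite_measure_finite_Union[symmetric])
       (auto simp: disjoint_family_on_def dest: FR_unique[OF nice_inj])
  also have "(\<Union>xy\<in>J t a b. {U \<in> space N. nice U \<and> FR U a b (fst xy) (snd xy)}) =
     {U \<in> space N. nice U \<and> joint U a b (a d + int t)}"
    unfolding joint_iff_FR using FR_in_J[OF _ ab] by (force simp: J_def)
  also have "N.prob \<dots> = N.prob {U \<in> space N. joint U a b (a d + int t)}"
    by (rule prob_nice) measurable
  also have "\<dots> = 1 - tail t a b"
    unfolding tail_def by (subst N.prob_neg) auto
  finally show ?thesis .
qed

lemma reg_cong_levels:
  assumes "\<And>v. v \<in> L \<Longrightarrow> v d \<le> x d \<Longrightarrow> U v = U' v" "a \<in> L"
  shows "reg U a x = reg U' a x"
  using assms by (auto intro: reg_cong[OF _ assms(2)])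

lemma depends_FR:
  assumes ab: "a \<in> L" "b \<in> L"
  shows "depends (\<lambda>U. FR U a b x y) {v \<in> L. v d \<le> x d}"
  unfolding depends_def
proof (intro allI impI)
  fix U U' :: "(nat \<Rightarrow> int) \<Rightarrow> real"
  assume eq: "\<forall>v\<in>{v \<in> L. v d \<le> x d}. U v = U' v"
  have R: "reg U c u = reg U' c u" if "u d \<le> x d" "c \<in> L" for c u
    using eq that by (intro reg_cong_levels) auto
  have "joint U a b (x d - 1) = joint U' a b (x d - 1)"
    unfolding joint_def
  proof (intro ex_cong1)
    fix u v
    show "(u d = v d \<and> a d < u d \<and> u d \<le> x d - 1 \<and> reg U a u \<and> reg U b v) =
          (u d = v d \<and> a d < u d \<and> u d \<le> x d - 1 \<and> reg U' a u \<and> reg U' b v)"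
      using R[of u a] R[of v b] ab by auto
  qed
  thus "FR U a b x y = FR U' a b x y"
    unfolding FR_def using R[of x a] R[of y b] ab by auto
qed

lemma depends_trail: "depends (\<lambda>U. trail U a m) {v \<in> L. a d < v d}"
  unfolding depends_def by (auto intro: trail_cong)

lemma depends_meetsn:
  assumes "a d = b d" shows "depends (\<lambda>U. meetsn n U a b) {v \<in> L. a d < v d}"
  unfolding depends_def
proof (intro allI impI)
  fix U U' :: "(nat \<Rightarrow> int) \<Rightarrow> real"
  assume eq: "\<forall>v\<in>{v \<in> L. a d < v d}. U v = U' v"
  have "trail U a m = trail U' a m" "trail U b m = trail U' b m" for m
    using eq assms by (auto intro!: dependsD[OF depends_trail])
  thus "meetsn n U a b = meetsn n U' a b" by (simp add: meetsn_def)
qed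

lemma depends_meets:
  assumes "a d = b d" shows "depends (\<lambda>U. meets U a b) {v \<in> L. a d < v d}"
  using depends_meetsn[of a b, OF assms] unfolding depends_def meets_iff_meetsn by blast

text \<open>\<open>FR U a b x y\<close> is decided on levels up to \<open>x d\<close> and
  \<open>R x y\<close> strictly above, so their probabilities multiply. The one-sided form serves
  both meeting within finitely many levels and never meeting.\<close>

lemma renewal:
  assumes ab: "a \<in> L" "b \<in> L" "a d = b d"
    and P [measurable]: "Measurable.pred N P"
    and R: "\<And>x y. x \<in> L \<Longrightarrow> y \<in> L \<Longrightarrow> Measurable.pred N (R x y)"
    and dep: "\<And>x y. x d = y d \<Longrightarrow> depends (R x y) {v \<in> L. x d < v d}"
    and step: "\<And>U x y. nice U \<Longrightarrow> P U \<Longrightarrow> FR U a b x y \<Longrightarrow> R x y U"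
  shows "N.prob {U \<in> space N. P U} \<le>
    (\<Sum>xy\<in>J t a b. Q a b xy * N.prob {U \<in> space N. R (fst xy) (snd xy) U}) + tail t a b"
proof -
  note [measurable] = ab(1,2)
  have JL: "fst xy \<in> L" "snd xy \<in> L" "fst xy d = snd xy d" if "xy \<in> J t a b" for xy
    using that by (auto simp: J_def)
  define E where "E xy = {U \<in> space N. FR U a b (fst xy) (snd xy) \<and> R (fst xy) (snd xy) U}" for xy
  have E [measurable]: "E xy \<in> N.events" if "xy \<in> J t a b" for xy
    using R[OF JL(1,2)[OF that]] unfolding E_def by measurable
  define F where "F = {U \<in> space N. \<not> joint U a b (a d + int t)}"
  have F: "F \<in> N.events" unfolding F_def by measurable
  have UE: "(\<Union>xy\<in>J t a b. E xy) \<in> N.events" by (intro sets.finite_UN) (auto intro: E)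
  have "N.prob {U \<in> space N. P U} \<le> N.prob ((\<Union>xy\<in>J t a b. E xy) \<union> F)"
  proof (rule N.finite_measure_mono_AE)
    show "AE U in N. U \<in> {U \<in> space N. P U} \<longrightarrow> U \<in> (\<Union>xy\<in>J t a b. E xy) \<union> F"
      using AE_nice
    proof eventually_elim
      fix U assume n: "nice U"
      show "U \<in> {U \<in> space N. P U} \<longrightarrow> U \<in> (\<Union>xy\<in>J t a b. E xy) \<union> F"
      proof
        assume U: "U \<in> {U \<in> space N. P U}"
        show "U \<in> (\<Union>xy\<in>J t a b. E xy) \<union> F"
        proof (cases "joint U a b (a d + int t)")
          case True
          then obtain x y where xy: "FR U a b x y" "x d \<le> a d + int t" by (auto simp: joint_iff_FR)
          have "(x, y) \<in> J t a b" by (rule FR_in_J[OF xy(1) ab xy(2)])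
          moreover have "U \<in> E (x, y)" using U xy step[OF n _ xy(1)] by (simp add: E_def)
          ultimately show ?thesis by blast
        qed (use U in \<open>simp add: F_def\<close>)
      qed
    qed
  qed (use UE F in auto)
  also have "\<dots> \<le> N.prob (\<Union>xy\<in>J t a b. E xy) + N.prob F"
    by (rule measure_Un_le[OF UE F])
  also have "N.prob (\<Union>xy\<in>J t a b. E xy) \<le> (\<Sum>xy\<in>J t a b. N.prob (E xy))"
    by (rule N.finite_measure_subadditive_finite) (auto intro: E)
  also have "\<dots> = (\<Sum>xy\<in>J t a b. Q a b xy * N.prob {U \<in> space N. R (fst xy) (snd xy) U})"
    unfolding E_def Q_def
    by (intro sum.cong refl depends_indep[OF _ _ depends_FR dep]) (use JL R ab in auto)
  finally show ?thesis by (simp add: F_def tail_def)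
qed

section \<open>Meeting probabilities as functions of the difference\<close>

definition u :: "nat \<Rightarrow> (nat \<Rightarrow> int) \<Rightarrow> real" where
  "u n z = N.prob {U \<in> space N. meetsn n U orig z}"

definition g :: "(nat \<Rightarrow> int) \<Rightarrow> real" where
  "g z = N.prob {U \<in> space N. \<not> meets U orig z}"

lemma prob_translate:
  assumes [measurable]: "\<And>a b. a \<in> L \<Longrightarrow> b \<in> L \<Longrightarrow> Measurable.pred N (P a b)"
    and "\<And>U. P orig (diff y x) (pull (trans x) U) = P (trans x orig) (trans x (diff y x)) U"
    and "x \<in> L" "y \<in> L"
  shows "N.prob {U \<in> space N. P x y U} = N.prob {U \<in> space N. P orig (diff y x) U}"
  using prob_pull[OF isoD(1)[OF iso_trans], of "P orig (diff y x)" x] assms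
  by (simp add: trans_orig trans_diff)

lemma prob_meetsn: "x \<in> L \<Longrightarrow> y \<in> L \<Longrightarrow> N.prob {U \<in> space N. meetsn n U x y} = u n (diff y x)"
  unfolding u_def using prob_translate[of "\<lambda>a b U. meetsn n U a b" y x] meetsn_iso[OF iso_trans, of orig "diff y x"]
  by simp

lemma prob_not_meets: "x \<in> L \<Longrightarrow> y \<in> L \<Longrightarrow> N.prob {U \<in> space N. \<not> meets U x y} = g (diff y x)"
  unfolding g_def using prob_translate[of "\<lambda>a b U. \<not> meets U a b" y x] meets_iso[OF iso_trans, of orig "diff y x"]
  by simp

lemma u_renewal:
  assumes "z \<in> L" "z d = 0"
  shows "u (Suc n) z \<le> mean t z (u n) + tail t orig z"
proof -
  have "u (Suc n) z \<le> (\<Sum>xy\<in>J t orig z. Q orig z xy * N.prob {U \<in> space N. meetsn n U (fst xy) (snd xy)}) + tail t orig z"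
    unfolding u_def
  proof (rule renewal[where R = "\<lambda>x y U. meetsn n U x y"])
    show "depends (\<lambda>U. meetsn n U x y) {v \<in> L. x d < v d}" if "x d = y d" for x y
      by (rule depends_meetsn[of x y, OF that])
  qed (use assms in \<open>auto intro: meetsn_FR[OF nice_inj]\<close>)
  also have "(\<Sum>xy\<in>J t orig z. Q orig z xy * N.prob {U \<in> space N. meetsn n U (fst xy) (snd xy)}) =
     mean t z (u n)"
    by (intro sum.cong refl) (auto simp: J_def prob_meetsn)
  finally show ?thesis .
qed

lemma g_renewal:
  assumes "z \<in> L" "z d = 0"
  shows "g z \<le> mean t z g + tail t orig z"
proof -
  have dep: "depends (\<lambda>U. \<not> meets U x y) {v \<in> L. x d < v d}" if "x d = y d" for x y
    using depends_meets[of x y, OF that] unfolding depends_def by blast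
  have "g z \<le> (\<Sum>xy\<in>J t orig z. Q orig z xy * N.prob {U \<in> space N. \<not> meets U (fst xy) (snd xy)}) + tail t orig z"
    unfolding g_def
  proof (rule renewal[where R = "\<lambda>x y U. \<not> meets U x y"])
    show "depends (\<lambda>U. \<not> meets U x y) {v \<in> L. x d < v d}" if "x d = y d" for x y
      by (rule dep[of x y, OF that])
  qed (use assms in \<open>auto intro: meets_FR\<close>)
  also have "(\<Sum>xy\<in>J t orig z. Q orig z xy * N.prob {U \<in> space N. \<not> meets U (fst xy) (snd xy)}) =
     mean t z g"
    by (intro sum.cong refl) (auto simp: J_def prob_not_meets)
  finally show ?thesis .
qed

lemma u_le_1: "u n z \<le> 1" and g_le_1: "g z \<le> 1" and g_nonneg: "0 \<le> g z"
  by (simp_all add: u_def g_def)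

lemma u_0: "z d = 0 \<Longrightarrow> z \<noteq> orig \<Longrightarrow> u 0 z = 0"
proof -
  assume "z d = 0" "z \<noteq> orig"
  hence "\<not> meetsn 0 U orig z" for U using meetsn_0[of U orig z] by (auto simp only: orig_d)
  thus "u 0 z = 0" by (simp add: u_def)
qed

lemma g_orig: "g orig = 0"
proof -
  have "meets U orig orig" for U by (auto simp: meets_def intro: exI[of _ orig])
  thus ?thesis by (simp add: g_def)
qed

section \<open>Explicit configurations\<close>

lemma Q_ge:
  assumes "finite A" "finite B" "A \<subseteq> L" "B \<subseteq> L" "A \<inter> B = {}" "a \<in> L" "b \<in> L"
    and "\<And>U. (\<forall>v\<in>A. U v < p) \<Longrightarrow> (\<forall>v\<in>B. p \<le> U v) \<Longrightarrow> FR U a b x y"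
  shows "p ^ card A * (1 - p) ^ card B \<le> Q a b (x, y)"
  unfolding open_closed_prob[OF assms(1-5), symmetric] Q_def
  by (rule N.finite_measure_mono) (use assms in auto)

lemma hop_apex:
  assumes "a \<in> L" "U (a(d := a d + 1)) < p"
  shows "hop U a (a(d := a d + 1))"
proof (rule hop_unique_nearest)
  fix w assume w: "w \<in> L" "a d < w d" "dl a w \<le> dl a (a(d := a d + 1))" "w \<noteq> a(d := a d + 1)"
  have "\<bar>a d - w d\<bar> \<le> dl a w" by (rule level_le_dl)
  with w have "w d = a d + 1" by simp
  moreover from this have "w = a(d := w d)" using w assms(1) by (intro apex_unique) auto
  ultimately show "p \<le> U w" using w(4) by simp
qed (use assms upd_in_L in auto)

lemma st_first:
  assumes "reg U a x" "a d < x d"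
  shows "\<exists>v. hop U a v \<and> dl a v \<le> x d - a d"
  using assms(1) unfolding reg_def
proof (cases rule: converse_rtranclpE)
  case base
  thus ?thesis using assms(2) by simp
next
  case (step v)
  from step(1) have "hop U a v" "a d + dl a v \<le> x d" by (simp_all add: st_def)
  thus ?thesis by (intro exI[of _ v]) simp
qed

text \<open>Bounds the variance of an increment from below, uniformly in \<open>z\<close>. The path
  of the origin moves diagonally to \<open>w1\<close> and then up, the path of \<open>z\<close>
  straight up twice; this prescribes a number of vertices that does not grow with
  \<open>z\<close>.\<close>

lemma Q_unit_step:
  "\<exists>c>0. \<forall>z\<in>L. z d = 0 \<longrightarrow> 4 < dl orig z \<longrightarrow>
     (\<exists>x y. (x, y) \<in> J 2 orig z \<and> (D orig z 1 (x, y))\<^sup>2 = 1 \<and> c \<le> Q orig z (x, y))"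
proof -
  have d1: "d \<noteq> 1" "1 \<noteq> d" "1 \<in> {1..d} - {d}" using d_ge_2 by auto
  define w1 where "w1 = (orig(1 := 1))(d := 1)"
  define w2 where "w2 = w1(d := w1 d + 1)"
  \<comment> \<open>Closing the rest of this half ball forces the first step to \<open>w1\<close>
    and excludes a joint regeneration already on level 1.\<close>
  define B where "B = {v \<in> L. dl orig v \<le> 2} \<inter> {v. 0 < v d \<and> v \<noteq> w1}"
  have w1L: "w1 \<in> L" using d_ge_2
    by (auto simp: w1_def lattice_points_def PiE_iff extensional_def orig_def)
  have w2L: "w2 \<in> L" unfolding w2_def by (rule upd_in_L[OF w1L])
  have "(\<Sum>k\<in>{1..d} - {d}. \<bar>orig k - w1 k\<bar>) = (\<Sum>k\<in>{1..d} - {d}. if k = 1 then 1 else 0)"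
    using d1 by (intro sum.cong) (auto simp: w1_def orig_def)
  hence s: "(\<Sum>k\<in>{1..d} - {d}. \<bar>orig k - w1 k\<bar>) = 1" using d1(3) by simp
  have w1d: "w1 d = 1" "w2 d = 2" by (auto simp: w1_def w2_def)
  have dw1: "dl orig w1 = 2" unfolding dl_split s by (simp add: w1d)
  have "(\<Sum>k\<in>{1..d} - {d}. \<bar>orig k - w2 k\<bar>) = (\<Sum>k\<in>{1..d} - {d}. \<bar>orig k - w1 k\<bar>)"
    by (intro sum.cong) (auto simp: w2_def)
  hence dw2: "dl orig w2 = 3" unfolding dl_split using s by (simp add: w1d)
  have finB: "finite B" unfolding B_def by (simp add: finite_l1_ball)
  define c where "c = p ^ 4 * (1 - p) ^ card B"
  have c: "c > 0" using p_pos p_less_1 by (simp add: c_def)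
  show ?thesis
  proof (intro exI[of _ c] conjI ballI impI c)
    fix z assume z: "z \<in> L" "z d = 0" "4 < dl orig z"
    define z1 where "z1 = z(d := z d + 1)"
    define z2 where "z2 = z1(d := z1 d + 1)"
    have zL: "z1 \<in> L" "z2 \<in> L" using z upd_in_L by (auto simp: z1_def z2_def)
    have zd: "z1 d = 1" "z2 d = 2" using z by (auto simp: z1_def z2_def)
    have z2_eq: "z2 = z(d := 2)" using z by (simp add: z2_def z1_def)
    have dz: "dl z z1 = 1" "dl z z2 = 2" using z(2) by (simp_all add: z1_def z2_eq)
    \<comment> \<open>Distance above 4 keeps \<open>z1\<close> and \<open>z2\<close> out of
      \<open>B\<close>, so that they may be prescribed open.\<close>
    have farz: "dl orig z1 > 2" "dl orig z2 > 2"
      using l1_triangle[of d orig z z1] l1_triangle[of d orig z z2] dz z(3)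
        l1_commute[of d z1 z] l1_commute[of d z2 z] by auto
    define A where "A = {w1, w2, z1, z2}"
    have A: "finite A" "A \<subseteq> L" "A \<inter> B = {}" "card A \<le> 4"
      using w1L w2L zL farz dw2 card_insert_le_m1[of 4] by (auto simp: A_def B_def card_insert_if)
    have FR: "FR U orig z w2 z2" if o: "\<forall>v\<in>A. U v < p" and cl: "\<forall>v\<in>B. p \<le> U v" for U
    proof -
      have h1: "hop U orig w1"
        by (rule hop_unique_nearest) (use o cl w1L w1d dw1 in \<open>auto simp: A_def B_def\<close>)
      have h2: "hop U w1 w2" "hop U z z1" "hop U z1 z2"
        unfolding w2_def z1_def z2_def
        using hop_apex[OF w1L, of U] hop_apex[OF z(1), of U] hop_apex[OF zL(1), of U] o
        by (auto simp: A_def w2_def z1_def z2_def)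
      have "dl w1 w2 = 1" "dl z1 z2 = 1" by (simp_all add: w2_def z2_def)
      hence "st U 2 orig w1" "st U 2 w1 w2" "st U 2 z z1" "st U 2 z1 z2"
        using h1 h2 dw1 dz w1d zd z(2) by (auto simp: st_def)
      hence "reg U orig w2" "reg U z z2" unfolding reg_def w1d zd
        by (auto intro: rtranclp.rtrancl_into_rtrancl)
      moreover have "\<not> joint U orig z 1"
      proof
        assume "joint U orig z 1"
        then obtain x where x: "reg U orig x" "x d = 1" by (auto simp: joint_def)
        then obtain v where v: "hop U orig v" "dl orig v \<le> 1" using st_first[of U orig x] by auto
        have "v \<in> B" using v hopD(1,3)[OF v(1)] dw1 by (auto simp: B_def)
        with cl hopD(2)[OF v(1)] show False by auto
      qed
      ultimately show ?thesis by (simp add: FR_def w1d zd)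
    qed
    have "c \<le> p ^ card A * (1 - p) ^ card B"
      unfolding c_def using A(4) p_pos p_less_1
      by (intro mult_right_mono power_decreasing) auto
    also have "\<dots> \<le> Q orig z (w2, z2)"
      by (rule Q_ge) (use A finB z FR in \<open>auto simp: B_def\<close>)
    finally have "c \<le> Q orig z (w2, z2)" .
    moreover have "(w2, z2) \<in> J 2 orig z"
      using w2L zL w1d zd dw2 dz by (simp add: J_def)
    moreover have "(D orig z 1 (w2, z2))\<^sup>2 = 1"
      using d1 by (simp add: D_def z2_eq w2_def w1_def orig_def)
    ultimately show "\<exists>x y. (x, y) \<in> J 2 orig z \<and> (D orig z 1 (x, y))\<^sup>2 = 1 \<and> c \<le> Q orig z (x, y)"
      by blast
  qed
qed

text \<open>The path of \<open>z\<close> jumps at once to the vertex straight above the origin,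
  while the path of the origin climbs. The level m of the common point equals the radius of the ball
  searched about \<open>z\<close>, so no joint regeneration can occur earlier.\<close>

lemma Q_meet_pos:
  assumes z: "z \<in> L" "z d = 0" "z \<noteq> orig"
  shows "\<exists>x t. (x, x) \<in> J t orig z \<and> 0 < Q orig z (x, x)"
proof -
  define up where "up k = orig(d := int k)" for k :: nat
  have up: "up k \<in> L" "up k d = int k" "dl orig (up k) = int k" for k
    using upd_in_L[OF orig_L] by (auto simp: up_def)
  have up_Suc: "up (Suc k) = (up k)(d := up k d + 1)" for k by (simp add: up_def add.commute)
  have dz: "dl z (up k) = dl z orig + int k" for k
  proof -
    have "(\<Sum>j\<in>{1..d} - {d}. \<bar>z j - up k j\<bar>) = (\<Sum>j\<in>{1..d} - {d}. \<bar>z j - orig j\<bar>)"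
      by (intro sum.cong) (auto simp: up_def)
    thus ?thesis unfolding dl_split by (simp add: up z)
  qed
  have "dl z orig \<noteq> 0" using l1_eq_0[of z d orig] z by auto
  hence dpos: "dl z orig > 0" using l1_nonneg[of d z orig] by linarith
  define m where "m = nat (dl z orig) + 1"
  have m: "int m = dl z (up 1)" "m \<ge> 2" using dpos by (auto simp: m_def dz)
  define A where "A = up ` {1..m}"
  define B where "B = {v \<in> L. dl z v \<le> int m} \<inter> {v. 0 < v d \<and> v \<noteq> up 1}"
  have A: "finite A" "A \<subseteq> L" using up by (auto simp: A_def)
  have B: "finite B" "B \<subseteq> L" by (auto simp: B_def finite_l1_ball)
  have AB: "A \<inter> B = {}"
  proof -
    have "up k \<notin> B" if "k \<in> {1..m}" for k
      using that m dz[of k] dz[of 1] by (cases "k = 1") (auto simp: B_def)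
    thus ?thesis by (auto simp: A_def)
  qed
  have FR: "FR U orig z (up m) (up m)" if o: "\<forall>v\<in>A. U v < p" and cl: "\<forall>v\<in>B. p \<le> U v" for U
  proof -
    have o': "U (up k) < p" if "1 \<le> k" "k \<le> m" for k using o that by (auto simp: A_def)
    have hup: "st U (int m) (up k) (up (Suc k))" if "Suc k \<le> m" for k
      using hop_apex[OF up(1), of U k] o'[of "Suc k"] that unfolding st_def up_Suc[symmetric]
      by (auto simp: up up_Suc add.commute)
    have climb: "(st U (int m))\<^sup>*\<^sup>* (up j) (up (j + i))" if "j + i \<le> m" for i j
      using that
    proof (induction i)
      case (Suc i)
      with hup[of "j + i"] show ?case by (auto intro: rtranclp.rtrancl_into_rtrancl)
    qed auto
    have "up 0 = orig" by (rule lattice_ext) (use up(1)[of 0] in \<open>auto simp: up_def orig_def\<close>)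
    hence r1: "reg U orig (up m)" using climb[of 0 m] by (simp add: reg_def up)
    have "hop U z (up 1)"
      by (rule hop_unique_nearest) (use o'[of 1] m cl up z in \<open>auto simp: B_def\<close>)
    hence "st U (int m) z (up 1)" using m z by (simp add: st_def)
    hence r2: "reg U z (up m)" using climb[of 1 "m - 1"] m
      by (simp add: reg_def up converse_rtranclp_into_rtranclp)
    have "\<not> joint U orig z (int m - 1)"
    proof
      assume "joint U orig z (int m - 1)"
      then obtain y where y: "reg U z y" "0 < y d" "y d \<le> int m - 1" by (auto simp: joint_def)
      then obtain v where v: "hop U z v" "dl z v \<le> y d" using st_first[of U z y] z by auto
      have "v \<in> B" using v hopD(1,3)[OF v(1)] y z m by (auto simp: B_def)
      with cl hopD(2)[OF v(1)] show False by auto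
    qed
    with r1 r2 m show ?thesis by (simp add: FR_def up)
  qed
  have "0 < p ^ card A * (1 - p) ^ card B" using p_pos p_less_1 by simp
  also have "\<dots> \<le> Q orig z (up m, up m)"
    by (rule Q_ge[OF A(1) B(1) A(2) B(2) AB orig_L z(1)]) (rule FR)
  finally have "0 < Q orig z (up m, up m)" .
  moreover have "(up m, up m) \<in> J (2 * m) orig z"
  proof -
    have "dl z (up m) \<le> int (2 * m)" using m(1) dz[of m] dz[of 1] by simp
    also have "\<dots> \<le> (int (2 * m))\<^sup>2" using m(2) by (simp add: power2_eq_square)
    finally have 1: "dl z (up m) \<le> (int (2 * m))\<^sup>2" .
    have "int m \<le> (int (2 * m))\<^sup>2" using m(2) by (simp add: power2_eq_square)
    with 1 m(2) up[of m] show ?thesis by (simp add: J_def)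
  qed
  ultimately show ?thesis by blast
qed

end

section \<open>Drift of radial functions\<close>

lemma taylor3_le:
  fixes f fa fb fc :: "real \<Rightarrow> real"
  assumes d: "\<And>x. a \<le> x \<Longrightarrow> x \<le> b \<Longrightarrow> (f has_real_derivative fa x) (at x)"
    "\<And>x. a \<le> x \<Longrightarrow> x \<le> b \<Longrightarrow> (fa has_real_derivative fb x) (at x)"
    "\<And>x. a \<le> x \<Longrightarrow> x \<le> b \<Longrightarrow> (fb has_real_derivative fc x) (at x)"
    and M: "\<And>x. a \<le> x \<Longrightarrow> x \<le> b \<Longrightarrow> \<bar>fc x\<bar> \<le> M"
    and c: "a \<le> c" "c \<le> b" "a \<le> c + w" "c + w \<le> b"
  shows "f (c + w) \<le> f c + fa c * w + fb c / 2 * w\<^sup>2 + M / 6 * \<bar>w\<bar> ^ 3"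
proof (cases "w = 0")
  case False
  define df where "df n = (if n = 0 then f else if n = 1 then fa else if n = 2 then fb else fc)" for n :: nat
  have "\<exists>t. (if c + w < c then c + w < t \<and> t < c else c < t \<and> t < c + w) \<and>
    f (c + w) = (\<Sum>m<3. df m c / fact m * (c + w - c) ^ m) + df 3 t / fact 3 * (c + w - c) ^ 3"
    by (rule Taylor[of 3 df f a b c "c + w"])
       (use d c False in \<open>auto simp: df_def less_Suc_eq numeral_3_eq_3\<close>)
  then obtain t where t: "if c + w < c then c + w < t \<and> t < c else c < t \<and> t < c + w"
    and eq: "f (c + w) = (\<Sum>m<3. df m c / fact m * w ^ m) + df 3 t / fact 3 * w ^ 3"
    by auto
  have "a \<le> t" "t \<le> b" using t c by (auto split: if_splits)
  have "f (c + w) = f c + fa c * w + fb c / 2 * w\<^sup>2 + fc t / 6 * w ^ 3"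
    unfolding eq by (simp add: df_def numeral_3_eq_3 fact_numeral power2_eq_square)
  moreover have "fc t / 6 * w ^ 3 \<le> M / 6 * \<bar>w\<bar> ^ 3"
  proof -
    have "fc t / 6 * w ^ 3 \<le> \<bar>fc t / 6 * w ^ 3\<bar>" by simp
    also have "\<dots> = \<bar>fc t\<bar> / 6 * \<bar>w\<bar> ^ 3" by (simp add: abs_mult power_abs)
    also have "\<dots> \<le> M / 6 * \<bar>w\<bar> ^ 3"
      using M[OF \<open>a \<le> t\<close> \<open>t \<le> b\<close>] by (intro mult_right_mono divide_right_mono) auto
    finally show ?thesis .
  qed
  ultimately show ?thesis by linarith
qed auto

text \<open>
  Second order expansion of \<open>\<phi>(|z + D|\<^sup>2)\<close> for a centred increment \<open>D\<close> with uncorrelated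
  coordinates of equal variance \<open>v\<close>.
\<close>

lemma radial_drift:
  fixes q :: "'a \<Rightarrow> real" and D :: "nat \<Rightarrow> 'a \<Rightarrow> real" and z :: "nat \<Rightarrow> real" and \<phi> :: "real \<Rightarrow> real"
  assumes I: "finite I" "I \<noteq> {}" and J: "finite J" and q: "\<And>x. x \<in> J \<Longrightarrow> 0 \<le> q x" "(\<Sum>x\<in>J. q x) \<le> 1"
    and mean: "\<And>i. i \<in> I \<Longrightarrow> (\<Sum>x\<in>J. q x * D i x) = 0"
    and cross: "\<And>i k. i \<in> I \<Longrightarrow> k \<in> I \<Longrightarrow> i \<noteq> k \<Longrightarrow> (\<Sum>x\<in>J. q x * (D i x * D k x)) = 0"
    and var: "\<And>i. i \<in> I \<Longrightarrow> (\<Sum>x\<in>J. q x * (D i x)\<^sup>2) = v"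
    and bound: "\<And>i x. i \<in> I \<Longrightarrow> x \<in> J \<Longrightarrow> \<bar>D i x\<bar> \<le> B" "0 \<le> B"
    and \<rho>: "\<rho> = (\<Sum>i\<in>I. (z i)\<^sup>2)" and b: "b = real (card I) * B" "6 * b \<le> sqrt \<rho>"
    and K: "0 \<le> K"
    and \<phi>: "\<And>w. \<bar>w\<bar> \<le> \<rho> / 2 \<Longrightarrow> \<phi> (\<rho> + w) \<le> \<phi> \<rho> + p1 * w + p2 / 2 * w\<^sup>2 + K * \<bar>w\<bar> ^ 3"
  shows "(\<Sum>x\<in>J. q x * \<phi> (\<Sum>i\<in>I. (z i + D i x)\<^sup>2)) \<le>
    \<phi> \<rho> * (\<Sum>x\<in>J. q x) + v * (real (card I) * p1 + 2 * \<rho> * p2)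
      + (5 / 2 * \<bar>p2\<bar> * sqrt \<rho> + 27 * K * (\<rho> * sqrt \<rho>)) * b ^ 3"
proof -
  define m where "m = real (card I)"
  have m: "m \<ge> 1" using I unfolding m_def by (simp add: Suc_leI card_gt_0_iff)
  have b0: "0 \<le> b" using b(1) bound(2) m by (simp add: m_def)
  have \<rho>0: "0 \<le> \<rho>" unfolding \<rho> by (simp add: sum_nonneg)
  define s where "s = sqrt \<rho>"
  have s: "0 \<le> s" "s\<^sup>2 = \<rho>" "6 * b \<le> s" using \<rho>0 b by (auto simp: s_def)
  define P where "P x = (\<Sum>i\<in>I. z i * D i x)" for x
  define S where "S x = (\<Sum>i\<in>I. (D i x)\<^sup>2)" for x
  \<comment> \<open>The change of the squared distance. Its mean is \<open>m * v\<close>, and its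
    square is close to \<open>4 * (P x)\<^sup>2\<close>, of mean \<open>4 * \<rho> * v\<close>;
    together they produce the factor \<open>m * p1 + 2 * \<rho> * p2\<close>.\<close>
  define W where "W x = 2 * P x + S x" for x
  have W: "(\<Sum>i\<in>I. (z i + D i x)\<^sup>2) = \<rho> + W x" for x
    unfolding \<rho> W_def P_def S_def
    by (simp add: power2_sum sum.distrib sum_distrib_left mult.assoc)
  have zs: "\<bar>z i\<bar> \<le> s" if "i \<in> I" for i
  proof -
    have "(z i)\<^sup>2 \<le> \<rho>" unfolding \<rho> using that I(1) by (intro member_le_sum) auto
    thus ?thesis unfolding s_def by (simp add: real_le_rsqrt)
  qed
  have P_le: "\<bar>P x\<bar> \<le> s * b" if "x \<in> J" for x
  proof -
    have "\<bar>P x\<bar> \<le> (\<Sum>i\<in>I. \<bar>z i * D i x\<bar>)" unfolding P_def by (rule sum_abs)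
    also have "\<dots> \<le> (\<Sum>i\<in>I. s * B)"
      unfolding abs_mult using zs bound that s(1) by (intro sum_mono mult_mono) auto
    finally show ?thesis by (simp add: b mult_ac)
  qed
  have S_nn: "0 \<le> S x" for x unfolding S_def by (simp add: sum_nonneg)
  have S_le: "S x \<le> b\<^sup>2" if "x \<in> J" for x
  proof -
    have "S x \<le> (\<Sum>i\<in>I. B\<^sup>2)" unfolding S_def
      using bound that by (intro sum_mono) (auto simp: abs_le_square_iff[symmetric])
    also have "\<dots> = m * B\<^sup>2" by (simp add: m_def)
    also have "\<dots> \<le> m\<^sup>2 * B\<^sup>2" using m by (intro mult_right_mono) (auto simp: power2_eq_square)
    finally show ?thesis by (simp add: b m_def power_mult_distrib)
  qed
  have bs: "b\<^sup>2 \<le> s * b" using s b0 unfolding power2_eq_square by (intro mult_right_mono) auto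
  have W_le: "\<bar>W x\<bar> \<le> 3 * s * b" if "x \<in> J" for x
    using P_le[OF that] S_le[OF that] S_nn[of x] bs unfolding W_def by linarith
  \<comment> \<open>The purpose of \<open>6 * b \<le> sqrt \<rho>\<close>: it keeps the change
    within the range where the expansion of \<open>\<phi>\<close> is assumed.\<close>
  have W_half: "\<bar>W x\<bar> \<le> \<rho> / 2" if "x \<in> J" for x
  proof -
    have "3 * s * b \<le> 3 * s * (s / 6)" using s by (intro mult_left_mono) auto
    also have "\<dots> = \<rho> / 2" using s(2) by (simp add: power2_eq_square)
    finally show ?thesis using W_le[OF that] by linarith
  qed
  have W2: "\<bar>(W x)\<^sup>2 - 4 * (P x)\<^sup>2\<bar> \<le> 5 * s * b ^ 3" if "x \<in> J" for x
  proof -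
    have "(W x)\<^sup>2 - 4 * (P x)\<^sup>2 = 4 * (P x * S x) + (S x)\<^sup>2"
      by (simp add: W_def power2_eq_square algebra_simps)
    moreover have "\<bar>P x * S x\<bar> \<le> s * b * b\<^sup>2"
      unfolding abs_mult using P_le[OF that] S_le[OF that] S_nn[of x] s(1) b0 by (intro mult_mono) auto
    moreover have "(S x)\<^sup>2 \<le> s * b * b\<^sup>2"
      unfolding power2_eq_square[of "S x"]
      using S_le[OF that] S_nn[of x] bs b0 s(1) by (intro mult_mono) auto
    moreover have "s * b * b\<^sup>2 = s * b ^ 3" by (simp add: power2_eq_square power3_eq_cube)
    ultimately show ?thesis using zero_le_power2[of "S x"] by linarith
  qed
  have sumW: "(\<Sum>x\<in>J. q x * W x) = m * v"
  proof -
    have "(\<Sum>x\<in>J. q x * W x) = 2 * (\<Sum>x\<in>J. \<Sum>i\<in>I. z i * (q x * D i x)) + (\<Sum>x\<in>J. \<Sum>i\<in>I. q x * (D i x)\<^sup>2)"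
      unfolding W_def P_def S_def
      by (simp add: sum.distrib sum_distrib_left algebra_simps)
    also have "(\<Sum>x\<in>J. \<Sum>i\<in>I. z i * (q x * D i x)) = (\<Sum>i\<in>I. z i * (\<Sum>x\<in>J. q x * D i x))"
      by (subst sum.swap) (simp add: sum_distrib_left)
    also have "\<dots> = 0" using mean by simp
    also have "(\<Sum>x\<in>J. \<Sum>i\<in>I. q x * (D i x)\<^sup>2) = (\<Sum>i\<in>I. \<Sum>x\<in>J. q x * (D i x)\<^sup>2)"
      by (rule sum.swap)
    also have "\<dots> = m * v" using var by (simp add: m_def)
    finally show ?thesis by simp
  qed
  have sumP: "(\<Sum>x\<in>J. q x * (P x)\<^sup>2) = \<rho> * v"
  proof -
    have "(\<Sum>x\<in>J. q x * (P x)\<^sup>2) = (\<Sum>x\<in>J. \<Sum>i\<in>I. \<Sum>k\<in>I. z i * z k * (q x * (D i x * D k x)))"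
      unfolding P_def power2_eq_square sum_product
      by (simp add: sum_distrib_left algebra_simps)
    also have "\<dots> = (\<Sum>i\<in>I. \<Sum>x\<in>J. \<Sum>k\<in>I. z i * z k * (q x * (D i x * D k x)))"
      by (rule sum.swap)
    also have "\<dots> = (\<Sum>i\<in>I. \<Sum>k\<in>I. \<Sum>x\<in>J. z i * z k * (q x * (D i x * D k x)))"
      by (intro sum.cong refl sum.swap)
    also have "\<dots> = (\<Sum>i\<in>I. \<Sum>k\<in>I. z i * z k * (\<Sum>x\<in>J. q x * (D i x * D k x)))"
      by (simp add: sum_distrib_left)
    also have "\<dots> = (\<Sum>i\<in>I. \<Sum>k\<in>I. if k = i then (z i)\<^sup>2 * v else 0)"
      using cross var by (intro sum.cong refl) (auto simp: power2_eq_square)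
    also have "\<dots> = \<rho> * v"
      using I(1) by (simp add: \<rho> sum_distrib_right)
    finally show ?thesis .
  qed
  define e where "e = 5 / 2 * \<bar>p2\<bar> * s * b ^ 3 + K * (3 * s * b) ^ 3"
  have e0: "0 \<le> e" using s b0 K unfolding e_def by simp
  have pointwise: "\<phi> (\<rho> + W x) \<le> \<phi> \<rho> + p1 * W x + p2 * 2 * (P x)\<^sup>2 + e" if "x \<in> J" for x
  proof -
    have "p2 / 2 * (W x)\<^sup>2 - p2 / 2 * (4 * (P x)\<^sup>2) = p2 / 2 * ((W x)\<^sup>2 - 4 * (P x)\<^sup>2)"
      by (simp add: algebra_simps)
    also have "\<dots> \<le> \<bar>p2 / 2 * ((W x)\<^sup>2 - 4 * (P x)\<^sup>2)\<bar>" by simp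
    also have "\<dots> \<le> \<bar>p2\<bar> / 2 * (5 * s * b ^ 3)"
      unfolding abs_mult using W2[OF that] by (intro mult_mono) auto
    finally have 1: "p2 / 2 * (W x)\<^sup>2 \<le> p2 * 2 * (P x)\<^sup>2 + 5 / 2 * \<bar>p2\<bar> * s * b ^ 3"
      by (simp add: algebra_simps)
    have "K * \<bar>W x\<bar> ^ 3 \<le> K * (3 * s * b) ^ 3"
      using W_le[OF that] K by (intro mult_left_mono power_mono) auto
    with 1 \<phi>[OF W_half[OF that]] show ?thesis unfolding e_def by linarith
  qed
  have "(\<Sum>x\<in>J. q x * \<phi> (\<Sum>i\<in>I. (z i + D i x)\<^sup>2)) \<le> (\<Sum>x\<in>J. q x * (\<phi> \<rho> + p1 * W x + p2 * 2 * (P x)\<^sup>2 + e))"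
    unfolding W using q pointwise by (intro sum_mono mult_left_mono) auto
  also have "\<dots> = \<phi> \<rho> * (\<Sum>x\<in>J. q x) + p1 * (\<Sum>x\<in>J. q x * W x) + p2 * 2 * (\<Sum>x\<in>J. q x * (P x)\<^sup>2) + e * (\<Sum>x\<in>J. q x)"
    by (simp add: sum.distrib sum_distrib_left algebra_simps)
  also have "\<dots> \<le> \<phi> \<rho> * (\<Sum>x\<in>J. q x) + p1 * (\<Sum>x\<in>J. q x * W x) + p2 * 2 * (\<Sum>x\<in>J. q x * (P x)\<^sup>2) + e"
    using mult_left_mono[OF q(2) e0] by simp
  also have "e = (5 / 2 * \<bar>p2\<bar> * s + 27 * K * (\<rho> * s)) * b ^ 3"
    unfolding e_def s(2)[symmetric] by (simp add: power3_eq_cube power2_eq_square algebra_simps)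
  finally show ?thesis unfolding sumW sumP m_def[symmetric] s_def[symmetric]
    by (simp add: algebra_simps)
qed

lemma taylor_powr:
  fixes \<rho> w :: real
  assumes "0 \<le> \<rho>" "\<bar>w\<bar> \<le> \<rho> / 2"
  shows "(\<rho> + w + 1) powr (-1/4) \<le> (\<rho> + 1) powr (-1/4) + (-1/4 * (\<rho> + 1) powr (-5/4)) * w
    + (5/16 * (\<rho> + 1) powr (-9/4)) / 2 * w\<^sup>2 + 2 * (\<rho> + 1) powr (-13/4) * \<bar>w\<bar> ^ 3"
proof -
  have "(\<rho> + w + 1) powr (-1/4) \<le> (\<rho> + 1) powr (-1/4) + (-1/4 * (\<rho> + 1) powr (-5/4)) * w
    + (5/16 * (\<rho> + 1) powr (-9/4)) / 2 * w\<^sup>2 + (45/64 * (\<rho> / 2 + 1) powr (-13/4)) / 6 * \<bar>w\<bar> ^ 3"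
  proof (rule taylor3_le[where f = "\<lambda>x. (x + 1) powr (-1/4)" and a = "\<rho> / 2" and b = "2 * \<rho>" and c = \<rho>
      and fc = "\<lambda>x. -45/64 * (x + 1) powr (-13/4)"
      and fa = "\<lambda>x. -1/4 * (x + 1) powr (-5/4)" and fb = "\<lambda>x. 5/16 * (x + 1) powr (-9/4)"])
    fix x assume x: "\<rho> / 2 \<le> x" "x \<le> 2 * \<rho>"
    hence "x + 1 > 0" using assms by linarith
    thus "((\<lambda>x. (x + 1) powr (-1/4)) has_real_derivative -1/4 * (x + 1) powr (-5/4)) (at x)"
      "((\<lambda>x. -1/4 * (x + 1) powr (-5/4)) has_real_derivative 5/16 * (x + 1) powr (-9/4)) (at x)"
      "((\<lambda>x. 5/16 * (x + 1) powr (-9/4)) has_real_derivative -45/64 * (x + 1) powr (-13/4)) (at x)"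
      by (auto intro!: derivative_eq_intros)
    have "(x + 1) powr (-13/4) \<le> (\<rho> / 2 + 1) powr (-13/4)"
      using x assms by (intro powr_mono2') auto
    thus "\<bar>-45/64 * (x + 1) powr (-13/4)\<bar> \<le> 45/64 * (\<rho> / 2 + 1) powr (-13/4)"
      by (simp add: abs_mult)
  qed (use assms in auto)
  \<comment> \<open>The third derivative is largest at \<rho> / 2. Passing from there to \<rho>
    costs a factor of at most 2^4.\<close>
  moreover have "(45/64 * (\<rho> / 2 + 1) powr (-13/4)) / 6 \<le> 2 * (\<rho> + 1) powr (-13/4)"
  proof -
    have "(\<rho> / 2 + 1) powr (-13/4) \<le> ((\<rho> + 1) / 2) powr (-13/4)"
      using assms by (intro powr_mono2') auto
    also have "\<dots> = (\<rho> + 1) powr (-13/4) * 2 powr (13/4)"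
      using assms by (simp add: powr_divide powr_minus field_simps)
    also have "\<dots> \<le> (\<rho> + 1) powr (-13/4) * 2 powr 4"
      by (intro mult_left_mono powr_mono) auto
    finally have "(\<rho> / 2 + 1) powr (-13/4) \<le> (\<rho> + 1) powr (-13/4) * 16" by simp
    thus ?thesis using powr_ge_zero[of "\<rho> + 1" "-13/4"] by linarith
  qed
  ultimately show ?thesis
    using mult_right_mono[of "(45/64 * (\<rho> / 2 + 1) powr (-13/4)) / 6" "2 * (\<rho> + 1) powr (-13/4)" "\<bar>w\<bar> ^ 3"]
    by simp
qed

lemma ln_ge_1: "3 \<le> (x::real) \<Longrightarrow> 1 \<le> ln x"
  using exp_le by (subst ln_ge_iff) auto

text \<open>The shift by 3, above \<open>exp 1\<close>, keeps the inner logarithm at least 1 and the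
  function nonnegative. Lower powers of the logarithm are then bounded by its cube, whence 2 + 3 + 2
  = 7; a further 2^3 arises because \<open>x + 3\<close> is at least half of
  \<open>\<rho> + 3\<close>.\<close>

lemma taylor_lnln:
  fixes \<rho> w :: real
  assumes "0 \<le> \<rho>" "\<bar>w\<bar> \<le> \<rho> / 2"
  shows "ln (ln (\<rho> + w + 3)) \<le> ln (ln (\<rho> + 3)) + 1 / ((\<rho> + 3) * ln (\<rho> + 3)) * w
    + (- (ln (\<rho> + 3) + 1) / ((\<rho> + 3)\<^sup>2 * (ln (\<rho> + 3))\<^sup>2)) / 2 * w\<^sup>2 + 10 / (\<rho> + 3) ^ 3 * \<bar>w\<bar> ^ 3"
proof -
  have "ln (ln (\<rho> + w + 3)) \<le> ln (ln (\<rho> + 3)) + 1 / ((\<rho> + 3) * ln (\<rho> + 3)) * w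
    + (- (ln (\<rho> + 3) + 1) / ((\<rho> + 3)\<^sup>2 * (ln (\<rho> + 3))\<^sup>2)) / 2 * w\<^sup>2 + (56 / (\<rho> + 3) ^ 3) / 6 * \<bar>w\<bar> ^ 3"
  proof (rule taylor3_le[where f = "\<lambda>x. ln (ln (x + 3))" and a = "\<rho> / 2" and b = "2 * \<rho>" and c = \<rho>
      and fa = "\<lambda>x. 1 / ((x + 3) * ln (x + 3))"
      and fb = "\<lambda>x. - (ln (x + 3) + 1) / ((x + 3)\<^sup>2 * (ln (x + 3))\<^sup>2)"
      and fc = "\<lambda>x. (2 * (ln (x + 3))\<^sup>2 + 3 * ln (x + 3) + 2) / ((x + 3) ^ 3 * (ln (x + 3)) ^ 3)"])
    fix x assume x: "\<rho> / 2 \<le> x" "x \<le> 2 * \<rho>"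
    define y where "y = x + 3"
    define l where "l = ln y"
    have y: "y \<ge> 3" "(\<rho> + 3) / 2 \<le> y" using x assms by (auto simp: y_def)
    have l: "l \<ge> 1" unfolding l_def by (rule ln_ge_1[OF y(1)])
    have pos: "x + 3 > 0" "ln (x + 3) > 0" using y l by (auto simp: y_def l_def)
    show "((\<lambda>x. ln (ln (x + 3))) has_real_derivative 1 / ((x + 3) * ln (x + 3))) (at x)"
      using pos by (auto intro!: derivative_eq_intros simp: field_simps)
    show "((\<lambda>x. 1 / ((x + 3) * ln (x + 3))) has_real_derivative
      - (ln (x + 3) + 1) / ((x + 3)\<^sup>2 * (ln (x + 3))\<^sup>2)) (at x)"
    proof -
      have "((\<lambda>x. 1 / ((x + 3) * ln (x + 3))) has_real_derivative
        (- (1 * l + y * (1 / y))) / ((y * l) * (y * l))) (at x)"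
        using pos unfolding y_def l_def by (auto intro!: derivative_eq_intros)
      also have "(- (1 * l + y * (1 / y))) / ((y * l) * (y * l)) = - (l + 1) / (y\<^sup>2 * l\<^sup>2)"
        using y(1) l by (simp add: power2_eq_square)
      finally show ?thesis by (simp only: y_def l_def)
    qed
    show "((\<lambda>x. - (ln (x + 3) + 1) / ((x + 3)\<^sup>2 * (ln (x + 3))\<^sup>2)) has_real_derivative
      (2 * (ln (x + 3))\<^sup>2 + 3 * ln (x + 3) + 2) / ((x + 3) ^ 3 * (ln (x + 3)) ^ 3)) (at x)"
    proof -
      have "((\<lambda>x. - (ln (x + 3) + 1) / ((x + 3)\<^sup>2 * (ln (x + 3))\<^sup>2)) has_real_derivative
        ((- (1 / y)) * (y\<^sup>2 * l\<^sup>2) - (- (l + 1)) * (2 * y * l\<^sup>2 + y\<^sup>2 * (2 * l * (1 / y)))) / ((y\<^sup>2 * l\<^sup>2) * (y\<^sup>2 * l\<^sup>2))) (at x)"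
        using pos unfolding y_def l_def by (auto intro!: derivative_eq_intros)
      also have "((- (1 / y)) * (y\<^sup>2 * l\<^sup>2) - (- (l + 1)) * (2 * y * l\<^sup>2 + y\<^sup>2 * (2 * l * (1 / y)))) / ((y\<^sup>2 * l\<^sup>2) * (y\<^sup>2 * l\<^sup>2))
        = (2 * l\<^sup>2 + 3 * l + 2) / (y ^ 3 * l ^ 3)"
        using y(1) l by (simp add: field_simps power2_eq_square power3_eq_cube)
      finally show ?thesis by (simp only: y_def l_def)
    qed
    have "\<bar>(2 * l\<^sup>2 + 3 * l + 2) / (y ^ 3 * l ^ 3)\<bar> = (2 * l\<^sup>2 + 3 * l + 2) / l ^ 3 / y ^ 3"
      using l y by (simp add: abs_of_nonneg)
    also have "\<dots> \<le> 7 / y ^ 3"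
    proof (rule divide_right_mono)
      have "l\<^sup>2 \<le> l ^ 3" "l \<le> l ^ 3" "1 \<le> l ^ 3"
        using power_increasing[of 2 3 l] power_increasing[of 1 3 l] power_increasing[of 0 3 l] l by auto
      thus "(2 * l\<^sup>2 + 3 * l + 2) / l ^ 3 \<le> 7" using l by (simp add: divide_simps)
    qed (use y in auto)
    also have "\<dots> \<le> 7 / ((\<rho> + 3) / 2) ^ 3"
      using y assms by (intro divide_left_mono power_mono mult_pos_pos zero_less_power) auto
    also have "\<dots> = 56 / (\<rho> + 3) ^ 3" by (simp add: power_divide)
    finally show "\<bar>(2 * (ln (x + 3))\<^sup>2 + 3 * ln (x + 3) + 2) / ((x + 3) ^ 3 * (ln (x + 3)) ^ 3)\<bar> \<le> 56 / (\<rho> + 3) ^ 3"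
      by (simp add: l_def y_def)
  qed (use assms in auto)
  moreover have "(56 / (\<rho> + 3) ^ 3) / 6 * \<bar>w\<bar> ^ 3 \<le> 10 / (\<rho> + 3) ^ 3 * \<bar>w\<bar> ^ 3"
    using assms by (intro mult_right_mono) (auto simp: divide_simps)
  ultimately show ?thesis by linarith
qed

context dsf
begin

section \<open>Squared horizontal distance and the drift of the chain of differences\<close>

definition rho :: "(nat \<Rightarrow> int) \<Rightarrow> real" where
  "rho z = (\<Sum>i\<in>{1..<d}. (of_int (z i))\<^sup>2)"

lemma rho_nonneg [simp]: "0 \<le> rho z"
  by (simp add: rho_def sum_nonneg)

lemma rho_orig [simp]: "rho orig = 0"
  unfolding rho_def orig_def by (intro sum.neutral) auto

lemma dl_orig: "z d = 0 \<Longrightarrow> dl orig z = (\<Sum>i\<in>{1..<d}. \<bar>z i\<bar>)"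
proof -
  assume "z d = 0"
  moreover have "{1..d} - {d} = {1..<d}" by auto
  ultimately show ?thesis unfolding dl_split by (auto simp: orig_def intro!: sum.cong)
qed

lemma sqrt_rho_le: "z d = 0 \<Longrightarrow> sqrt (rho z) \<le> of_int (dl orig z)"
proof -
  assume z: "z d = 0"
  have "sqrt (rho z) \<le> (\<Sum>i\<in>{1..<d}. \<bar>real_of_int (z i)\<bar>)"
    using L2_set_le_sum[of "{1..<d}" "\<lambda>i. \<bar>real_of_int (z i)\<bar>"] by (simp add: rho_def L2_set_def)
  also have "(\<Sum>i\<in>{1..<d}. \<bar>real_of_int (z i)\<bar>) = of_int (dl orig z)"
    unfolding dl_orig[of z, OF z] by simp
  finally show ?thesis .
qed

lemma dl_le_rho: "z d = 0 \<Longrightarrow> of_int (dl orig z) \<le> rho z"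
proof -
  assume z: "z d = 0"
  have "\<bar>k\<bar> \<le> k\<^sup>2" for k :: int
  proof -
    have "\<bar>k\<bar> * 1 \<le> \<bar>k\<bar> * \<bar>k\<bar>"
    proof (cases "k = 0")
      case False
      hence "1 \<le> \<bar>k\<bar>" by arith
      thus ?thesis by (intro mult_left_mono) auto
    qed auto
    also have "\<bar>k\<bar> * \<bar>k\<bar> = k\<^sup>2" by (simp add: power2_eq_square)
    finally show ?thesis by (simp only: mult_1_right)
  qed
  hence "dl orig z \<le> (\<Sum>i\<in>{1..<d}. (z i)\<^sup>2)"
    unfolding dl_orig[of z, OF z] by (intro sum_mono) auto
  hence "real_of_int (dl orig z) \<le> real_of_int (\<Sum>i\<in>{1..<d}. (z i)\<^sup>2)" by (simp only: of_int_le_iff)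
  thus ?thesis by (simp add: rho_def)
qed

lemma finite_rho_ball: "finite {z \<in> L. z d = 0 \<and> rho z \<le> R}"
proof (rule finite_subset)
  show "{z \<in> L. z d = 0 \<and> rho z \<le> R} \<subseteq> {z \<in> L. dl orig z \<le> \<lfloor>R\<rfloor>}"
    using dl_le_rho by (auto simp: le_floor_iff intro: order_trans)
qed (rule finite_l1_ball)

lemma rho_diff:
  "rho (diff (snd xy) (fst xy)) = (\<Sum>i\<in>{1..<d}. (of_int (z i) + D orig z i xy)\<^sup>2)"
  unfolding rho_def by (intro sum.cong) (auto simp: diff_def D_def orig_def)

lemma D_bound:
  assumes "xy \<in> J t a b" "i \<in> {1..<d}"
  shows "\<bar>D a b i xy\<bar> \<le> 2 * real t ^ 2"
proof -
  have i: "i \<in> {1..d}" using assms(2) by auto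
  have "\<bar>(snd xy i - b i) - (fst xy i - a i)\<bar> \<le> dl a (fst xy) + dl b (snd xy)"
    using l1_coord[OF i, of a "fst xy"] l1_coord[OF i, of b "snd xy"] by linarith
  also have "\<dots> \<le> 2 * (int t)\<^sup>2" using assms(1) by (auto simp: J_def)
  finally have "real_of_int \<bar>(snd xy i - b i) - (fst xy i - a i)\<bar> \<le> real_of_int (2 * (int t)\<^sup>2)"
    by (simp only: of_int_le_iff)
  thus ?thesis by (simp add: D_def)
qed

text \<open>Packs \<open>radial_drift\<close> for the kernel \<open>Q\<close>, to be used with two
  test functions. \<open>p1\<close> and \<open>p2\<close> stand for the derivatives of
  \<open>\<phi>\<close> at \<open>rho z\<close>, and \<open>c\<close> for a lower bound on the
  variance, which may replace it because its factor is not positive. The 12 is 6 * 2, as coordinates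
  of increments are at most 2 t^2.\<close>

definition drift_rate :: "real \<Rightarrow> bool" where
  "drift_rate c \<longleftrightarrow> (\<forall>z t \<phi> p1 p2 K. z \<in> L \<longrightarrow> z d = 0 \<longrightarrow> t \<ge> 2 \<longrightarrow>
     12 * real (d - 1) * real t ^ 2 \<le> sqrt (rho z) \<longrightarrow> 0 \<le> K \<longrightarrow>
     (\<forall>w. \<bar>w\<bar> \<le> rho z / 2 \<longrightarrow> \<phi> (rho z + w) \<le> \<phi> (rho z) + p1 * w + p2 / 2 * w\<^sup>2 + K * \<bar>w\<bar> ^ 3) \<longrightarrow>
     0 \<le> \<phi> (rho z) \<longrightarrow> real (d - 1) * p1 + 2 * rho z * p2 \<le> 0 \<longrightarrow>
     mean t z (\<lambda>w. \<phi> (rho w)) \<le>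
       \<phi> (rho z) + c * (real (d - 1) * p1 + 2 * rho z * p2)
         + (5 / 2 * \<bar>p2\<bar> * sqrt (rho z) + 27 * K * (rho z * sqrt (rho z))) * (2 * real (d - 1) * real t ^ 2) ^ 3)"

lemma drift_rate_ex: "\<exists>c>0. drift_rate c"
proof -
  obtain c where c: "c > 0" "\<And>z. z \<in> L \<Longrightarrow> z d = 0 \<Longrightarrow> 4 < dl orig z \<Longrightarrow>
     \<exists>x y. (x, y) \<in> J 2 orig z \<and> (D orig z 1 (x, y))\<^sup>2 = 1 \<and> c \<le> Q orig z (x, y)"
    using Q_unit_step by blast
  have "drift_rate c"
    unfolding drift_rate_def
  proof (intro allI impI)
    fix z t and \<phi> :: "real \<Rightarrow> real" and p1 p2 K :: real
    assume z: "z \<in> L" "z d = 0" and t: "t \<ge> 2" and far: "12 * real (d - 1) * real t ^ 2 \<le> sqrt (rho z)"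
      and K: "0 \<le> K" and \<phi>: "\<forall>w. \<bar>w\<bar> \<le> rho z / 2 \<longrightarrow> \<phi> (rho z + w) \<le> \<phi> (rho z) + p1 * w + p2 / 2 * w\<^sup>2 + K * \<bar>w\<bar> ^ 3"
      and \<phi>0: "0 \<le> \<phi> (rho z)" and neg: "real (d - 1) * p1 + 2 * rho z * p2 \<le> 0"
    have t4: "real t ^ 2 \<ge> 4" using power_mono[of 2 "real t" 2] t by simp
    have d1: "real (d - 1) \<ge> 1" using d_ge_2 by simp
    have "12 * 1 * real t ^ 2 \<le> 12 * real (d - 1) * real t ^ 2"
      using d1 by (intro mult_right_mono) auto
    hence "12 * real t ^ 2 \<le> real_of_int (dl orig z)"
      using far sqrt_rho_le[of z, OF z(2)] by linarith
    hence "2 * real t ^ 2 < real_of_int (dl orig z)" "4 < real_of_int (dl orig z)" using t4 by linarith+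
    hence dl: "2 * (int t)\<^sup>2 < dl orig z" "4 < dl orig z"
      using of_int_less_iff[where ?'a = real, of "2 * (int t)\<^sup>2" "dl orig z"]
        of_int_less_iff[where ?'a = real, of 4 "dl orig z"] by simp_all
    define v where "v = (\<Sum>xy\<in>J t orig z. Q orig z xy * (D orig z 1 xy)\<^sup>2)"
    have one: "1 \<in> {1..<d}" using d_ge_2 by auto
    have ab: "orig \<in> L" "z \<in> L" "orig d = z d" using z by auto
    have v: "c \<le> v"
    proof -
      obtain x y where xy: "(x, y) \<in> J 2 orig z" "(D orig z 1 (x, y))\<^sup>2 = 1" "c \<le> Q orig z (x, y)"
        using c(2)[OF z dl(2)] by auto
      have "(x, y) \<in> J t orig z" using xy(1) J_mono[OF t] by auto
      hence "Q orig z (x, y) * (D orig z 1 (x, y))\<^sup>2 \<le> v"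
        unfolding v_def by (intro member_le_sum[where f = "\<lambda>xy. Q orig z xy * (D orig z 1 xy)\<^sup>2"]) auto
      thus ?thesis using xy(2,3) by simp
    qed
    have sQ: "(\<Sum>xy\<in>J t orig z. Q orig z xy) \<le> 1"
      using sum_Q[OF ab] by simp
    have cardI: "card {1..<d} = d - 1" by simp
    have "(\<Sum>xy\<in>J t orig z. Q orig z xy * \<phi> (\<Sum>i\<in>{1..<d}. (of_int (z i) + D orig z i xy)\<^sup>2)) \<le>
       \<phi> (rho z) * (\<Sum>xy\<in>J t orig z. Q orig z xy) + v * (real (card {1..<d}) * p1 + 2 * rho z * p2)
         + (5 / 2 * \<bar>p2\<bar> * sqrt (rho z) + 27 * K * (rho z * sqrt (rho z))) * (2 * real (d - 1) * real t ^ 2) ^ 3"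
    proof (rule radial_drift[where B = "2 * real t ^ 2"])
      show "(\<Sum>xy\<in>J t orig z. Q orig z xy * D orig z i xy) = 0" if "i \<in> {1..<d}" for i
        by (rule sum_Q_D[OF ab dl(1) that])
      show "(\<Sum>xy\<in>J t orig z. Q orig z xy * (D orig z i xy * D orig z k xy)) = 0"
        if "i \<in> {1..<d}" "k \<in> {1..<d}" "i \<noteq> k" for i k
        by (rule sum_Q_DD[OF ab dl(1) that])
      show "(\<Sum>xy\<in>J t orig z. Q orig z xy * (D orig z i xy)\<^sup>2) = v" if "i \<in> {1..<d}" for i
        unfolding v_def by (rule sum_Q_D2[OF ab dl(1) that one])
      show "\<bar>D orig z i xy\<bar> \<le> 2 * real t ^ 2" if "i \<in> {1..<d}" "xy \<in> J t orig z" for i xy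
        by (rule D_bound[OF that(2,1)])
      show "6 * (2 * real (d - 1) * real t ^ 2) \<le> sqrt (rho z)" using far by (simp add: algebra_simps)
      show "2 * real (d - 1) * real t ^ 2 = real (card {1..<d}) * (2 * real t ^ 2)"
        unfolding cardI by simp
    qed (use one sQ K \<phi> in \<open>auto simp: rho_def\<close>)
    \<comment> \<open>The cut kernel has mass at most 1; for a nonnegative \<open>\<phi>\<close> the
      missing mass only lowers the left side.\<close>
    also have "\<phi> (rho z) * (\<Sum>xy\<in>J t orig z. Q orig z xy) \<le> \<phi> (rho z) * 1"
      by (rule mult_left_mono[OF sQ \<phi>0])
    also have "v * (real (card {1..<d}) * p1 + 2 * rho z * p2) \<le> c * (real (d - 1) * p1 + 2 * rho z * p2)"
      unfolding cardI by (rule mult_right_mono_neg[OF v neg])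
    finally show "mean t z (\<lambda>w. \<phi> (rho w)) \<le>
       \<phi> (rho z) + c * (real (d - 1) * p1 + 2 * rho z * p2)
         + (5 / 2 * \<bar>p2\<bar> * sqrt (rho z) + 27 * K * (rho z * sqrt (rho z))) * (2 * real (d - 1) * real t ^ 2) ^ 3"
      unfolding rho_diff[of _ z] by simp
  qed
  with c(1) show ?thesis by blast
qed

lemma tail_bound:
  "\<exists>C>0. \<forall>z\<in>L. \<forall>t\<ge>1. z d = 0 \<longrightarrow> tail t orig z \<le> C / real t ^ k"
proof -
  obtain C where C: "C > 0" "\<forall>a\<in>L. \<forall>b\<in>L. \<forall>n\<ge>1. a d = b d \<longrightarrow>
     N.prob {U \<in> space N. \<not> joint U a b (a d + int n)} \<le> C / real n ^ k"
    using joint_tail[of k] by blast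
  have "tail t orig z \<le> C / real t ^ k" if "z \<in> L" "z d = 0" "t \<ge> 1" for z t
    using C(2)[rule_format, OF orig_L, of z t] that by (simp add: tail_def)
  with C(1) show ?thesis by blast
qed

text \<open>The truncation level used at squared distance \<open>\<rho>\<close>; any small power would do.\<close>

definition cutoff :: "real \<Rightarrow> nat" where "cutoff \<rho> = nat \<lfloor>\<rho> powr (1/64)\<rfloor>"

text \<open>From 2^64 on the 64th root is at least 2, so that rounding down loses at most half of
  it.\<close>

lemma cutoff_bounds:
  assumes "\<rho> \<ge> 2 ^ 64"
  shows "cutoff \<rho> \<ge> 2" "real (cutoff \<rho>) \<le> \<rho> powr (1/64)" "\<rho> powr (1/64) / 2 \<le> real (cutoff \<rho>)"
    "real (cutoff \<rho>) ^ 2 \<le> \<rho> powr (1/32)" "1 / real (cutoff \<rho>) ^ 64 \<le> 2 ^ 64 / \<rho>"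
proof -
  have "(2 ^ 64) powr (1/64) \<le> \<rho> powr (1/64)" using assms by (intro powr_mono2) auto
  moreover have "(2 ^ 64 :: real) powr (1/64) = 2"
  proof -
    have "(2 ^ 64 :: real) = 2 powr real 64" by (rule powr_realpow[symmetric]) simp
    also have "\<dots> powr (1/64) = 2 powr (real 64 * (1/64))" by (rule powr_powr)
    also have "real 64 * (1/64) = 1" by simp
    finally show ?thesis by simp
  qed
  ultimately have 2: "\<rho> powr (1/64) \<ge> 2" by simp
  thus 1: "cutoff \<rho> \<ge> 2" "real (cutoff \<rho>) \<le> \<rho> powr (1/64)" "\<rho> powr (1/64) / 2 \<le> real (cutoff \<rho>)"
    unfolding cutoff_def by linarith+
  have "real (cutoff \<rho>) ^ 2 \<le> (\<rho> powr (1/64)) ^ 2" using 1 by (intro power_mono) auto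
  also have "\<dots> = \<rho> powr (1/32)" using assms by (simp add: powr_powr flip: powr_realpow)
  finally show "real (cutoff \<rho>) ^ 2 \<le> \<rho> powr (1/32)" .
  have "\<rho> / 2 ^ 64 = (\<rho> powr (1/64) / 2) ^ 64"
    using assms by (simp add: power_divide powr_powr flip: powr_realpow)
  also have "\<dots> \<le> real (cutoff \<rho>) ^ 64" using 1 by (intro power_mono) auto
  finally have "\<rho> / 2 ^ 64 \<le> real (cutoff \<rho>) ^ 64" .
  moreover have "0 < \<rho> / 2 ^ 64" using assms by (intro divide_pos_pos) auto
  ultimately have "1 / real (cutoff \<rho>) ^ 64 \<le> 1 / (\<rho> / 2 ^ 64)"
    using 1 by (intro divide_left_mono mult_pos_pos zero_less_power) auto
  thus "1 / real (cutoff \<rho>) ^ 64 \<le> 2 ^ 64 / \<rho>" by simp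
qed

section \<open>Dimension at least four: distant paths rarely meet\<close>

text \<open>Induction on \<open>n\<close> against a supersolution. Near the origin the choice of
  \<open>C\<close> makes the bound at least 1. Farther out, a drift of order rho^(-5/4) pays for the
  Taylor remainder of order rho^(-7/4 + 3/32) and for the tail.\<close>

lemma u_bound:
  assumes d4: "d \<ge> 4"
  obtains C where "C \<ge> 1"
    "\<And>n z. z \<in> L \<Longrightarrow> z d = 0 \<Longrightarrow> u n z \<le> C * (rho z + 1) powr (-1/4)"
proof -
  obtain c where c: "c > 0" and drift: "drift_rate c" using drift_rate_ex by blast
  \<comment> \<open>With a cutoff near rho^(1/64), the power 128 turns into a tail of order
    rho^(-2), below the drift.\<close>
  obtain C1 where C1: "C1 > 0" and tail: "\<forall>z\<in>L. \<forall>t\<ge>1. z d = 0 \<longrightarrow> tail t orig z \<le> C1 / real t ^ 128"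
    using tail_bound[of 128] by blast
  define m where "m = real (d - 1)"
  have m: "m \<ge> 3" using d4 by (simp add: m_def)
  have m0: "m > 0" using m by simp
  define far where "far \<rho> \<longleftrightarrow> 12 * m * \<rho> powr (1/32) \<le> sqrt \<rho> \<and>
    (\<rho> + 1) powr (-7/4) * (56 * (8 * m ^ 3 * \<rho> powr (3/32))) + C1 * (2 ^ 128 / \<rho>\<^sup>2) \<le> c * ((\<rho> + 1) powr (-5/4) / 8)
    \<and> \<rho> \<ge> 2 ^ 64" for \<rho> :: real
  have "eventually (\<lambda>\<rho>::real. 12 * m * \<rho> powr (1/32) \<le> sqrt \<rho>) at_top"
    using m0 by real_asymp
  moreover have "eventually (\<lambda>\<rho>::real. (\<rho> + 1) powr (-7/4) * (56 * (8 * m ^ 3 * \<rho> powr (3/32))) + C1 * (2 ^ 128 / \<rho>\<^sup>2)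
      \<le> c * ((\<rho> + 1) powr (-5/4) / 8)) at_top"
    using m0 C1 c by real_asymp
  ultimately have "eventually far at_top"
    unfolding far_def using eventually_ge_at_top[of "2 ^ 64 :: real"] by eventually_elim auto
  then obtain R0 where R0: "\<And>\<rho>. \<rho> \<ge> R0 \<Longrightarrow> far \<rho>"
    by (auto simp: eventually_at_top_linorder)
  define R where "R = max R0 1"
  have R: "R \<ge> 1" "R \<ge> R0" by (auto simp: R_def)
  define C where "C = (R + 1) powr (1/4)"
  have C: "C \<ge> 1" unfolding C_def using R by (intro ge_one_powr_ge_zero) auto
  have near: "1 \<le> C * (rho z + 1) powr (-1/4)" if "rho z \<le> R" for z
  proof -
    have "(R + 1) powr (-1/4) \<le> (rho z + 1) powr (-1/4)"
      using that by (intro powr_mono2') (auto simp: add_nonneg_pos)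
    hence "C * (R + 1) powr (-1/4) \<le> C * (rho z + 1) powr (-1/4)" using C by (intro mult_left_mono) auto
    moreover have "C * (R + 1) powr (-1/4) = 1"
      unfolding C_def using R by (simp flip: powr_add)
    ultimately show ?thesis by simp
  qed
  have super: "mean (cutoff (rho z)) z (\<lambda>w. (rho w + 1) powr (-1/4))
      + tail (cutoff (rho z)) orig z \<le> (rho z + 1) powr (-1/4)"
    if z: "z \<in> L" "z d = 0" and far: "rho z > R" for z
  proof -
    define \<rho> where "\<rho> = rho z"
    define t where "t = cutoff \<rho>"
    define X where "X = \<rho> + 1"
    have \<rho>R: "\<rho> \<ge> R0" using far R by (simp add: \<rho>_def)
    note r = R0[OF \<rho>R, unfolded far_def]
    note t = cutoff_bounds[of \<rho>, folded t_def]
    have \<rho>0: "\<rho> > 0" "X \<ge> 1" "\<rho> \<le> X" using r by (auto simp: X_def intro: less_le_trans[of 0 "2^64"])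
    have t1: "12 * m * real t ^ 2 \<le> sqrt \<rho>"
    proof -
      have "12 * m * real t ^ 2 \<le> 12 * m * \<rho> powr (1/32)"
        using t(4) r m0 by (intro mult_left_mono) auto
      with r show ?thesis by linarith
    qed
    define p1 where "p1 = -1/4 * X powr (-5/4)"
    define p2 where "p2 = 5/16 * X powr (-9/4)"
    have Xpow: "X * X powr (-9/4) = X powr (-5/4)" "X powr (-9/4) * sqrt X = X powr (-7/4)"
      "X powr (-13/4) * (X * sqrt X) = X powr (-7/4)"
      using \<rho>0(2) powr_add[of X 1 "-9/4"] powr_add[of X "-9/4" "1/2"]
        powr_add[of X "-13/4" "1"] powr_add[of X "-9/4" "1/2"]
      by (simp_all add: powr_half_sqrt mult_ac flip: powr_add)
    \<comment> \<open>Dimension enters here: m >= 3 gives at most - 3/4 + 5/8 = - 1/8.\<close>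
    have neg: "m * p1 + 2 * \<rho> * p2 \<le> - (X powr (-5/4) / 8)"
    proof -
      have "m * p1 \<le> 3 * p1" unfolding p1_def using m by (intro mult_right_mono_neg) auto
      moreover have "2 * \<rho> * p2 \<le> 2 * X * p2" unfolding p2_def using \<rho>0 by (intro mult_right_mono) auto
      moreover have "2 * X * p2 = 5/8 * X powr (-5/4)" unfolding p2_def Xpow(1)[symmetric] by simp
      ultimately show ?thesis unfolding p1_def by linarith
    qed
    have "mean t z (\<lambda>w. (rho w + 1) powr (-1/4)) \<le>
       X powr (-1/4) + c * (m * p1 + 2 * \<rho> * p2)
         + (5 / 2 * \<bar>p2\<bar> * sqrt \<rho> + 27 * (2 * X powr (-13/4)) * (\<rho> * sqrt \<rho>)) * (2 * m * real t ^ 2) ^ 3"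
      unfolding m_def \<rho>_def X_def
    proof (rule drift[unfolded drift_rate_def, rule_format, where \<phi> = "\<lambda>x. (x + 1) powr (-1/4)"])
      fix w :: real assume "\<bar>w\<bar> \<le> rho z / 2"
      thus "(rho z + w + 1) powr (-1/4) \<le> (rho z + 1) powr (-1/4) + p1 * w + p2 / 2 * w\<^sup>2
          + 2 * (rho z + 1) powr (-13/4) * \<bar>w\<bar> ^ 3"
        using taylor_powr[of "rho z" w] by (simp add: p1_def p2_def X_def \<rho>_def)
    next
      have "m * p1 + 2 * \<rho> * p2 \<le> 0" using neg powr_ge_zero[of X "-5/4"] by linarith
      thus "real (d - 1) * p1 + 2 * rho z * p2 \<le> 0" by (simp add: m_def \<rho>_def)
    qed (use z t r t1 in \<open>auto simp: m_def \<rho>_def\<close>)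
    also have "c * (m * p1 + 2 * \<rho> * p2) \<le> c * (- (X powr (-5/4) / 8))"
      using c neg by (intro mult_left_mono) auto
    also have "(5 / 2 * \<bar>p2\<bar> * sqrt \<rho> + 27 * (2 * X powr (-13/4)) * (\<rho> * sqrt \<rho>)) * (2 * m * real t ^ 2) ^ 3
        \<le> (X powr (-7/4) * 56) * (8 * m ^ 3 * \<rho> powr (3/32))"
    proof (rule mult_mono)
      have s: "sqrt \<rho> \<le> sqrt X" "\<rho> * sqrt \<rho> \<le> X * sqrt X" using \<rho>0 by (auto intro!: mult_mono)
      have "5 / 2 * \<bar>p2\<bar> * sqrt \<rho> \<le> 1 * (X powr (-9/4) * sqrt X)"
        using s mult_mono[of "25/32 * X powr (-9/4)" "X powr (-9/4)" "sqrt \<rho>" "sqrt X"] \<rho>0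
        by (simp add: p2_def)
      moreover have "27 * (2 * X powr (-13/4)) * (\<rho> * sqrt \<rho>) \<le> 54 * (X powr (-13/4) * (X * sqrt X))"
        using mult_left_mono[OF s(2), of "54 * X powr (-13/4)"] by (simp add: mult_ac)
      ultimately have "5 / 2 * \<bar>p2\<bar> * sqrt \<rho> + 27 * (2 * X powr (-13/4)) * (\<rho> * sqrt \<rho>) \<le> 55 * X powr (-7/4)"
        unfolding Xpow by linarith
      thus "5 / 2 * \<bar>p2\<bar> * sqrt \<rho> + 27 * (2 * X powr (-13/4)) * (\<rho> * sqrt \<rho>) \<le> X powr (-7/4) * 56"
        using powr_ge_zero[of X "-7/4"] by linarith
      have "(real t ^ 2) ^ 3 \<le> (\<rho> powr (1/32)) ^ 3" using t(4) r by (intro power_mono) auto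
      also have "\<dots> = \<rho> powr (3/32)" using \<rho>0 by (simp add: powr_powr flip: powr_realpow)
      finally have "8 * m ^ 3 * (real t ^ 2) ^ 3 \<le> 8 * m ^ 3 * \<rho> powr (3/32)"
        using m0 by (intro mult_left_mono) auto
      thus "(2 * m * real t ^ 2) ^ 3 \<le> 8 * m ^ 3 * \<rho> powr (3/32)" by (simp add: power_mult_distrib)
    qed (use m0 \<rho>0 in auto)
    finally have 1: "mean t z (\<lambda>w. (rho w + 1) powr (-1/4)) \<le>
       X powr (-1/4) - c * (X powr (-5/4) / 8) + X powr (-7/4) * (56 * (8 * m ^ 3 * \<rho> powr (3/32)))"
      by (simp add: mult_ac)
    have "tail t orig z \<le> C1 / real t ^ 128" using tail[rule_format, OF z(1) _ z(2), of t] t(1) r by simp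
    also have "real t ^ 128 = (real t ^ 64)\<^sup>2" by (simp flip: power_mult)
    also have "C1 / (real t ^ 64)\<^sup>2 = C1 * (1 / real t ^ 64)\<^sup>2" by (simp add: power_divide)
    also have "\<dots> \<le> C1 * (2 ^ 64 / \<rho>)\<^sup>2"
      using t(5) r C1 by (intro mult_left_mono power_mono) auto
    also have "(2 ^ 64 / \<rho>)\<^sup>2 = 2 ^ 128 / \<rho>\<^sup>2" by (simp add: power_divide flip: power_mult)
    finally have "tail t orig z \<le> C1 * (2 ^ 128 / \<rho>\<^sup>2)" .
    with 1 r show ?thesis unfolding X_def t_def \<rho>_def by linarith
  qed
  have "u n z \<le> C * (rho z + 1) powr (-1/4)" if "z \<in> L" "z d = 0" for n z
    using that
  proof (induction n arbitrary: z)
    case (0 z)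
    show ?case
    proof (cases "z = orig")
      case True
      thus ?thesis using near[of z] R u_le_1[of 0 z] by simp
    next
      case False
      thus ?thesis using u_0[of z] 0 C by simp
    qed
  next
    case (Suc n z)
    show ?case
    proof (cases "rho z \<le> R")
      case True
      thus ?thesis using near[of z] u_le_1[of "Suc n" z] by linarith
    next
      case False
      define t where "t = cutoff (rho z)"
      have "u (Suc n) z \<le> mean t z (u n) + tail t orig z"
        by (rule u_renewal) (use Suc in auto)
      \<comment> \<open>As \<open>C \<ge> 1\<close>, the tail may be scaled by \<open>C\<close>
        along with the supersolution.\<close>
      also have "\<dots> \<le> mean t z (\<lambda>w. C * (rho w + 1) powr (-1/4)) + C * tail t orig z"
        using Suc.IH C tail_nonneg[of t orig z] mult_right_mono[of 1 C "tail t orig z"]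
        by (intro add_mono sum_mono mult_left_mono) (auto simp: J_def)
      also have "\<dots> = C * (mean t z (\<lambda>w. (rho w + 1) powr (-1/4)) + tail t orig z)"
        by (simp add: sum_distrib_left algebra_simps)
      also have "\<dots> \<le> C * (rho z + 1) powr (-1/4)"
        using super[of z] Suc.prems False C unfolding t_def by (intro mult_left_mono) auto
      finally show ?thesis .
    qed
  qed
  with C show ?thesis by (rule that)
qed

section \<open>Dimension two and three: paths on the same level meet\<close>

text \<open>Required for every \<open>t\<close> from the cutoff on, since the maximum principle lets
  \<open>t\<close> grow to remove the tail. The function is unbounded, so a larger \<open>t\<close>
  adds contributions from long rounds; their sum over all levels is bounded and absorbed by the
  drift at the cutoff.\<close>

lemma lnln_superharmonic:
  assumes d3: "d \<le> 3"
  obtains R where "R > 0"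
    "\<And>z t. z \<in> L \<Longrightarrow> z d = 0 \<Longrightarrow> R \<le> rho z \<Longrightarrow> cutoff (rho z) \<le> t \<Longrightarrow>
      mean t z (\<lambda>w. ln (ln (rho w + 3))) \<le> ln (ln (rho z + 3))"
proof -
  obtain c where c: "c > 0" and drift: "drift_rate c" using drift_rate_ex by blast
  \<comment> \<open>198 = 3 * 64 + 2 + 4: a factor rho^(-3) through the cutoff, two powers to make
    the increments summable, and four to pay for the growth of the function.\<close>
  obtain C1 where C1: "C1 > 0" and tail: "\<forall>z\<in>L. \<forall>t\<ge>1. z d = 0 \<longrightarrow> tail t orig z \<le> C1 / real t ^ 198"
    using tail_bound[of 198] by blast
  define m where "m = real (d - 1)"
  have m: "1 \<le> m" "m \<le> 2" using d3 d_ge_2 by (auto simp: m_def)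
  have m0: "m > 0" using m by simp
  define far where "far \<rho> \<longleftrightarrow> 12 * m * \<rho> powr (1/32) \<le> sqrt \<rho> \<and> 6 * ln (\<rho> + 3) + 6 \<le> \<rho> + 3 \<and>
    275 * (sqrt (\<rho> + 3) / (\<rho> + 3)\<^sup>2) * (8 * m ^ 3 * \<rho> powr (3/32))
      + 2 * (16 * (2 * \<rho> + 8 * m + 3) * C1 * (2 ^ 64 / \<rho>) ^ 3) \<le> c * (1 / ((\<rho> + 3) * (ln (\<rho> + 3))\<^sup>2))
    \<and> \<rho> \<ge> 2 ^ 64" for \<rho> :: real
  have "eventually (\<lambda>\<rho>::real. 12 * m * \<rho> powr (1/32) \<le> sqrt \<rho>) at_top"
    using m0 by real_asymp
  moreover have "eventually (\<lambda>\<rho>::real. 6 * ln (\<rho> + 3) + 6 \<le> \<rho> + 3) at_top"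
    by real_asymp
  moreover have "eventually (\<lambda>\<rho>::real. 275 * (sqrt (\<rho> + 3) / (\<rho> + 3)\<^sup>2) * (8 * m ^ 3 * \<rho> powr (3/32))
      + 2 * (16 * (2 * \<rho> + 8 * m + 3) * C1 * (2 ^ 64 / \<rho>) ^ 3) \<le> c * (1 / ((\<rho> + 3) * (ln (\<rho> + 3))\<^sup>2))) at_top"
    using m0 C1 c by real_asymp
  ultimately have "eventually far at_top"
    unfolding far_def using eventually_ge_at_top[of "2 ^ 64 :: real"] by eventually_elim auto
  then obtain R0 where R0: "\<And>\<rho>. \<rho> \<ge> R0 \<Longrightarrow> far \<rho>"
    by (auto simp: eventually_at_top_linorder)
  show ?thesis
  proof (rule that[of "max R0 1"])
    fix z t' assume z: "z \<in> L" "z d = 0" and far: "max R0 1 \<le> rho z" and t': "cutoff (rho z) \<le> t'"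
    define \<rho> where "\<rho> = rho z"
    define t where "t = cutoff \<rho>"
    define X where "X = \<rho> + 3"
    define l where "l = ln X"
    have \<rho>R: "\<rho> \<ge> R0" using far by (simp add: \<rho>_def)
    note r = R0[OF \<rho>R, unfolded far_def]
    note t = cutoff_bounds[of \<rho>, folded t_def]
    have \<rho>0: "\<rho> > 0" "X \<ge> 3" "\<rho> \<le> X" using r by (auto simp: X_def intro: less_le_trans[of 0 "2^64"])
    have l: "l \<ge> 1" unfolding l_def by (rule ln_ge_1[OF \<rho>0(2)])
    have t1: "12 * m * real t ^ 2 \<le> sqrt \<rho>"
    proof -
      have "12 * m * real t ^ 2 \<le> 12 * m * \<rho> powr (1/32)"
        using t(4) r m0 by (intro mult_left_mono) auto
      with r show ?thesis by linarith
    qed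
    define A where "A s = mean s z (\<lambda>w. ln (ln (rho w + 3)))" for s
    define p1 where "p1 = 1 / (X * l)"
    define p2 where "p2 = - (l + 1) / (X\<^sup>2 * l\<^sup>2)"
    \<comment> \<open>For m = 2 the terms of order 1 / (X l) cancel, ln being harmonic in the plane;
      a negative term of order 1 / (X l^2) survives.\<close>
    have neg: "m * p1 + 2 * \<rho> * p2 \<le> - (1 / (X * l\<^sup>2))"
    proof -
      have "m * p1 \<le> 2 * p1" unfolding p1_def using m l \<rho>0 by (intro mult_right_mono) auto
      moreover have "2 * p1 + 2 * \<rho> * p2 = (6 * l + 6 - 2 * X) / (X\<^sup>2 * l\<^sup>2)"
      proof -
        have \<rho>X: "\<rho> = X - 3" by (simp add: X_def)
        have "X \<noteq> 0" "l \<noteq> 0" using \<rho>0 l by auto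
        thus ?thesis unfolding \<rho>X p1_def p2_def by (simp add: field_simps power2_eq_square)
      qed
      moreover have "(6 * l + 6 - 2 * X) / (X\<^sup>2 * l\<^sup>2) \<le> (- X) / (X\<^sup>2 * l\<^sup>2)"
        using r by (intro divide_right_mono) (auto simp: X_def l_def)
      moreover have "(- X) / (X\<^sup>2 * l\<^sup>2) = - (1 / (X * l\<^sup>2))"
        using \<rho>0 l by (simp add: power2_eq_square)
      ultimately show ?thesis by linarith
    qed
    have ln0: "0 \<le> ln l" using l by simp
    have "A t \<le> ln l + c * (m * p1 + 2 * \<rho> * p2)
         + (5 / 2 * \<bar>p2\<bar> * sqrt \<rho> + 27 * (10 / X ^ 3) * (\<rho> * sqrt \<rho>)) * (2 * m * real t ^ 2) ^ 3"
      unfolding m_def \<rho>_def X_def A_def l_def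
    proof (rule drift[unfolded drift_rate_def, rule_format, where \<phi> = "\<lambda>x. ln (ln (x + 3))"])
      fix w :: real assume "\<bar>w\<bar> \<le> rho z / 2"
      thus "ln (ln (rho z + w + 3)) \<le> ln (ln (rho z + 3)) + p1 * w + p2 / 2 * w\<^sup>2 + 10 / (rho z + 3) ^ 3 * \<bar>w\<bar> ^ 3"
        using taylor_lnln[of "rho z" w] by (simp add: p1_def p2_def X_def \<rho>_def l_def)
    next
      have "0 \<le> 1 / (X * l\<^sup>2)" using \<rho>0 by simp
      with neg have "m * p1 + 2 * \<rho> * p2 \<le> 0" by linarith
      thus "real (d - 1) * p1 + 2 * rho z * p2 \<le> 0" by (simp add: m_def \<rho>_def)
    qed (use z t r t1 ln0 in \<open>auto simp: m_def \<rho>_def l_def X_def\<close>)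
    also have "c * (m * p1 + 2 * \<rho> * p2) \<le> c * (- (1 / (X * l\<^sup>2)))"
      using c neg by (intro mult_left_mono) auto
    also have "(5 / 2 * \<bar>p2\<bar> * sqrt \<rho> + 27 * (10 / X ^ 3) * (\<rho> * sqrt \<rho>)) * (2 * m * real t ^ 2) ^ 3
        \<le> (275 * (sqrt X / X\<^sup>2)) * (8 * m ^ 3 * \<rho> powr (3/32))"
    proof (rule mult_mono)
      have s: "sqrt \<rho> \<le> sqrt X" "\<rho> * sqrt \<rho> \<le> X * sqrt X" using \<rho>0 by (auto intro!: mult_mono)
      have "\<bar>p2\<bar> = (l + 1) / l\<^sup>2 / X\<^sup>2" unfolding p2_def using l \<rho>0 by (simp add: mult.commute add.commute)
      also have "\<dots> \<le> 2 / X\<^sup>2"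
      proof (rule divide_right_mono)
        have "l \<le> l\<^sup>2" "1 \<le> l\<^sup>2" using l power_increasing[of 1 2 l] power_increasing[of 0 2 l] by auto
        thus "(l + 1) / l\<^sup>2 \<le> 2" using l by (simp add: divide_simps)
      qed auto
      finally have "\<bar>p2\<bar> * sqrt \<rho> \<le> 2 / X\<^sup>2 * sqrt X" using s \<rho>0 by (intro mult_mono) auto
      hence "5 / 2 * \<bar>p2\<bar> * sqrt \<rho> \<le> 5 * (sqrt X / X\<^sup>2)" by simp
      moreover have "27 * (10 / X ^ 3) * (\<rho> * sqrt \<rho>) \<le> 27 * (10 / X ^ 3) * (X * sqrt X)"
        using s(2) \<rho>0 by (intro mult_left_mono) auto
      moreover have "27 * (10 / X ^ 3) * (X * sqrt X) = 270 * (sqrt X / X\<^sup>2)"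
        using \<rho>0 by (simp add: power2_eq_square power3_eq_cube)
      ultimately show "5 / 2 * \<bar>p2\<bar> * sqrt \<rho> + 27 * (10 / X ^ 3) * (\<rho> * sqrt \<rho>) \<le> 275 * (sqrt X / X\<^sup>2)"
        by linarith
      have "(real t ^ 2) ^ 3 \<le> (\<rho> powr (1/32)) ^ 3" using t(4) r by (intro power_mono) auto
      also have "\<dots> = \<rho> powr (3/32)" using \<rho>0 by (simp add: powr_powr flip: powr_realpow)
      finally have "8 * m ^ 3 * (real t ^ 2) ^ 3 \<le> 8 * m ^ 3 * \<rho> powr (3/32)"
        using m0 by (intro mult_left_mono) auto
      thus "(2 * m * real t ^ 2) ^ 3 \<le> 8 * m ^ 3 * \<rho> powr (3/32)" by (simp add: power_mult_distrib)
    qed (use m0 \<rho>0 in auto)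
    finally have At: "A t \<le> ln l - c * (1 / (X * l\<^sup>2)) + 275 * (sqrt X / X\<^sup>2) * (8 * m ^ 3 * \<rho> powr (3/32))"
      by simp
    \<comment> \<open>\<open>G * real (Suc s) ^ 4\<close> will dominate the function on rounds of at
      most \<open>Suc s\<close> levels, by the crude estimate of ln (ln y) by y.\<close>
    define G where "G = 2 * \<rho> + 8 * m + 3"
    have G0: "G > 0" using \<rho>0 m0 by (simp add: G_def)
    define E where "E = 16 * G * C1 * (2 ^ 64 / \<rho>) ^ 3"
    have ab: "orig \<in> L" "z \<in> L" "orig d = z d" using z by auto
    have increment: "A (Suc s) \<le> A s + E * (1 / (real s)\<^sup>2)" if s: "s \<ge> t" for s
    proof -
      have s1: "real s \<ge> 1" "s \<ge> 1" using s t(1) r by auto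
      define f where "f xy = ln (ln (rho (diff (snd xy) (fst xy)) + 3))" for xy
      have f_le: "f xy \<le> G * real (Suc s) ^ 4" if xy: "xy \<in> J (Suc s) orig z" for xy
      proof -
        have "rho (diff (snd xy) (fst xy)) \<le> (\<Sum>i\<in>{1..<d}. 2 * (of_int (z i))\<^sup>2 + 8 * real (Suc s) ^ 4)"
          unfolding rho_diff[of _ z]
        proof (rule sum_mono)
          fix i assume i: "i \<in> {1..<d}"
          have "(of_int (z i) + D orig z i xy)\<^sup>2 \<le> 2 * (of_int (z i))\<^sup>2 + 2 * (D orig z i xy)\<^sup>2"
            using sum_squares_bound[of "of_int (z i)" "D orig z i xy"] by (simp add: power2_sum)
          moreover have "(D orig z i xy)\<^sup>2 \<le> (2 * real (Suc s) ^ 2)\<^sup>2"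
            using power_mono[OF D_bound[OF xy i], of 2] by (simp only: power2_abs abs_ge_zero)
          moreover have "(2 * real (Suc s) ^ 2)\<^sup>2 = 4 * real (Suc s) ^ 4"
            by (simp add: power_mult_distrib del: of_nat_Suc flip: power_mult)
          ultimately show "(of_int (z i) + D orig z i xy)\<^sup>2 \<le> 2 * (of_int (z i))\<^sup>2 + 8 * real (Suc s) ^ 4"
            by linarith
        qed
        also have "\<dots> = 2 * \<rho> + 8 * m * real (Suc s) ^ 4"
          by (simp add: sum.distrib sum_distrib_left \<rho>_def rho_def m_def del: of_nat_Suc)
        finally have 1: "rho (diff (snd xy) (fst xy)) \<le> 2 * \<rho> + 8 * m * real (Suc s) ^ 4" .
        define y where "y = rho (diff (snd xy) (fst xy)) + 3"
        have y: "y \<ge> 3" by (simp add: y_def)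
        have "f xy \<le> ln y" using ln_ge_1[OF y] ln_bound[of "ln y"] by (simp add: f_def y_def)
        also have "\<dots> \<le> y" using ln_bound[of y] y by simp
        also have "y \<le> 2 * \<rho> + 8 * m * real (Suc s) ^ 4 + 3" using 1 by (simp add: y_def)
        also have "\<dots> \<le> (2 * \<rho> + 3) * real (Suc s) ^ 4 + 8 * m * real (Suc s) ^ 4"
          using mult_left_mono[of 1 "real (Suc s) ^ 4" "2 * \<rho> + 3"] \<rho>0
          by (simp del: of_nat_Suc add: one_le_power)
        also have "\<dots> = G * real (Suc s) ^ 4" by (simp add: G_def algebra_simps)
        finally show ?thesis .
      qed
      have sub: "J s orig z \<subseteq> J (Suc s) orig z" by (rule J_mono) simp
      have "A (Suc s) - A s = (\<Sum>xy\<in>J (Suc s) orig z - J s orig z. Q orig z xy * f xy)"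
        unfolding A_def f_def[symmetric] by (rule sum_diff[symmetric, OF finite_J sub])
      also have "\<dots> \<le> (\<Sum>xy\<in>J (Suc s) orig z - J s orig z. Q orig z xy * (G * real (Suc s) ^ 4))"
        using f_le by (intro sum_mono mult_left_mono) auto
      also have "\<dots> = (\<Sum>xy\<in>J (Suc s) orig z - J s orig z. Q orig z xy) * (G * real (Suc s) ^ 4)"
        by (rule sum_distrib_right[symmetric])
      also have "(\<Sum>xy\<in>J (Suc s) orig z - J s orig z. Q orig z xy) = tail s orig z - tail (Suc s) orig z"
        using sum_diff[OF finite_J sub, of "Q orig z"] sum_Q[OF ab] by simp
      also have "(tail s orig z - tail (Suc s) orig z) * (G * real (Suc s) ^ 4) \<le> (C1 / real s ^ 198) * (G * (16 * real s ^ 4))"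
      proof (rule mult_mono)
        show "tail s orig z - tail (Suc s) orig z \<le> C1 / real s ^ 198"
          using tail[rule_format, OF z(1) s1(2) z(2)] tail_nonneg[of "Suc s" orig z] by linarith
        have "real (Suc s) ^ 4 \<le> (2 * real s) ^ 4" using s1 by (intro power_mono) auto
        thus "G * real (Suc s) ^ 4 \<le> G * (16 * real s ^ 4)"
          using G0 by (intro mult_left_mono) (auto simp: power_mult_distrib)
      qed (use C1 G0 in auto)
      also have "\<dots> = 16 * G * C1 * (1 / real s ^ 64) ^ 3 * (1 / (real s)\<^sup>2)"
      proof -
        have 198: "real s ^ 198 = (real s ^ 64) ^ 3 * (real s)\<^sup>2 * real s ^ 4"
          by (simp flip: power_mult power_add)
        have cancel: "C1 / (q ^ 3 * w * b) * (G * (16 * b)) = 16 * G * C1 * (1 / q) ^ 3 * (1 / w)"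
          if "b \<noteq> 0" for q w b :: real
          using that by (simp add: power_divide)
        have "real s \<noteq> 0" using s1 by auto
        thus ?thesis unfolding 198 by (intro cancel) simp
      qed
      also have "\<dots> \<le> E * (1 / (real s)\<^sup>2)"
        unfolding E_def
      proof (intro mult_right_mono mult_left_mono power_mono)
        have "1 / real s ^ 64 \<le> 1 / real t ^ 64"
          using s t(1) r by (intro divide_left_mono power_mono mult_pos_pos zero_less_power) auto
        thus "1 / real s ^ 64 \<le> 2 ^ 64 / \<rho>" using t(5) r by linarith
      qed (use G0 C1 in auto)
      finally show ?thesis by linarith
    qed
    have E0: "E \<ge> 0" using G0 C1 \<rho>0 by (simp add: E_def)
    \<comment> \<open>The sum of 1 / s^2 in telescoping form: each term is at most 2 / s - 2 / (s +
      1).\<close>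
    have sum_incr: "A (t + n) \<le> A t + E * (2 - 2 / real (t + n))" for n
    proof (induction n)
      case 0
      have "2 / real t \<le> 2" using t(1) r by (simp add: divide_le_eq)
      hence "0 \<le> E * (2 - 2 / real t)" using E0 by (intro mult_nonneg_nonneg) auto
      thus ?case by simp
    next
      case (Suc n)
      define s where "s = t + n"
      have s1: "real s \<ge> 1" using t(1) r by (auto simp: s_def)
      have "1 / (real s)\<^sup>2 \<le> 2 / real s - 2 / real (Suc s)"
      proof -
        have "1 / (real s)\<^sup>2 = 2 / (2 * (real s * real s))" by (simp add: power2_eq_square)
        also have "\<dots> \<le> 2 / (real s * (real s + 1))"
        proof (rule divide_left_mono)
          have "real s * (real s + 1) \<le> real s * (2 * real s)" using s1 by (intro mult_left_mono) auto
          thus "real s * (real s + 1) \<le> 2 * (real s * real s)" by simp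
        qed (use s1 in auto)
        also have "\<dots> = 2 / real s - 2 / real (Suc s)" using s1 by (simp add: divide_simps)
        finally show ?thesis .
      qed
      hence "E * (1 / (real s)\<^sup>2) \<le> E * (2 / real s - 2 / real (Suc s))" using E0 by (intro mult_left_mono)
      hence "A (Suc s) \<le> A t + E * (2 - 2 / real s) + E * (2 / real s - 2 / real (Suc s))"
        using increment[of s] Suc by (simp add: s_def)
      also have "\<dots> = A t + E * (2 - 2 / real (Suc s))" by (simp add: algebra_simps)
      finally show ?case by (simp add: s_def)
    qed
    obtain n where n: "t' = t + n" using t' le_Suc_ex by (auto simp: t_def \<rho>_def)
    have "E * (2 - 2 / real (t + n)) \<le> E * 2" using E0 by (intro mult_left_mono) auto
    hence "A t' \<le> A t + 2 * E" using sum_incr[of n] n by simp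
    also have "\<dots> \<le> ln l" using At r unfolding E_def G_def X_def l_def by linarith
    finally show "mean t' z (\<lambda>w. ln (ln (rho w + 3))) \<le> ln (ln (rho z + 3))"
      by (simp add: A_def l_def X_def \<rho>_def)
  qed auto
qed

lemma tail_vanishes:
  assumes z: "z \<in> L" "z d = 0" and "\<And>t. t \<ge> t0 \<Longrightarrow> e \<le> tail t orig z"
  shows "e \<le> 0"
proof (rule ccontr)
  assume e: "\<not> e \<le> 0"
  obtain C where C: "C > 0" "\<forall>z\<in>L. \<forall>t\<ge>1. z d = 0 \<longrightarrow> tail t orig z \<le> C / real t ^ 1"
    using tail_bound[of 1] by blast
  obtain n :: nat where n: "C / e < real n" using reals_Archimedean2 by blast
  define t where "t = max (max t0 n) 1"
  have t: "t \<ge> t0" "t \<ge> 1" "real n \<le> real t" by (auto simp: t_def)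
  have "e \<le> C / real t" using assms(3)[OF t(1)] C(2)[rule_format, OF z(1) t(2) z(2)] by simp
  hence "real t \<le> C / e" using e t(2) by (simp add: field_simps)
  with n t(3) show False by linarith
qed

text \<open>
  Maximum principle: a bounded subharmonic function vanishing at the origin, compared with the
  superharmonic function \<open>ln (ln (rho + 3))\<close>, attains its maximum near the origin, and the
  origin is reached in one step with positive probability.
\<close>

lemma g_zero:
  assumes d3: "d \<le> 3" and z0: "z0 \<in> L" "z0 d = 0"
  shows "g z0 = 0"
proof -
  define f where "f z = ln (ln (rho z + 3))" for z
  have f0: "0 \<le> f z" for z unfolding f_def using ln_ge_1[of "rho z + 3"] by simp
  obtain R where R: "R > 0" and super: "\<And>z t. z \<in> L \<Longrightarrow> z d = 0 \<Longrightarrow> R \<le> rho z \<Longrightarrow> cutoff (rho z) \<le> t \<Longrightarrow>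
      mean t z f \<le> f z"
    unfolding f_def using lnln_superharmonic[OF d3] by blast
  define K where "K = {z \<in> L. z d = 0 \<and> rho z \<le> R}"
  have K: "finite K" "orig \<in> K" using finite_rho_ball R by (auto simp: K_def)
  define s where "s = Max (g ` K)"
  have s: "g z \<le> s" if "z \<in> K" for z unfolding s_def using K that by (intro Max_ge) auto
  have s0: "0 \<le> s" using s[OF K(2)] g_orig by simp
  \<comment> \<open>If \<open>M\<close> were positive, the mass \<open>Q orig z (x, x)\<close> sent
    to the origin, where \<open>k\<close> is at most 0, would cost
    \<open>M * Q orig z (x, x)\<close> in the mean. Only \<open>tail\<close> could make this up, and
    it vanishes as \<open>t\<close> grows.\<close>
  have max_step: "M \<le> 0" if z: "z \<in> L" "z d = 0" "z \<noteq> orig"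
    and step: "\<And>t. t \<ge> t0 \<Longrightarrow> M \<le> mean t z k + tail t orig z"
    and kh: "\<And>w. w \<in> L \<Longrightarrow> w d = 0 \<Longrightarrow> k w \<le> M" "k orig \<le> 0" for M k z t0
  proof (rule ccontr)
    assume M: "\<not> M \<le> 0"
    obtain x t1 where x: "(x, x) \<in> J t1 orig z" "0 < Q orig z (x, x)" using Q_meet_pos[OF z] by blast
    have "M * Q orig z (x, x) \<le> tail t orig z" if t: "t \<ge> max t0 t1" for t
    proof -
      have xt: "(x, x) \<in> J t orig z" using J_mono[of t1 t orig z] t x(1) by auto
      have "mean t z k =
        Q orig z (x, x) * k orig + (\<Sum>xy\<in>J t orig z - {(x, x)}. Q orig z xy * k (diff (snd xy) (fst xy)))"
        using xt by (subst sum.remove[of _ "(x, x)"]) (auto simp: diff_self)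
      also have "\<dots> \<le> 0 + (\<Sum>xy\<in>J t orig z - {(x, x)}. Q orig z xy * M)"
        using kh by (intro add_mono sum_mono mult_left_mono mult_nonneg_nonpos) (auto simp: J_def)
      also have "\<dots> = ((\<Sum>xy\<in>J t orig z. Q orig z xy) - Q orig z (x, x)) * M"
        using xt by (simp add: sum_distrib_right[symmetric] sum_diff1)
      also have "\<dots> \<le> (1 - Q orig z (x, x)) * M"
        using M sum_Q[of orig z t] z by (intro mult_right_mono) auto
      finally show ?thesis using step[of t] t by (simp add: algebra_simps)
    qed
    from tail_vanishes[OF z(1,2) this] have "M * Q orig z (x, x) \<le> 0" by blast
    with M x(2) show False by (simp add: mult_le_0_iff)
  qed
  have comparison: "g z \<le> s + \<epsilon> * f z" if z: "z \<in> L" "z d = 0" and \<epsilon>: "\<epsilon> > 0" for z \<epsilon>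
  proof (rule ccontr)
    assume neg: "\<not> g z \<le> s + \<epsilon> * f z"
    define h where "h w = g w - s - \<epsilon> * f w" for w
    \<comment> \<open>Since \<open>g\<close> is at most 1 and \<open>f\<close> tends to infinity,
      \<open>h\<close> is positive on a finite set only and attains its maximum there, outside
      \<open>K\<close>, where \<open>f\<close> is superharmonic.\<close>
    define P where "P = {w \<in> L. w d = 0 \<and> h w > 0}"
    have "z \<in> P" using z neg by (auto simp: P_def h_def)
    have "P \<subseteq> {w \<in> L. w d = 0 \<and> rho w \<le> exp (exp (1 / \<epsilon>))}"
    proof
      fix w assume w: "w \<in> P"
      hence "\<epsilon> * f w < 1" using g_le_1[of w] s0 by (auto simp: P_def h_def)
      hence "f w < 1 / \<epsilon>" using \<epsilon> by (simp add: field_simps)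
      moreover have "ln (rho w + 3) > 0" using ln_ge_1[of "rho w + 3"] by simp
      ultimately have "ln (rho w + 3) < exp (1 / \<epsilon>)"
        unfolding f_def by (metis exp_less_cancel_iff exp_ln)
      hence "rho w + 3 < exp (exp (1 / \<epsilon>))"
        using rho_nonneg[of w] by (metis add_nonneg_pos exp_less_cancel_iff exp_ln zero_less_numeral)
      with w show "w \<in> {w \<in> L. w d = 0 \<and> rho w \<le> exp (exp (1 / \<epsilon>))}" by (auto simp: P_def)
    qed
    hence "finite P" by (rule finite_subset[OF _ finite_rho_ball])
    then obtain y where y: "y \<in> P" "\<And>w. w \<in> P \<Longrightarrow> h w \<le> h y"
      using ex_is_arg_min_if_finite[of P "\<lambda>w. - h w"] \<open>z \<in> P\<close> unfolding is_arg_min_linorder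
      by (metis empty_iff neg_le_iff_le)
    have yL: "y \<in> L" "y d = 0" "h y > 0" using y(1) by (auto simp: P_def)
    have hK: "h w \<le> 0" if "w \<in> K" for w
    proof -
      have "0 \<le> \<epsilon> * f w" using f0[of w] \<epsilon> by (intro mult_nonneg_nonneg) auto
      with s[OF that] show ?thesis unfolding h_def by linarith
    qed
    have "y \<notin> K" using hK[of y] yL by auto
    hence far: "R \<le> rho y" and y0: "y \<noteq> orig" using yL K(2) by (auto simp: K_def)
    have "h y \<le> 0"
    proof (rule max_step[of y "cutoff (rho y)" "h y" h, OF yL(1,2) y0])
      fix t assume t: "t \<ge> cutoff (rho y)"
      define q where "q = (\<Sum>xy\<in>J t orig y. Q orig y xy)"
      have q: "q = 1 - tail t orig y" unfolding q_def using sum_Q[of orig y t] yL by simp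
      have "g y \<le> mean t y g + tail t orig y"
        by (rule g_renewal[OF yL(1,2)])
      also have "mean t y g =
        mean t y h + s * q
          + \<epsilon> * mean t y f"
        unfolding h_def q_def by (simp add: sum_distrib_left sum.distrib sum_subtractf algebra_simps)
      also have "\<dots> \<le> mean t y h + s * 1 + \<epsilon> * f y"
        using super[OF yL(1,2) far t] \<epsilon> s0 by (intro add_mono mult_left_mono order_refl) (auto simp: q)
      finally show "h y \<le> mean t y h + tail t orig y"
        by (simp add: h_def[of y])
    next
      show "h w \<le> h y" if "w \<in> L" "w d = 0" for w
        using y(2)[of w] that yL(3) by (cases "w \<in> P") (auto simp: P_def)
      show "h orig \<le> 0" by (rule hK[OF K(2)])
    qed
    with yL show False by simp
  qed
  \<comment> \<open>The multiple of \<open>f\<close> is made arbitrarily small, which leaves the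
    maximum over \<open>K\<close> as a bound everywhere; \<open>max_step\<close> then applies to
    \<open>g\<close> itself. The denominator \<open>f z + 1\<close> also covers
    \<open>f z = 0\<close>.\<close>
  have gs: "g z \<le> s" if z: "z \<in> L" "z d = 0" for z
  proof (rule field_le_epsilon)
    fix e :: real assume e: "e > 0"
    have "g z \<le> s + e / (f z + 1) * f z" using f0[of z] e by (intro comparison z) auto
    also have "e / (f z + 1) * f z \<le> e" using f0[of z] e by (simp add: field_simps)
    finally show "g z \<le> s + e" by simp
  qed
  obtain y where y: "y \<in> K" "s = g y"
  proof -
    have "s \<in> g ` K" unfolding s_def using K by (intro Max_in) auto
    thus ?thesis using that by blast
  qed
  have yL: "y \<in> L" "y d = 0" using y(1) by (auto simp: K_def)
  have "s \<le> 0"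
  proof (cases "y = orig")
    case True
    thus ?thesis using y(2) g_orig by simp
  next
    case False
    show ?thesis
    proof (rule max_step[of y 0 s g, OF yL False])
      show "s \<le> mean t y g + tail t orig y" for t
        unfolding y(2) by (rule g_renewal[OF yL])
    qed (use gs g_orig in auto)
  qed
  with gs[OF z0] g_nonneg[of z0] show ?thesis by linarith
qed

end

section \<open>Undirected graphs\<close>

lemma uwalk_rtranclp:
  "uwalk G xs \<Longrightarrow> (\<lambda>a b. a \<in> fst G \<and> b \<in> fst G \<and> {a, b} \<in> snd G)\<^sup>*\<^sup>* (hd xs) (last xs)"
proof (induction xs)
  case (Cons x xs)
  show ?case
  proof (cases xs)
    case (Cons y ys)
    hence "uwalk G xs" "x \<in> fst G" "y \<in> fst G" "{x, y} \<in> snd G"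
      using Cons.prems by (auto simp: uwalk_def)
    with Cons.IH Cons show ?thesis by (auto intro: converse_rtranclp_into_rtranclp)
  qed simp
qed (simp add: uwalk_def)

text \<open>Walks as lists give way to a closure, where induction and symmetry are at hand.
  Membership of \<open>u\<close> is stated separately because the closure is reflexive at every
  point.\<close>

lemma ureachable_iff:
  "ureachable G u v \<longleftrightarrow> u \<in> fst G \<and> (\<lambda>a b. a \<in> fst G \<and> b \<in> fst G \<and> {a, b} \<in> snd G)\<^sup>*\<^sup>* u v"
proof
  assume "ureachable G u v"
  then obtain xs where xs: "uwalk G xs" "hd xs = u" "last xs = v" by (auto simp: ureachable_def)
  moreover from xs have "u \<in> fst G" by (auto simp: uwalk_def)
  ultimately show "u \<in> fst G \<and> (\<lambda>a b. a \<in> fst G \<and> b \<in> fst G \<and> {a, b} \<in> snd G)\<^sup>*\<^sup>* u v"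
    using uwalk_rtranclp[OF xs(1)] by simp
next
  assume R: "u \<in> fst G \<and> (\<lambda>a b. a \<in> fst G \<and> b \<in> fst G \<and> {a, b} \<in> snd G)\<^sup>*\<^sup>* u v"
  hence "(\<lambda>a b. a \<in> fst G \<and> b \<in> fst G \<and> {a, b} \<in> snd G)\<^sup>*\<^sup>* u v" by blast
  thus "ureachable G u v"
  proof (induction rule: rtranclp_induct)
    case base
    show ?case unfolding ureachable_def using R
      by (intro exI[of _ "[u]"]) (auto simp: uwalk_def)
  next
    case (step v w)
    then obtain xs where xs: "uwalk G xs" "hd xs = u" "last xs = v" by (auto simp: ureachable_def)
    hence "uwalk G (xs @ [w])" "hd (xs @ [w]) = u" "last (xs @ [w]) = w"
      using step(2) by (auto simp: uwalk_def successively_append_iff)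
    thus ?case unfolding ureachable_def by blast
  qed
qed

lemma ureachable_refl: "u \<in> fst G \<Longrightarrow> ureachable G u u"
  by (simp add: ureachable_iff)

lemma ureachable_trans: "ureachable G u v \<Longrightarrow> ureachable G v w \<Longrightarrow> ureachable G u w"
  unfolding ureachable_iff by auto

lemma ureachable_sym:
  assumes "ureachable G u v" shows "ureachable G v u"
proof -
  let ?R = "\<lambda>a b. a \<in> fst G \<and> b \<in> fst G \<and> {a, b} \<in> snd G"
  have R: "?R\<^sup>*\<^sup>* u v" and u: "u \<in> fst G" using assms by (auto simp: ureachable_iff)
  have "symp ?R\<^sup>*\<^sup>*" by (intro symp_rtranclp sympI) (auto simp: insert_commute)
  with R have "?R\<^sup>*\<^sup>* v u" by (auto dest: sympD)
  moreover have "v \<in> fst G" using R u by (induction rule: rtranclp_induct) auto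
  ultimately show ?thesis by (simp add: ureachable_iff)
qed

lemma ureachable_in: "ureachable G u v \<Longrightarrow> u \<in> fst G \<and> v \<in> fst G"
  using ureachable_sym[of G u v] by (auto simp: ureachable_iff)

lemma utree_ucomponent_of:
  assumes F: "uforest G" and v: "v \<in> fst G"
  shows "utree (ucomponent_of G v)"
proof -
  define C where "C = ucomponent_of G v"
  have fC: "w \<in> fst C \<longleftrightarrow> ureachable G v w" for w by (simp add: C_def ucomponent_of_def)
  have sC: "e \<in> snd C \<longleftrightarrow> e \<in> snd G \<and> e \<subseteq> fst C" for e by (simp add: C_def ucomponent_of_def)
  have sub: "fst C \<subseteq> fst G"
    using ureachable_in[of G v] by (auto simp: fC)
  have walk: "uwalk G xs" if "uwalk C xs" for xs
  proof -
    have "successively (\<lambda>u v. {u, v} \<in> snd C) xs" "set xs \<subseteq> fst C" "xs \<noteq> []"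
      using that by (simp_all add: uwalk_def)
    moreover from this(1) have "successively (\<lambda>u v. {u, v} \<in> snd G) xs"
      by (rule successively_mono) (simp add: sC)
    ultimately show ?thesis using sub unfolding uwalk_def by blast
  qed
  have "uforest C"
    unfolding uforest_def
  proof (intro conjI notI)
    show "simple_ugraph C" using F by (simp add: uforest_def simple_ugraph_def sC)
    assume "\<exists>xs. ucycle C xs"
    then obtain xs where "ucycle C xs" by blast
    hence "ucycle G xs" using walk by (auto simp: ucycle_def sC)
    with F show False by (auto simp: uforest_def)
  qed
  moreover have "uconnected C"
    unfolding uconnected_def
  proof (intro conjI ballI)
    have "v \<in> fst C" by (simp add: fC ureachable_refl[OF v])
    thus "fst C \<noteq> {}" by blast
    fix a b assume ab: "a \<in> fst C" "b \<in> fst C"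
    hence "ureachable G a b" by (auto simp: fC intro: ureachable_trans[OF ureachable_sym])
    hence "(\<lambda>a b. a \<in> fst G \<and> b \<in> fst G \<and> {a, b} \<in> snd G)\<^sup>*\<^sup>* a b" by (simp add: ureachable_iff)
    \<comment> \<open>Carrying membership along shows that a walk of the whole graph never leaves
      the component.\<close>
    hence "b \<in> fst C \<and> ureachable C a b"
    proof (induction rule: rtranclp_induct)
      case (step b c)
      have "ureachable G b c" using step(2) by (auto simp: ureachable_iff)
      moreover have "ureachable G v b" using step(3) by (simp add: fC)
      ultimately have "c \<in> fst C" unfolding fC by (rule ureachable_trans[rotated])
      moreover have "ureachable C b c"
        using step(2,3) \<open>c \<in> fst C\<close> by (auto simp: ureachable_iff sC)
      ultimately show ?case using step(3) ureachable_trans[of C a b c] by blast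
    qed (simp add: ab ureachable_refl)
    thus "ureachable C a b" by simp
  qed
  ultimately show ?thesis by (simp add: utree_def C_def)
qed

context dsf
begin

section \<open>The spanning forest of a nice environment\<close>

context
  fixes U :: "(nat \<Rightarrow> int) \<Rightarrow> real"
  assumes nice: "nice U"
begin

abbreviation "G \<equiv> dsf_graph d p U"

lemma hop_exists: "\<exists>v. hop U a v"
proof -
  obtain w where "w \<in> L" "U w < p" "w d = a d + 1" using nice unfolding nice_def by blast
  thus ?thesis by (intro hop_ex[of w]) auto
qed

lemma hop_successor: "hop U a (successor d p U a)"
  unfolding successor_def
proof (rule theI'[of "hop U a"])
  obtain b where b: "hop U a b" using hop_exists by blast
  show "\<exists>!b. hop U a b"
    by (rule ex1I[of _ b]) (rule b, rule hop_unique[OF nice_inj[OF nice] _ b])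
qed

lemma successor_eq: "hop U a b \<Longrightarrow> successor d p U a = b"
  using hop_unique[OF nice_inj[OF nice] hop_successor] by blast

lemma fst_G: "v \<in> fst G \<longleftrightarrow> v \<in> L \<and> U v < p"
  by (simp add: dsf_graph_def open_vertices_def)

lemma edge_iff: "{a, b} \<in> snd G \<longleftrightarrow> a \<in> fst G \<and> hop U a b \<or> b \<in> fst G \<and> hop U b a"
proof -
  have "{a, b} \<in> snd G \<longleftrightarrow> (\<exists>x\<in>fst G. {a, b} = {x, successor d p U x})"
    by (auto simp: dsf_graph_def)
  also have "\<dots> \<longleftrightarrow> a \<in> fst G \<and> successor d p U a = b \<or> b \<in> fst G \<and> successor d p U b = a"
    by (auto simp: doubleton_eq_iff)
  finally show ?thesis using hop_successor successor_eq by blast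
qed

lemma hop_in_G: "hop U a b \<Longrightarrow> b \<in> fst G"
  by (auto simp: fst_G dest: hopD)

lemma meets_refl: "meets U a a"
  by (auto simp: meets_def intro: exI[of _ a])

lemma meets_sym: "meets U a b \<Longrightarrow> meets U b a"
  by (auto simp: meets_def)

lemma meets_trans: "meets U a b \<Longrightarrow> meets U b c \<Longrightarrow> meets U a c"
proof -
  assume "meets U a b" "meets U b c"
  then obtain m n where m: "trail U a m" "trail U b m" "trail U b n" "trail U c n"
    by (auto simp: meets_def)
  have "trail U m n \<or> trail U n m"
    using trail_linear[OF nice_inj[OF nice] m(2,3)] trail_linear[OF nice_inj[OF nice] m(3,2)] by linarith
  thus ?thesis using trail_trans[OF m(1)] trail_trans[OF m(4)] m(1,4) unfolding meets_def by blast
qed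

lemma trail_meets: "trail U a b \<Longrightarrow> meets U a b"
  unfolding meets_def using trail_refl by blast

lemma hop_trail: "hop U a b \<Longrightarrow> trail U a b"
  by (simp add: trail_def)

lemma trail_reachable:
  assumes "trail U a b" "a \<in> fst G" shows "ureachable G a b"
  using assms(1) unfolding trail_def
proof (induction rule: rtranclp_induct)
  case base
  show ?case by (rule ureachable_refl[OF assms(2)])
next
  case (step b c)
  have "b \<in> fst G" using ureachable_in[OF step(3)] by blast
  hence "ureachable G b c"
    using step(2) hop_in_G[OF step(2)] by (auto simp: ureachable_iff edge_iff)
  with step(3) show ?case by (rule ureachable_trans)
qed

text \<open>\<open>meets\<close> is transitive because a path is a chain; any zigzag of edges
  therefore collapses to two ascending paths with a common end.\<close>

lemma ureachable_iff_meets: "ureachable G a b \<longleftrightarrow> a \<in> fst G \<and> b \<in> fst G \<and> meets U a b"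
proof
  assume r: "ureachable G a b"
  hence "(\<lambda>a b. a \<in> fst G \<and> b \<in> fst G \<and> {a, b} \<in> snd G)\<^sup>*\<^sup>* a b" by (simp add: ureachable_iff)
  hence "meets U a b"
  proof (induction rule: rtranclp_induct)
    case (step b c)
    hence "meets U b c" by (auto simp: edge_iff intro: trail_meets hop_trail meets_sym)
    with step(3) show ?case by (rule meets_trans)
  qed (rule meets_refl)
  with ureachable_in[OF r] show "a \<in> fst G \<and> b \<in> fst G \<and> meets U a b" by blast
next
  assume "a \<in> fst G \<and> b \<in> fst G \<and> meets U a b"
  then obtain m where m: "a \<in> fst G" "b \<in> fst G" "trail U a m" "trail U b m" by (auto simp: meets_def)
  show "ureachable G a b"
    by (rule ureachable_trans[OF trail_reachable[OF m(3,1)] ureachable_sym[OF trail_reachable[OF m(4,2)]]])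
qed

text \<open>At a lowest vertex of a cycle, both neighbours on the cycle would be its successor, but
  they are distinct.\<close>

lemma uforest_G: "uforest G"
  unfolding uforest_def
proof (intro conjI notI)
  show "simple_ugraph G"
    unfolding simple_ugraph_def
  proof
    fix e assume "e \<in> snd G"
    then obtain a where a: "a \<in> fst G" "e = {a, successor d p U a}" by (auto simp: dsf_graph_def)
    with hop_in_G[OF hop_successor] hopD(3)[OF hop_successor[of a]]
    show "e \<subseteq> fst G \<and> card e = 2" by (auto simp: card_insert_if)
  qed
  assume "\<exists>xs. ucycle G xs"
  then obtain xs where xs: "uwalk G xs" "distinct xs" "length xs \<ge> 3" "{last xs, hd xs} \<in> snd G"
    by (auto simp: ucycle_def)
  define n where "n = length xs"
  have n: "n \<ge> 3" using xs by (simp add: n_def)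
  have edge: "{xs ! i, xs ! (if Suc i = n then 0 else Suc i)} \<in> snd G" if "i < n" for i
  proof (cases "Suc i = n")
    case True
    hence "i = length xs - 1" "xs \<noteq> []" using xs(3) by (auto simp: n_def)
    hence "last xs = xs ! i" "hd xs = xs ! 0" by (simp_all add: hd_conv_nth last_conv_nth)
    thus ?thesis using xs(4) True by simp
  next
    case False
    with that xs(1) show ?thesis by (auto simp: uwalk_def successively_conv_nth n_def)
  qed
  obtain i where i: "i < n" "\<And>k. k < n \<Longrightarrow> (xs ! i) d \<le> (xs ! k) d"
  proof -
    obtain i where "is_arg_min (\<lambda>i. (xs ! i) d) (\<lambda>i. i \<in> {..<n}) i"
      using ex_is_arg_min_if_finite[of "{..<n}" "\<lambda>i. (xs ! i) d"] n by (auto simp: lessThan_empty_iff)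
    thus thesis using that unfolding is_arg_min_linorder by auto
  qed
  have up: "hop U (xs ! i) (xs ! k)" if "k < n" "{xs ! i, xs ! k} \<in> snd G" for k
    using that i(2)[of k] by (auto simp: edge_iff dest: hopD(3))
  define j where "j = (if Suc i = n then 0 else Suc i)"
  define k where "k = (if i = 0 then n - 1 else i - 1)"
  have jk: "j < n" "k < n" "j \<noteq> k" using n i(1) by (auto simp: j_def k_def)
  have "hop U (xs ! i) (xs ! j)" using up[OF jk(1)] edge[OF i(1)] by (simp add: j_def)
  moreover have "hop U (xs ! i) (xs ! k)"
  proof (rule up[OF jk(2)])
    have "(if Suc k = n then 0 else Suc k) = i" using n i(1) by (auto simp: k_def)
    thus "{xs ! i, xs ! k} \<in> snd G" using edge[OF jk(2)] by (simp add: insert_commute)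
  qed
  ultimately have "xs ! j = xs ! k" using hop_unique[OF nice_inj[OF nice]] by blast
  with xs(2) jk show False by (simp add: nth_eq_iff_index_eq n_def)
qed

text \<open>A highest vertex of a finite component would have a still higher successor inside the
  component.\<close>

lemma infinite_component:
  assumes v: "v \<in> fst G" shows "infinite (fst (ucomponent_of G v))"
proof
  define C where "C = fst (ucomponent_of G v)"
  assume "finite (fst (ucomponent_of G v))"
  hence fin: "finite ((\<lambda>w. w d) ` C)" by (simp add: C_def)
  have C: "w \<in> C \<longleftrightarrow> ureachable G v w" for w by (simp add: C_def ucomponent_of_def)
  have "v \<in> C" by (simp add: C ureachable_refl[OF v])
  hence "Max ((\<lambda>w. w d) ` C) \<in> (\<lambda>w. w d) ` C" by (intro Max_in[OF fin]) blast
  then obtain w where w: "w \<in> C" "w d = Max ((\<lambda>w. w d) ` C)" by (metis imageE)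
  obtain b where b: "hop U w b" using hop_exists by blast
  have "ureachable G w b"
    using ureachable_in[of G v w] w(1) by (intro trail_reachable hop_trail b) (simp add: C)
  hence "b \<in> C" using w(1) ureachable_trans[of G v w b] by (simp add: C)
  hence "b d \<le> w d" using Max_ge[OF fin] w(2) by auto
  with hopD(3)[OF b] show False by simp
qed

lemma uconnected_G:
  assumes same: "\<And>a b. a \<in> L \<Longrightarrow> b \<in> L \<Longrightarrow> a d = b d \<Longrightarrow> meets U a b"
  shows "uconnected G"
proof -
  have main: "meets U a b" if "a \<in> fst G" "b \<in> fst G" "b d = a d + int n" for a b n
    using that
  proof (induction n arbitrary: b)
    case 0
    thus ?case by (intro same) (auto simp: fst_G)
  next
    case (Suc n)
    obtain c where c: "c \<in> L" "U c < p" "c d = b d - 1" using nice unfolding nice_def by blast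
    \<comment> \<open>The point below \<open>b\<close> may be closed, but a path starts there as
      well and steps to \<open>b\<close>. This links two adjacent levels through the hypothesis on
      equal levels.\<close>
    define b' where "b' = b(d := b d - 1)"
    have b: "b \<in> L" "U b < p" using Suc by (auto simp: fst_G)
    have b': "b' \<in> L" "b' d = b d - 1" "b = b'(d := b' d + 1)"
      using upd_in_L[OF b(1)] by (auto simp: b'_def)
    have "U (b'(d := b' d + 1)) < p" using b(2) by (simp only: b'(3)[symmetric])
    from hop_apex[of b' U, OF b'(1) this] have "hop U b' b" by (simp only: b'(3)[symmetric])
    hence 1: "meets U b' b" by (intro trail_meets hop_trail)
    have 2: "meets U c b'" using c b'(1,2) by (intro same) auto
    have 3: "meets U a c" using Suc.prems c by (intro Suc.IH) (auto simp: fst_G)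
    show ?case by (rule meets_trans[OF meets_trans[OF 3 2] 1])
  qed
  have "meets U a b" if "a \<in> fst G" "b \<in> fst G" for a b
  proof (cases "a d \<le> b d")
    case True
    thus ?thesis using main[of a b "nat (b d - a d)"] that by simp
  next
    case False
    thus ?thesis using main[of b a "nat (a d - b d)"] that meets_sym by simp
  qed
  moreover have "fst G \<noteq> {}" using nice unfolding nice_def fst_G[symmetric] by (metis empty_iff fst_G)
  ultimately show ?thesis by (auto simp: uconnected_def ureachable_iff_meets)
qed

text \<open>The points \<open>z i\<close> may be closed and so lie outside the graph; their
  successors are vertices and inherit that their paths never meet.\<close>

lemma infinite_components:
  assumes z: "\<And>k. \<exists>z::nat \<Rightarrow> _. \<forall>i<k. \<forall>j<k. i \<noteq> j \<longrightarrow> \<not> meets U (z i) (z j)"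
  shows "infinite (ucomponents G)"
proof
  assume fin: "finite (ucomponents G)"
  define k where "k = Suc (card (ucomponents G))"
  obtain z :: "nat \<Rightarrow> _" where z: "\<And>i j. i < k \<Longrightarrow> j < k \<Longrightarrow> i \<noteq> j \<Longrightarrow> \<not> meets U (z i) (z j)"
    using z[of k] by blast
  define c where "c i = ucomponent_of G (successor d p U (z i))" for i
  have inj: "inj_on c {..<k}"
  proof (rule inj_onI, rule ccontr)
    fix i j assume ij: "i \<in> {..<k}" "j \<in> {..<k}" "c i = c j" "i \<noteq> j"
    define a where "a = successor d p U (z i)"
    define b where "b = successor d p U (z j)"
    have h: "hop U (z i) a" "hop U (z j) b" by (simp_all add: a_def b_def hop_successor)
    have "b \<in> fst (c j)" using ureachable_refl[OF hop_in_G[OF h(2)]] by (simp add: c_def ucomponent_of_def b_def)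
    hence "ureachable G a b" unfolding ij(3)[symmetric] by (simp add: c_def ucomponent_of_def a_def)
    hence "meets U a b" by (simp add: ureachable_iff_meets)
    hence "meets U (z i) b" by (rule meets_trans[OF trail_meets[OF hop_trail[OF h(1)]]])
    hence "meets U (z i) (z j)"
      by (rule meets_trans[OF _ meets_sym[OF trail_meets[OF hop_trail[OF h(2)]]]])
    with z[of i j] ij show False by auto
  qed
  have "c ` {..<k} \<subseteq> ucomponents G"
    unfolding c_def ucomponents_def using hop_in_G[OF hop_successor] by auto
  hence "card {..<k} \<le> card (ucomponents G)"
    using card_inj_on_le[OF inj _ fin] by simp
  thus False by (simp add: k_def)
qed

lemma not_uconnected_G:
  assumes "infinite (ucomponents G)" shows "\<not> uconnected G"
proof
  assume c: "uconnected G"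
  have "ucomponent_of G v = (fst G, {e \<in> snd G. e \<subseteq> fst G})" if "v \<in> fst G" for v
  proof -
    have "{w. ureachable G v w} = fst G"
    proof (intro set_eqI iffI)
      fix w assume "w \<in> {w. ureachable G v w}"
      hence "ureachable G v w" by simp
      from ureachable_in[OF this] show "w \<in> fst G" by blast
    next
      fix w assume "w \<in> fst G"
      thus "w \<in> {w. ureachable G v w}" using c that unfolding uconnected_def by blast
    qed
    thus ?thesis by (simp add: ucomponent_of_def)
  qed
  hence "ucomponents G \<subseteq> {(fst G, {e \<in> snd G. e \<subseteq> fst G})}" by (auto simp: ucomponents_def)
  with assms show False using finite_subset by blast
qed

end

section \<open>Almost sure connectivity and disconnectedness\<close>

lemma AE_same_level_meets:
  assumes "d \<le> 3"
  shows "AE U in N. \<forall>a\<in>L. \<forall>b\<in>L. a d = b d \<longrightarrow> meets U a b"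
proof (intro AE_ball_countable' countable_lattice_points)
  fix a b assume ab [measurable]: "a \<in> L" "b \<in> L"
  show "AE U in N. a d = b d \<longrightarrow> meets U a b"
  proof (cases "a d = b d")
    case True
    have "N.prob {U \<in> space N. \<not> meets U a b} = 0"
      using prob_not_meets[OF ab] g_zero[OF assms, of "diff b a"] True by simp
    hence "{U \<in> space N. \<not> meets U a b} \<in> null_sets N"
      by (intro null_setsI) (simp_all add: N.emeasure_eq_measure)
    hence "AE U in N. meets U a b" by (rule AE_I') auto
    thus ?thesis by eventually_elim simp
  qed simp
qed

lemma prob_meets_le:
  assumes z [measurable]: "z \<in> L" and u: "\<And>n. u n z \<le> B"
  shows "N.prob {U \<in> space N. meets U orig z} \<le> B"
proof -
  define A where "A n = {U \<in> space N. meetsn n U orig z}" for n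
  have "incseq A" unfolding A_def incseq_def by (auto intro: meetsn_mono)
  moreover have "range A \<subseteq> N.events" unfolding A_def by auto
  ultimately have "(\<lambda>n. N.prob (A n)) \<longlonglongrightarrow> N.prob (\<Union>n. A n)"
    by (intro N.finite_Lim_measure_incseq)
  moreover have "(\<Union>n. A n) = {U \<in> space N. meets U orig z}"
    by (auto simp: A_def meets_iff_meetsn)
  ultimately show ?thesis
    using u by (intro LIMSEQ_le_const2[where X = "\<lambda>n. N.prob (A n)"]) (auto simp: A_def u_def)
qed

text \<open>Among \<open>k\<close> points spaced \<open>M\<close> apart along coordinate 1, the
  union bound for a meeting is of order k^2 M^(-1/2). It tends to 0, so almost surely some spacing
  works.\<close>

lemma AE_nonmeeting:
  assumes d4: "d \<ge> 4"
  shows "AE U in N. \<exists>z::nat \<Rightarrow> _. \<forall>i<k. \<forall>j<k. i \<noteq> j \<longrightarrow> \<not> meets U (z i) (z j)"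
proof -
  obtain C where C: "C \<ge> 1" and u: "\<And>n z. z \<in> L \<Longrightarrow> z d = 0 \<Longrightarrow> u n z \<le> C * (rho z + 1) powr (-1/4)"
    using u_bound[OF d4] by blast
  define z where "z M i = orig(1 := int (M * i))" for M i :: nat
  have d1: "d \<noteq> 1" using d4 by simp
  have zL [measurable]: "z M i \<in> L" and zd: "z M i d = 0" for M i
    using d4 by (auto simp: z_def lattice_points_def PiE_iff extensional_def orig_def)
  define E where "E M = {U \<in> space N. \<exists>i<k. \<exists>j<k. i \<noteq> j \<and> meets U (z M i) (z M j)}" for M
  have E [measurable]: "E M \<in> N.events" for M unfolding E_def by measurable
  have rho: "real M ^ 2 \<le> rho (diff (z M j) (z M i))" if "i \<noteq> j" for M i j
  proof -
    have one: "1 \<in> {1..<d}" using d4 by auto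
    have "(of_int (diff (z M j) (z M i) 1))\<^sup>2 \<le> rho (diff (z M j) (z M i))"
      unfolding rho_def using one
      by (intro member_le_sum[where f = "\<lambda>l. (of_int (diff (z M j) (z M i) l))\<^sup>2"]) auto
    moreover have "diff (z M j) (z M i) 1 = int M * (int j - int i)"
      using one by (simp add: diff_def z_def algebra_simps)
    moreover have "1 \<le> (int j - int i)\<^sup>2"
      using that by (cases "int j - int i = 0") (auto simp: int_one_le_iff_zero_less)
    hence "1 \<le> real_of_int ((int j - int i)\<^sup>2)" by (simp only: of_int_1_le_iff)
    hence "real M ^ 2 * 1 \<le> real M ^ 2 * real_of_int ((int j - int i)\<^sup>2)" by (intro mult_left_mono) auto
    ultimately show ?thesis by (simp add: power_mult_distrib)
  qed
  have PE: "N.prob (E M) \<le> real (k * k) * (C * (real M ^ 2 + 1) powr (-1/4))" for M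
  proof -
    define I where "I = {ij \<in> {..<k} \<times> {..<k}. fst ij \<noteq> snd ij}"
    have I: "finite I" "card I \<le> k * k"
      using card_mono[of "{..<k} \<times> {..<k}" I] by (auto simp: I_def card_cartesian_product)
    have "N.prob (E M) \<le> N.prob (\<Union>ij\<in>I. {U \<in> space N. meets U (z M (fst ij)) (z M (snd ij))})"
      by (rule N.finite_measure_mono) (use I in \<open>auto simp: E_def I_def\<close>)
    also have "\<dots> \<le> (\<Sum>ij\<in>I. N.prob {U \<in> space N. meets U (z M (fst ij)) (z M (snd ij))})"
      by (rule N.finite_measure_subadditive_finite) (use I in auto)
    also have "\<dots> \<le> (\<Sum>ij\<in>I. C * (real M ^ 2 + 1) powr (-1/4))"
    proof (rule sum_mono)
      fix ij assume ij: "ij \<in> I"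
      define w where "w = diff (z M (snd ij)) (z M (fst ij))"
      have "N.prob {U \<in> space N. meets U (z M (fst ij)) (z M (snd ij))} = N.prob {U \<in> space N. meets U orig w}"
        unfolding w_def
        by (rule prob_translate[where P = "\<lambda>a b U. meets U a b"])
           (auto simp: meets_iso[OF iso_trans, of orig] zL)
      also have "\<dots> \<le> C * (rho w + 1) powr (-1/4)"
        by (intro prob_meets_le u) (auto simp: w_def zd)
      also have "\<dots> \<le> C * (real M ^ 2 + 1) powr (-1/4)"
        using rho[of "fst ij" "snd ij" M] ij C unfolding w_def
        by (intro mult_left_mono powr_mono2') (auto simp: I_def add_nonneg_pos)
      finally show "N.prob {U \<in> space N. meets U (z M (fst ij)) (z M (snd ij))} \<le> C * (real M ^ 2 + 1) powr (-1/4)" .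
    qed
    also have "\<dots> = real (card I) * (C * (real M ^ 2 + 1) powr (-1/4))" by simp
    also have "\<dots> \<le> real (k * k) * (C * (real M ^ 2 + 1) powr (-1/4))"
      using I(2) C by (intro mult_right_mono) (auto simp del: of_nat_mult)
    finally show ?thesis .
  qed
  have "(\<lambda>M. real (k * k) * (C * (real M ^ 2 + 1) powr (-1/4))) \<longlonglongrightarrow> real (k * k) * (C * 0)"
    by (intro tendsto_intros) real_asymp
  hence lim: "(\<lambda>M. real (k * k) * (C * (real M ^ 2 + 1) powr (-1/4))) \<longlonglongrightarrow> 0" by simp
  have "N.prob (\<Inter>M. E M) \<le> 0"
  proof (rule LIMSEQ_le_const[OF lim], intro exI allI impI)
    fix M
    have "N.prob (\<Inter>M. E M) \<le> N.prob (E M)" by (rule N.finite_measure_mono) auto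
    with PE[of M] show "N.prob (\<Inter>M. E M) \<le> real (k * k) * (C * (real M ^ 2 + 1) powr (-1/4))" by linarith
  qed
  hence "(\<Inter>M. E M) \<in> null_sets N"
    by (intro null_setsI) (auto simp: N.emeasure_eq_measure antisym)
  thus ?thesis
    by (rule AE_I') (auto simp: E_def)
qed

lemma AE_low_dim:
  assumes "d \<le> 3"
  shows "AE U in N. uconnected (dsf_graph d p U) \<and> utree (dsf_graph d p U)"
  using AE_nice AE_same_level_meets[OF assms]
proof eventually_elim
  fix U assume U: "nice U" "\<forall>a\<in>L. \<forall>b\<in>L. a d = b d \<longrightarrow> meets U a b"
  have "uconnected (dsf_graph d p U)" by (rule uconnected_G[OF U(1)]) (use U(2) in blast)
  with uforest_G[OF U(1)] show "uconnected (dsf_graph d p U) \<and> utree (dsf_graph d p U)"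
    by (simp add: utree_def)
qed

lemma AE_high_dim:
  assumes "d \<ge> 4"
  shows "AE U in N. \<not> uconnected (dsf_graph d p U) \<and> uforest (dsf_graph d p U) \<and>
    infinite (ucomponents (dsf_graph d p U)) \<and>
    (\<forall>C\<in>ucomponents (dsf_graph d p U). utree C \<and> infinite (fst C))"
proof -
  have "AE U in N. \<forall>k. \<exists>z::nat \<Rightarrow> _. \<forall>i<k. \<forall>j<k. i \<noteq> j \<longrightarrow> \<not> meets U (z i) (z j)"
    unfolding AE_all_countable using AE_nonmeeting[OF assms] by blast
  with AE_nice show ?thesis
  proof eventually_elim
    fix U assume n: "nice U" and z: "\<forall>k. \<exists>z::nat \<Rightarrow> _. \<forall>i<k. \<forall>j<k. i \<noteq> j \<longrightarrow> \<not> meets U (z i) (z j)"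
    have inf: "infinite (ucomponents (dsf_graph d p U))"
      by (rule infinite_components[OF n]) (use z in blast)
    show "\<not> uconnected (dsf_graph d p U) \<and> uforest (dsf_graph d p U) \<and>
      infinite (ucomponents (dsf_graph d p U)) \<and>
      (\<forall>C\<in>ucomponents (dsf_graph d p U). utree C \<and> infinite (fst C))"
      using inf not_uconnected_G[OF n inf] uforest_G[OF n] utree_ucomponent_of[OF uforest_G[OF n]]
        infinite_component[OF n]
      by (auto simp: ucomponents_def)
  qed
qed

lemma dsf_graph_restrict: "dsf_graph d p (restrict U L) = dsf_graph d p U"
proof -
  have "open_vertices d p (restrict U L) = open_vertices d p U"
    by (auto simp: open_vertices_def)
  moreover have "hop (restrict U L) a b \<longleftrightarrow> hop U a b" for a b
    by (auto intro: hop_cong)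
  hence "successor d p (restrict U L) a = successor d p U a" for a
    by (simp add: successor_def)
  ultimately show ?thesis by (simp add: dsf_graph_def)
qed

text \<open>Independence with uniform marginals identifies the joint law of the family on
  \<open>L\<close> as \<open>N\<close>; \<open>dsf_graph_restrict\<close> bridges the family and its
  restriction to \<open>L\<close>.\<close>

lemma AE_transfer:
  assumes M: "prob_space M" and ind: "prob_space.indep_vars M (\<lambda>_. borel) X L"
    and X: "\<And>v. v \<in> L \<Longrightarrow> distr M borel (X v) = uniform_measure lborel {0<..<1}"
    and P: "AE U in N. P (dsf_graph d p U)"
  shows "AE \<omega> in M. P (dsf_graph d p (\<lambda>v. X v \<omega>))"
proof -
  interpret M: prob_space M by (rule M)
  have "L \<noteq> {}" using orig_L by blast
  have rv: "X v \<in> borel_measurable M" if "v \<in> L" for v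
    using ind that by (auto simp: M.indep_vars_def)
  have "distr M (\<Pi>\<^sub>M v\<in>L. borel) (\<lambda>\<omega>. \<lambda>v\<in>L. X v \<omega>) = (\<Pi>\<^sub>M v\<in>L. distr M borel (X v))"
    using M.indep_vars_iff_distr_eq_PiM'[where X = X and M' = "\<lambda>_. borel" and I = L] \<open>L \<noteq> {}\<close> rv ind
    by blast
  also have "\<dots> = N"
    unfolding N_def using X by (intro PiM_cong refl) (simp add: UU_def)
  finally have "AE U in distr M (\<Pi>\<^sub>M v\<in>L. borel) (\<lambda>\<omega>. \<lambda>v\<in>L. X v \<omega>). P (dsf_graph d p U)"
    by (rule ssubst) (rule P)
  hence "AE \<omega> in M. P (dsf_graph d p (\<lambda>v\<in>L. X v \<omega>))"
    by (rule AE_distrD[rotated]) (intro measurable_restrict rv)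
  thus ?thesis using dsf_graph_restrict[of "\<lambda>v. X v _"] by simp
qed

end

theorem theorem1p1:
  fixes M :: "'w measure" and U :: "(nat \<Rightarrow> int) \<Rightarrow> 'w \<Rightarrow> real" and d :: nat and p :: real
  assumes "prob_space M"
    and "d \<ge> 2"
    and "0 < p" and "p < 1"
    and "prob_space.indep_vars M (\<lambda>_. borel) U (lattice_points d)"
    and "\<And>v. v \<in> lattice_points d \<Longrightarrow>
           distr M borel (U v) = uniform_measure lborel {0<..<1}"
  shows "(d = 2 \<or> d = 3 \<longrightarrow>
           (AE \<omega> in M. uconnected (dsf_graph d p (\<lambda>v. U v \<omega>))
                     \<and> utree (dsf_graph d p (\<lambda>v. U v \<omega>)))) \<and>
         (d \<ge> 4 \<longrightarrow>
           (AE \<omega> in M. \<not> uconnected (dsf_graph d p (\<lambda>v. U v \<omega>))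
                     \<and> uforest (dsf_graph d p (\<lambda>v. U v \<omega>))
                     \<and> infinite (ucomponents (dsf_graph d p (\<lambda>v. U v \<omega>)))
                     \<and> (\<forall>C\<in>ucomponents (dsf_graph d p (\<lambda>v. U v \<omega>)). utree C \<and> infinite (fst C))))"
proof -
  interpret dsf d p by unfold_locales (use assms(2-4) in auto)
  note transfer = AE_transfer[OF assms(1,5,6)]
  show ?thesis
  proof (intro conjI impI)
    assume "d = 2 \<or> d = 3"
    hence "d \<le> 3" by auto
    from transfer[OF _ AE_low_dim[OF this]]
    show "AE \<omega> in M. uconnected (dsf_graph d p (\<lambda>v. U v \<omega>)) \<and> utree (dsf_graph d p (\<lambda>v. U v \<omega>))" .
  next
    assume "d \<ge> 4"
    from transfer[OF _ AE_high_dim[OF this]]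
    show "AE \<omega> in M. \<not> uconnected (dsf_graph d p (\<lambda>v. U v \<omega>))
                     \<and> uforest (dsf_graph d p (\<lambda>v. U v \<omega>))
                     \<and> infinite (ucomponents (dsf_graph d p (\<lambda>v. U v \<omega>)))
                     \<and> (\<forall>C\<in>ucomponents (dsf_graph d p (\<lambda>v. U v \<omega>)). utree C \<and> infinite (fst C))" .
  qed
qed

end
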